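(* For any symmetric monoidal categories $\mathcal A,\mathcal B,\mathcal C,\mathcal D$, the following equality of 1-cells $((\mathcal A\otimes\mathcal B)\otimes\mathcal C)\otimes\mathcal D\to\mathcal A\otimes(\mathcal B\otimes(\mathcal C\otimes\mathcal D))$ holds in $\mathrm{SMC}$: $$A'_{\mathcal A,\mathcal B,\mathcal C\otimes\mathcal D}\circ A'_{\mathcal A\otimes\mathcal B,\mathcal C,\mathcal D}=(1_{\mathcal A}\otimes A'_{\mathcal B,\mathcal C,\mathcal D})\circ A'_{\mathcal A,\mathcal B\otimes\mathcal C,\mathcal D}\circ(A'_{\mathcal A,\mathcal B,\mathcal C}\otimes1_{\mathcal D}).$$
   Context: **Basics.** All symmetric monoidal categories are small, with tensor $\otimes$, unit $I$ and natural isomorphisms $ass_{a,b,c}:a\otimes(b\otimes c)\to(a\otimes b)\otimes c$, $r_a:a\otimes I\to a$, $l_a:I\otimes a\to a$, $s_{a,b}:a\otimes b\to b\otimes a$ satisfying the usual coherence axioms. A symmetric monoidal functor $F:\mathcal A\to\mathcal B$ is a lax one: a functor with an arrow $F^0:I\to F(I)$ and a natural family $F^2_{x,y}:Fx\otimes Fy\to F(x\otimes y)$ satisfying the usual associativity, unit and symmetry axioms; it is strict if $F^0$ and all $F^2_{x,y}$ are identities. $\mathrm{SMC}$ is the 2-category of symmetric monoidal categories, symmetric monoidal functors and monoidal natural transformations. **Internal hom.** $[\mathcal A,\mathcal B]$ is the category $\mathrm{SMC}(\mathcal A,\mathcal B)$ with the pointwise symmetric monoidal structure: $(F\Box G)(a)=Fa\otimes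 Ga$, $(F\Box G)^0$ is $I\cong I\otimes I\xrightarrow{F^0\otimes G^0}F(I)\otimes G(I)$, $(F\Box G)^2_{a,b}$ is the canonical interchange $(Fa\otimes Ga)\otimes(Fb\otimes Gb)\cong(Fa\otimes Fb)\otimes(Ga\otimes Gb)$ followed by $F^2_{a,b}\otimes G^2_{a,b}$; $(\sigma\Box\tau)_a=\sigma_a\otimes\tau_a$; the unit is the constant functor at $I_{\mathcal B}$ (with $I\to I$ the identity and $I\otimes I\to I$ the canonical arrow); $ass,r,l,s$ are pointwise. For $F:\mathcal B\to\mathcal C$, $[\mathcal A,F]:[\mathcal A,\mathcal B]\to[\mathcal A,\mathcal C]$ is $H\mapsto F\circ H$, $\theta\mapsto F*\theta$, with $[\mathcal A,F]^0$ having all components $F^0$ and $[\mathcal A,F]^2_{H,K}$ having component $F^2_{Ha,Ka}$ at $a$; for a 2-cell $\sigma$, $[\mathcal A,\sigma]_H=\sigma*H$. For $F:\mathcal C\to\mathcal A$, $[F,1]:[\mathcal A,\mathcal B]\to[\mathcal C,\mathcal B]$ is precomposition with $F$, which is strict. **Tensor.** $\mathcal A\otimes\mathcal B$ is the following symmetric monoidal category. Its objects are the formal words freely generated from a constant $I$ and symbols $a\otimes b$ ($a$ in $\mathcal A$, $b$ in $\mathcal B$) under a formal binary operation $X\otimes Y$. Its arrows are freely generated, under composition and the operations $p\mapsto X\otimes p$, $p\mapsto p\otimes X$ for objects $X$, by formal arrows $ass,r,l$ (with formal inverses) and $s$ for all objects, and by arrows $\alpha_b:I\to I_{\mathcal A}\otimes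 b$; $\beta_a:I\to a\otimes I_{\mathcal B}$; $\gamma_{a,a',b}:(a\otimes b)\otimes(a'\otimes b)\to(a\otimes a')\otimes b$; $\delta_{a,b,b'}:(a\otimes b)\otimes(a\otimes b')\to a\otimes(b\otimes b')$; $a\otimes g:a\otimes b\to a\otimes b'$ for $g:b\to b'$ in $\mathcal B$; $f\otimes b:a\otimes b\to a'\otimes b$ for $f:a\to a'$ in $\mathcal A$; modulo the smallest congruence, compatible with all $X\otimes-$ and $-\otimes X$, such that: (i) $\otimes$ is a bifunctor and $\otimes,I,ass,r,l,s$ form a symmetric monoidal structure; (ii) for each $a$, $b\mapsto a\otimes b$, $g\mapsto a\otimes g$ with structure $\beta_a$, $\delta_{a,-,-}$ is a symmetric monoidal functor $\eta(a):\mathcal B\to\mathcal A\otimes\mathcal B$; (iii) for each $b$, $a\mapsto a\otimes b$, $f\mapsto f\otimes b$ with structure $\alpha_b$, $\gamma_{-,-,b}$ is a symmetric monoidal functor $\mathcal A\to\mathcal A\otimes\mathcal B$; (iv) for each $f:a\to a'$ the family $(f\otimes b)_b$, and for each $g:b\to b'$ the family $(a\otimes g)_a$, is a monoidal natural transformation between the corresponding functors of (ii), resp. (iii); (v) with $c:I\otimes I\to I$ canonical, $\alpha_{b\otimes b'}\circ c=\delta_{I_{\mathcal A},b,b'}\circ(\alpha_b\otimes\alpha_{b'})$, $\beta_{a\otimes a'}\circ c=\gamma_{a,a',I_{\mathcal B}}\circ(\beta_a\otimes\beta_{a'})$, and $\beta_{I_{\mathcal A}}=\alpha_{I_{\mathcal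 B}}$; (vi) $\gamma_{a,a',b\otimes b'}\circ(\delta_{a,b,b'}\otimes\delta_{a',b,b'})=\delta_{a\otimes a',b,b'}\circ(\gamma_{a,a',b}\otimes\gamma_{a,a',b'})\circ m$, where $m$ is the canonical isomorphism exchanging the two middle factors $a\otimes b'$ and $a'\otimes b$. The symmetric monoidal functor $\eta:\mathcal A\to[\mathcal B,\mathcal A\otimes\mathcal B]$ is $a\mapsto\eta(a)$, $\eta(f)_b=f\otimes b$, $(\eta^0)_b=\alpha_b$, $(\eta^2_{a,a'})_b=\gamma_{a,a',b}$. **$En$ and $Rn$.** For $F:\mathcal A\to[\mathcal B,\mathcal C]$, $En(F):\mathcal A\otimes\mathcal B\to\mathcal C$ is the strict symmetric monoidal functor with $a\otimes b\mapsto F(a)(b)$, $\alpha_b\mapsto(F^0)_b$, $\beta_a\mapsto(Fa)^0$, $\gamma_{a,a',b}\mapsto(F^2_{a,a'})_b$, $\delta_{a,b,b'}\mapsto(Fa)^2_{b,b'}$, $f\otimes b\mapsto F(f)_b$, $a\otimes g\mapsto F(a)(g)$. $Rn:[\mathcal A\otimes\mathcal B,\mathcal C]\to[\mathcal A,[\mathcal B,\mathcal C]]$ is the strict symmetric monoidal functor $F\mapsto[\mathcal B,F]\circ\eta$, $\sigma\mapsto[\mathcal B,\sigma]*\eta$. **Tensor on 1-cells.** For $F:\mathcal A\to\mathcal C$, $F\otimes1_{\mathcal B}=En(\eta\circ F):\mathcal A\otimes\mathcal B\to\mathcal C\otimes\mathcal B$ with $\eta:\mathcal C\to[\mathcal B,\mathcal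 C\otimes\mathcal B]$; for $G:\mathcal B\to\mathcal D$, $1_{\mathcal A}\otimes G=En([G,1]\circ\eta):\mathcal A\otimes\mathcal B\to\mathcal A\otimes\mathcal D$ with $\eta:\mathcal A\to[\mathcal D,\mathcal A\otimes\mathcal D]$. **Associativity arrow.** $A'_{\mathcal A,\mathcal B,\mathcal C}:(\mathcal A\otimes\mathcal B)\otimes\mathcal C\to\mathcal A\otimes(\mathcal B\otimes\mathcal C)$ is $En(En(K))$ where $K$ is the composite $\mathcal A\xrightarrow{\eta}[\mathcal B\otimes\mathcal C,\mathcal A\otimes(\mathcal B\otimes\mathcal C)]\xrightarrow{Rn}[\mathcal B,[\mathcal C,\mathcal A\otimes(\mathcal B\otimes\mathcal C)]]$ (so $En(K):\mathcal A\otimes\mathcal B\to[\mathcal C,\mathcal A\otimes(\mathcal B\otimes\mathcal C)]$). *)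

theory Defs
  imports "HOL-Library.FuncSet"
begin

section \<open>Symmetric monoidal categories\<close>

record ('o, 'a) smcat =
  Obj :: "'o set"
  Arr :: "'a set"
  Dom :: "'a \<Rightarrow> 'o"
  Cod :: "'a \<Rightarrow> 'o"
  Ide :: "'o \<Rightarrow> 'a"
  Comp :: "'a \<Rightarrow> 'a \<Rightarrow> 'a"  (infixl "\<cdot>\<index>" 65)
  Unit :: 'o
  TensO :: "'o \<Rightarrow> 'o \<Rightarrow> 'o"  (infixl "\<otimes>\<index>" 70)
  TensA :: "'a \<Rightarrow> 'a \<Rightarrow> 'a"  (infixl "\<star>\<index>" 70)
  Ass :: "'o \<Rightarrow> 'o \<Rightarrow> 'o \<Rightarrow> 'a"
  Ru :: "'o \<Rightarrow> 'a"
  Lu :: "'o \<Rightarrow> 'a"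
  Sym :: "'o \<Rightarrow> 'o \<Rightarrow> 'a"

definition Hom :: "('o, 'a) smcat \<Rightarrow> 'o \<Rightarrow> 'o \<Rightarrow> 'a set" where
  "Hom C x y = {f \<in> Arr C. Dom C f = x \<and> Cod C f = y}"

definition inverse_arrows :: "('o, 'a) smcat \<Rightarrow> 'a \<Rightarrow> 'a \<Rightarrow> bool" where
  "inverse_arrows C f g \<longleftrightarrow>
     f \<in> Arr C \<and> g \<in> Hom C (Cod C f) (Dom C f) \<and>
     g \<cdot>\<^bsub>C\<^esub> f = Ide C (Dom C f) \<and> f \<cdot>\<^bsub>C\<^esub> g = Ide C (Cod C f)"

definition iso_arr :: "('o, 'a) smcat \<Rightarrow> 'a \<Rightarrow> bool" where
  "iso_arr C f \<longleftrightarrow> (\<exists>g. inverse_arrows C f g)"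

definition inv_arr :: "('o, 'a) smcat \<Rightarrow> 'a \<Rightarrow> 'a" where
  "inv_arr C f = (THE g. inverse_arrows C f g)"

text \<open>Composition is in applicative order: \<open>g \<cdot> f\<close> is \<open>f\<close> followed by \<open>g\<close>.
  The associator goes from \<open>a \<otimes> (b \<otimes> c)\<close> to \<open>(a \<otimes> b) \<otimes> c\<close>.  The values of the
  operations outside the carriers are irrelevant.\<close>

locale smc =
  fixes C :: "('o, 'a) smcat" (structure)
  assumes dom_obj: "f \<in> Arr C \<Longrightarrow> Dom C f \<in> Obj C"
    and cod_obj: "f \<in> Arr C \<Longrightarrow> Cod C f \<in> Obj C"
    and ide_hom: "a \<in> Obj C \<Longrightarrow> Ide C a \<in> Hom C a a"
    and comp_hom: "\<lbrakk>f \<in> Hom C a b; g \<in> Hom C b c\<rbrakk> \<Longrightarrow> g \<cdot> f \<in> Hom C a c"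
    and comp_ide: "f \<in> Hom C a b \<Longrightarrow> f \<cdot> Ide C a = f"
    and ide_comp: "f \<in> Hom C a b \<Longrightarrow> Ide C b \<cdot> f = f"
    and comp_assoc: "\<lbrakk>f \<in> Hom C a b; g \<in> Hom C b c; h \<in> Hom C c d\<rbrakk>
        \<Longrightarrow> h \<cdot> (g \<cdot> f) = (h \<cdot> g) \<cdot> f"
    and unit_obj: "Unit C \<in> Obj C"
    and tens_obj: "\<lbrakk>a \<in> Obj C; b \<in> Obj C\<rbrakk> \<Longrightarrow> a \<otimes> b \<in> Obj C"
    and tens_hom: "\<lbrakk>f \<in> Hom C a a'; g \<in> Hom C b b'\<rbrakk> \<Longrightarrow> f \<star> g \<in> Hom C (a \<otimes> b) (a' \<otimes> b')"
    and tens_ide: "\<lbrakk>a \<in> Obj C; b \<in> Obj C\<rbrakk> \<Longrightarrow> Ide C a \<star> Ide C b = Ide C (a \<otimes> b)"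
    and tens_comp: "\<lbrakk>f \<in> Hom C a b; g \<in> Hom C b c; f' \<in> Hom C a' b'; g' \<in> Hom C b' c'\<rbrakk>
        \<Longrightarrow> (g \<cdot> f) \<star> (g' \<cdot> f') = (g \<star> g') \<cdot> (f \<star> f')"
    and ass_hom: "\<lbrakk>a \<in> Obj C; b \<in> Obj C; c \<in> Obj C\<rbrakk>
        \<Longrightarrow> Ass C a b c \<in> Hom C (a \<otimes> (b \<otimes> c)) ((a \<otimes> b) \<otimes> c)"
    and ru_hom: "a \<in> Obj C \<Longrightarrow> Ru C a \<in> Hom C (a \<otimes> Unit C) a"
    and lu_hom: "a \<in> Obj C \<Longrightarrow> Lu C a \<in> Hom C (Unit C \<otimes> a) a"
    and sym_hom: "\<lbrakk>a \<in> Obj C; b \<in> Obj C\<rbrakk> \<Longrightarrow> Sym C a b \<in> Hom C (a \<otimes> b) (b \<otimes> a)"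
    and ass_iso: "\<lbrakk>a \<in> Obj C; b \<in> Obj C; c \<in> Obj C\<rbrakk> \<Longrightarrow> iso_arr C (Ass C a b c)"
    and ru_iso: "a \<in> Obj C \<Longrightarrow> iso_arr C (Ru C a)"
    and lu_iso: "a \<in> Obj C \<Longrightarrow> iso_arr C (Lu C a)"
    and ass_nat: "\<lbrakk>f \<in> Hom C a a'; g \<in> Hom C b b'; h \<in> Hom C c c'\<rbrakk>
        \<Longrightarrow> Ass C a' b' c' \<cdot> (f \<star> (g \<star> h)) = ((f \<star> g) \<star> h) \<cdot> Ass C a b c"
    and ru_nat: "f \<in> Hom C a a' \<Longrightarrow> Ru C a' \<cdot> (f \<star> Ide C (Unit C)) = f \<cdot> Ru C a"
    and lu_nat: "f \<in> Hom C a a' \<Longrightarrow> Lu C a' \<cdot> (Ide C (Unit C) \<star> f) = f \<cdot> Lu C a"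
    and sym_nat: "\<lbrakk>f \<in> Hom C a a'; g \<in> Hom C b b'\<rbrakk>
        \<Longrightarrow> Sym C a' b' \<cdot> (f \<star> g) = (g \<star> f) \<cdot> Sym C a b"
    and pentagon: "\<lbrakk>a \<in> Obj C; b \<in> Obj C; c \<in> Obj C; d \<in> Obj C\<rbrakk>
        \<Longrightarrow> Ass C (a \<otimes> b) c d \<cdot> Ass C a b (c \<otimes> d)
          = (Ass C a b c \<star> Ide C d) \<cdot> Ass C a (b \<otimes> c) d \<cdot> (Ide C a \<star> Ass C b c d)"
    and triangle: "\<lbrakk>a \<in> Obj C; b \<in> Obj C\<rbrakk>
        \<Longrightarrow> (Ru C a \<star> Ide C b) \<cdot> Ass C a (Unit C) b = Ide C a \<star> Lu C b"
    and ru_lu_unit: "Ru C (Unit C) = Lu C (Unit C)"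
    and sym_sym: "\<lbrakk>a \<in> Obj C; b \<in> Obj C\<rbrakk> \<Longrightarrow> Sym C b a \<cdot> Sym C a b = Ide C (a \<otimes> b)"
    and sym_unit: "a \<in> Obj C \<Longrightarrow> Lu C a \<cdot> Sym C a (Unit C) = Ru C a"
    and hexagon: "\<lbrakk>a \<in> Obj C; b \<in> Obj C; c \<in> Obj C\<rbrakk>
        \<Longrightarrow> Ass C c a b \<cdot> Sym C (a \<otimes> b) c \<cdot> Ass C a b c
          = (Sym C a c \<star> Ide C b) \<cdot> Ass C a c b \<cdot> (Ide C a \<star> Sym C b c)"

text \<open>The canonical interchange \<open>(a \<otimes> b) \<otimes> (c \<otimes> d) \<cong> (a \<otimes> c) \<otimes> (b \<otimes> d)\<close>.\<close>

definition mid :: "('o, 'a) smcat \<Rightarrow> 'o \<Rightarrow> 'o \<Rightarrow> 'o \<Rightarrow> 'o \<Rightarrow> 'a" where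
  "mid C a b c d =
     Ass C a c (b \<otimes>\<^bsub>C\<^esub> d)
     \<cdot>\<^bsub>C\<^esub> (Ide C a \<star>\<^bsub>C\<^esub> inv_arr C (Ass C c b d))
     \<cdot>\<^bsub>C\<^esub> (Ide C a \<star>\<^bsub>C\<^esub> (Sym C b c \<star>\<^bsub>C\<^esub> Ide C d))
     \<cdot>\<^bsub>C\<^esub> (Ide C a \<star>\<^bsub>C\<^esub> Ass C b c d)
     \<cdot>\<^bsub>C\<^esub> inv_arr C (Ass C a b (c \<otimes>\<^bsub>C\<^esub> d))"


section \<open>Symmetric monoidal functors and monoidal transformations\<close>

text \<open>A functor is given by its action on objects and arrows, the arrow \<open>F\<^sup>0\<close> and the
  family \<open>F\<^sup>2\<close>.  All functions are extensional (undefined outside their carriers), so that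
  equality of 1-cells with given source and target is equality of records.\<close>

record ('o, 'a, 'p, 'b) smfun =
  FO :: "'o \<Rightarrow> 'p"
  FA :: "'a \<Rightarrow> 'b"
  F0 :: 'b
  F2 :: "'o \<Rightarrow> 'o \<Rightarrow> 'b"

definition restrict2 :: "('o \<Rightarrow> 'o \<Rightarrow> 'b) \<Rightarrow> 'o set \<Rightarrow> 'o \<Rightarrow> 'o \<Rightarrow> 'b" where
  "restrict2 f S = (\<lambda>x y. if x \<in> S \<and> y \<in> S then f x y else undefined)"

locale sm_functor = A: smc A + B: smc B
  for A :: "('o, 'a) smcat" and B :: "('p, 'b) smcat" +
  fixes F :: "('o, 'a, 'p, 'b) smfun"
  assumes fo_ext: "FO F \<in> extensional (Obj A)"
    and fa_ext: "FA F \<in> extensional (Arr A)"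
    and f2_ext: "F2 F = restrict2 (F2 F) (Obj A)"
    and fo_obj: "x \<in> Obj A \<Longrightarrow> FO F x \<in> Obj B"
    and fa_hom: "f \<in> Hom A x y \<Longrightarrow> FA F f \<in> Hom B (FO F x) (FO F y)"
    and fa_ide: "x \<in> Obj A \<Longrightarrow> FA F (Ide A x) = Ide B (FO F x)"
    and fa_comp: "\<lbrakk>f \<in> Hom A x y; g \<in> Hom A y z\<rbrakk>
        \<Longrightarrow> FA F (g \<cdot>\<^bsub>A\<^esub> f) = FA F g \<cdot>\<^bsub>B\<^esub> FA F f"
    and f0_hom: "F0 F \<in> Hom B (Unit B) (FO F (Unit A))"
    and f2_hom: "\<lbrakk>x \<in> Obj A; y \<in> Obj A\<rbrakk>
        \<Longrightarrow> F2 F x y \<in> Hom B (FO F x \<otimes>\<^bsub>B\<^esub> FO F y) (FO F (x \<otimes>\<^bsub>A\<^esub> y))"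
    and f2_nat: "\<lbrakk>f \<in> Hom A x x'; g \<in> Hom A y y'\<rbrakk>
        \<Longrightarrow> F2 F x' y' \<cdot>\<^bsub>B\<^esub> (FA F f \<star>\<^bsub>B\<^esub> FA F g) = FA F (f \<star>\<^bsub>A\<^esub> g) \<cdot>\<^bsub>B\<^esub> F2 F x y"
    and f_ass: "\<lbrakk>x \<in> Obj A; y \<in> Obj A; z \<in> Obj A\<rbrakk>
        \<Longrightarrow> FA F (Ass A x y z) \<cdot>\<^bsub>B\<^esub> F2 F x (y \<otimes>\<^bsub>A\<^esub> z) \<cdot>\<^bsub>B\<^esub> (Ide B (FO F x) \<star>\<^bsub>B\<^esub> F2 F y z)
          = F2 F (x \<otimes>\<^bsub>A\<^esub> y) z \<cdot>\<^bsub>B\<^esub> (F2 F x y \<star>\<^bsub>B\<^esub> Ide B (FO F z))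
              \<cdot>\<^bsub>B\<^esub> Ass B (FO F x) (FO F y) (FO F z)"
    and f_ru: "x \<in> Obj A
        \<Longrightarrow> FA F (Ru A x) \<cdot>\<^bsub>B\<^esub> F2 F x (Unit A) \<cdot>\<^bsub>B\<^esub> (Ide B (FO F x) \<star>\<^bsub>B\<^esub> F0 F) = Ru B (FO F x)"
    and f_lu: "x \<in> Obj A
        \<Longrightarrow> FA F (Lu A x) \<cdot>\<^bsub>B\<^esub> F2 F (Unit A) x \<cdot>\<^bsub>B\<^esub> (F0 F \<star>\<^bsub>B\<^esub> Ide B (FO F x)) = Lu B (FO F x)"
    and f_sym: "\<lbrakk>x \<in> Obj A; y \<in> Obj A\<rbrakk>
        \<Longrightarrow> FA F (Sym A x y) \<cdot>\<^bsub>B\<^esub> F2 F x y = F2 F y x \<cdot>\<^bsub>B\<^esub> Sym B (FO F x) (FO F y)"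

record ('o, 'a, 'p, 'b) smtrans =
  TDom :: "('o, 'a, 'p, 'b) smfun"
  TCod :: "('o, 'a, 'p, 'b) smfun"
  TC :: "'o \<Rightarrow> 'b"

locale sm_transformation =
  S: sm_functor A B "TDom \<sigma>" + T: sm_functor A B "TCod \<sigma>"
  for A :: "('o, 'a) smcat" and B :: "('p, 'b) smcat" and \<sigma> :: "('o, 'a, 'p, 'b) smtrans" +
  assumes tc_ext: "TC \<sigma> \<in> extensional (Obj A)"
    and tc_hom: "x \<in> Obj A \<Longrightarrow> TC \<sigma> x \<in> Hom B (FO (TDom \<sigma>) x) (FO (TCod \<sigma>) x)"
    and tc_nat: "f \<in> Hom A x y
        \<Longrightarrow> TC \<sigma> y \<cdot>\<^bsub>B\<^esub> FA (TDom \<sigma>) f = FA (TCod \<sigma>) f \<cdot>\<^bsub>B\<^esub> TC \<sigma> x"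
    and tc_unit: "TC \<sigma> (Unit A) \<cdot>\<^bsub>B\<^esub> F0 (TDom \<sigma>) = F0 (TCod \<sigma>)"
    and tc_tens: "\<lbrakk>x \<in> Obj A; y \<in> Obj A\<rbrakk>
        \<Longrightarrow> TC \<sigma> (x \<otimes>\<^bsub>A\<^esub> y) \<cdot>\<^bsub>B\<^esub> F2 (TDom \<sigma>) x y
          = F2 (TCod \<sigma>) x y \<cdot>\<^bsub>B\<^esub> (TC \<sigma> x \<star>\<^bsub>B\<^esub> TC \<sigma> y)"

text \<open>\<open>smf_comp A C G F\<close> is the composite \<open>G \<circ> F : A \<rightarrow> C\<close>.\<close>

definition smf_comp :: "('o, 'a) smcat \<Rightarrow> ('q, 'c) smcat \<Rightarrow> ('p, 'b, 'q, 'c) smfun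
    \<Rightarrow> ('o, 'a, 'p, 'b) smfun \<Rightarrow> ('o, 'a, 'q, 'c) smfun" where
  "smf_comp A C G F =
    \<lparr> FO = (\<lambda>x \<in> Obj A. FO G (FO F x)),
      FA = (\<lambda>f \<in> Arr A. FA G (FA F f)),
      F0 = FA G (F0 F) \<cdot>\<^bsub>C\<^esub> F0 G,
      F2 = restrict2 (\<lambda>x y. FA G (F2 F x y) \<cdot>\<^bsub>C\<^esub> F2 G (FO F x) (FO F y)) (Obj A) \<rparr>"

text \<open>Whiskering of 2-cells: \<open>whisker_fun A C F \<theta>\<close> is \<open>F * \<theta>\<close> for \<open>\<theta> : H \<Rightarrow> K : A \<rightarrow> B\<close> and
  \<open>F : B \<rightarrow> C\<close>; \<open>whisker_trans A C \<sigma> H\<close> is \<open>\<sigma> * H\<close> for \<open>H : A \<rightarrow> B\<close> and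
  \<open>\<sigma> : F \<Rightarrow> G : B \<rightarrow> C\<close>.\<close>

definition whisker_fun :: "('o, 'a) smcat \<Rightarrow> ('q, 'c) smcat \<Rightarrow> ('p, 'b, 'q, 'c) smfun
    \<Rightarrow> ('o, 'a, 'p, 'b) smtrans \<Rightarrow> ('o, 'a, 'q, 'c) smtrans" where
  "whisker_fun A C F \<theta> =
    \<lparr> TDom = smf_comp A C F (TDom \<theta>), TCod = smf_comp A C F (TCod \<theta>),
      TC = (\<lambda>a \<in> Obj A. FA F (TC \<theta> a)) \<rparr>"

definition whisker_trans :: "('o, 'a) smcat \<Rightarrow> ('q, 'c) smcat \<Rightarrow> ('p, 'b, 'q, 'c) smtrans
    \<Rightarrow> ('o, 'a, 'p, 'b) smfun \<Rightarrow> ('o, 'a, 'q, 'c) smtrans" where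
  "whisker_trans A C \<sigma> H =
    \<lparr> TDom = smf_comp A C (TDom \<sigma>) H, TCod = smf_comp A C (TCod \<sigma>) H,
      TC = (\<lambda>a \<in> Obj A. TC \<sigma> (FO H a)) \<rparr>"


section \<open>The internal hom\<close>

definition const_unit :: "('o, 'a) smcat \<Rightarrow> ('p, 'b) smcat \<Rightarrow> ('o, 'a, 'p, 'b) smfun" where
  "const_unit A B =
    \<lparr> FO = (\<lambda>x \<in> Obj A. Unit B),
      FA = (\<lambda>f \<in> Arr A. Ide B (Unit B)),
      F0 = Ide B (Unit B),
      F2 = restrict2 (\<lambda>x y. Ru B (Unit B)) (Obj A) \<rparr>"

definition fun_tens :: "('o, 'a) smcat \<Rightarrow> ('p, 'b) smcat
    \<Rightarrow> ('o, 'a, 'p, 'b) smfun \<Rightarrow> ('o, 'a, 'p, 'b) smfun \<Rightarrow> ('o, 'a, 'p, 'b) smfun" where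
  "fun_tens A B F G =
    \<lparr> FO = (\<lambda>x \<in> Obj A. FO F x \<otimes>\<^bsub>B\<^esub> FO G x),
      FA = (\<lambda>f \<in> Arr A. FA F f \<star>\<^bsub>B\<^esub> FA G f),
      F0 = (F0 F \<star>\<^bsub>B\<^esub> F0 G) \<cdot>\<^bsub>B\<^esub> inv_arr B (Ru B (Unit B)),
      F2 = restrict2 (\<lambda>x y. (F2 F x y \<star>\<^bsub>B\<^esub> F2 G x y)
             \<cdot>\<^bsub>B\<^esub> mid B (FO F x) (FO G x) (FO F y) (FO G y)) (Obj A) \<rparr>"

definition ihom :: "('o, 'a) smcat \<Rightarrow> ('p, 'b) smcat
    \<Rightarrow> (('o, 'a, 'p, 'b) smfun, ('o, 'a, 'p, 'b) smtrans) smcat" where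
  "ihom A B =
    \<lparr> Obj = {F. sm_functor A B F},
      Arr = {\<sigma>. sm_transformation A B \<sigma>},
      Dom = TDom,
      Cod = TCod,
      Ide = (\<lambda>F. \<lparr> TDom = F, TCod = F, TC = (\<lambda>a \<in> Obj A. Ide B (FO F a)) \<rparr>),
      Comp = (\<lambda>\<tau> \<sigma>. \<lparr> TDom = TDom \<sigma>, TCod = TCod \<tau>,
                TC = (\<lambda>a \<in> Obj A. TC \<tau> a \<cdot>\<^bsub>B\<^esub> TC \<sigma> a) \<rparr>),
      Unit = const_unit A B,
      TensO = fun_tens A B,
      TensA = (\<lambda>\<sigma> \<tau>. \<lparr> TDom = fun_tens A B (TDom \<sigma>) (TDom \<tau>),
                 TCod = fun_tens A B (TCod \<sigma>) (TCod \<tau>),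
                 TC = (\<lambda>a \<in> Obj A. TC \<sigma> a \<star>\<^bsub>B\<^esub> TC \<tau> a) \<rparr>),
      Ass = (\<lambda>F G H. \<lparr> TDom = fun_tens A B F (fun_tens A B G H),
               TCod = fun_tens A B (fun_tens A B F G) H,
               TC = (\<lambda>a \<in> Obj A. Ass B (FO F a) (FO G a) (FO H a)) \<rparr>),
      Ru = (\<lambda>F. \<lparr> TDom = fun_tens A B F (const_unit A B), TCod = F,
              TC = (\<lambda>a \<in> Obj A. Ru B (FO F a)) \<rparr>),
      Lu = (\<lambda>F. \<lparr> TDom = fun_tens A B (const_unit A B) F, TCod = F,
              TC = (\<lambda>a \<in> Obj A. Lu B (FO F a)) \<rparr>),
      Sym = (\<lambda>F G. \<lparr> TDom = fun_tens A B F G, TCod = fun_tens A B G F,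
               TC = (\<lambda>a \<in> Obj A. Sym B (FO F a) (FO G a)) \<rparr>) \<rparr>"

text \<open>\<open>postcomp A B C F\<close> is \<open>[A, F] : [A, B] \<rightarrow> [A, C]\<close> for \<open>F : B \<rightarrow> C\<close>, and
  \<open>postcomp_trans A B C \<sigma>\<close> is the 2-cell \<open>[A, \<sigma>]\<close>.\<close>

definition postcomp :: "('o, 'a) smcat \<Rightarrow> ('p, 'b) smcat \<Rightarrow> ('q, 'c) smcat \<Rightarrow> ('p, 'b, 'q, 'c) smfun
    \<Rightarrow> (('o, 'a, 'p, 'b) smfun, ('o, 'a, 'p, 'b) smtrans,
        ('o, 'a, 'q, 'c) smfun, ('o, 'a, 'q, 'c) smtrans) smfun" where
  "postcomp A B C F =
    \<lparr> FO = (\<lambda>H \<in> Obj (ihom A B). smf_comp A C F H),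
      FA = (\<lambda>\<theta> \<in> Arr (ihom A B). whisker_fun A C F \<theta>),
      F0 = \<lparr> TDom = const_unit A C, TCod = smf_comp A C F (const_unit A B),
             TC = (\<lambda>a \<in> Obj A. F0 F) \<rparr>,
      F2 = restrict2 (\<lambda>H K.
             \<lparr> TDom = fun_tens A C (smf_comp A C F H) (smf_comp A C F K),
               TCod = smf_comp A C F (fun_tens A B H K),
               TC = (\<lambda>a \<in> Obj A. F2 F (FO H a) (FO K a)) \<rparr>) (Obj (ihom A B)) \<rparr>"

definition postcomp_trans :: "('o, 'a) smcat \<Rightarrow> ('p, 'b) smcat \<Rightarrow> ('q, 'c) smcat
    \<Rightarrow> ('p, 'b, 'q, 'c) smtrans
    \<Rightarrow> (('o, 'a, 'p, 'b) smfun, ('o, 'a, 'p, 'b) smtrans,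
        ('o, 'a, 'q, 'c) smfun, ('o, 'a, 'q, 'c) smtrans) smtrans" where
  "postcomp_trans A B C \<sigma> =
    \<lparr> TDom = postcomp A B C (TDom \<sigma>), TCod = postcomp A B C (TCod \<sigma>),
      TC = (\<lambda>H \<in> Obj (ihom A B). whisker_trans A C \<sigma> H) \<rparr>"

text \<open>\<open>precomp C A B F\<close> is \<open>[F, 1] : [A, B] \<rightarrow> [C, B]\<close> for \<open>F : C \<rightarrow> A\<close>.\<close>

definition precomp :: "('q, 'c) smcat \<Rightarrow> ('o, 'a) smcat \<Rightarrow> ('p, 'b) smcat \<Rightarrow> ('q, 'c, 'o, 'a) smfun
    \<Rightarrow> (('o, 'a, 'p, 'b) smfun, ('o, 'a, 'p, 'b) smtrans,
        ('q, 'c, 'p, 'b) smfun, ('q, 'c, 'p, 'b) smtrans) smfun" where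
  "precomp C A B F =
    \<lparr> FO = (\<lambda>H \<in> Obj (ihom A B). smf_comp C B H F),
      FA = (\<lambda>\<theta> \<in> Arr (ihom A B). whisker_trans C B \<theta> F),
      F0 = Ide (ihom C B) (const_unit C B),
      F2 = restrict2 (\<lambda>H K. Ide (ihom C B) (fun_tens C B (smf_comp C B H F) (smf_comp C B K F)))
             (Obj (ihom A B)) \<rparr>"


section \<open>The tensor product\<close>

datatype ('o, 'p) tword =
    WUnit
  | WGen 'o 'p
  | WTens "('o, 'p) tword" "('o, 'p) tword"  (infixl "\<otimes>\<^sub>w" 70)

datatype ('o, 'a, 'p, 'b) texp =
    EIde "('o, 'p) tword"
  | EComp "('o, 'a, 'p, 'b) texp" "('o, 'a, 'p, 'b) texp"  (infixl "\<bullet>" 65)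
  | EWhL "('o, 'p) tword" "('o, 'a, 'p, 'b) texp"  (infixr "\<rhd>" 70)
  | EWhR "('o, 'a, 'p, 'b) texp" "('o, 'p) tword"  (infixl "\<lhd>" 70)
  | EAss "('o, 'p) tword" "('o, 'p) tword" "('o, 'p) tword"
  | EAssInv "('o, 'p) tword" "('o, 'p) tword" "('o, 'p) tword"
  | ERu "('o, 'p) tword"
  | ERuInv "('o, 'p) tword"
  | ELu "('o, 'p) tword"
  | ELuInv "('o, 'p) tword"
  | ESym "('o, 'p) tword" "('o, 'p) tword"
  | EAlpha 'p
  | EBeta 'o
  | EGamma 'o 'o 'p
  | EDelta 'o 'p 'p
  | EArrL 'a 'p  \<comment> \<open>the arrow written \<open>f \<otimes> b\<close>\<close>
  | EArrR 'o 'b  \<comment> \<open>the arrow written \<open>a \<otimes> g\<close>\<close>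

primrec wf_word :: "('o, 'a) smcat \<Rightarrow> ('p, 'b) smcat \<Rightarrow> ('o, 'p) tword \<Rightarrow> bool" where
  "wf_word A B WUnit \<longleftrightarrow> True"
| "wf_word A B (WGen a b) \<longleftrightarrow> a \<in> Obj A \<and> b \<in> Obj B"
| "wf_word A B (X \<otimes>\<^sub>w Y) \<longleftrightarrow> wf_word A B X \<and> wf_word A B Y"

primrec edom :: "('o, 'a) smcat \<Rightarrow> ('p, 'b) smcat \<Rightarrow> ('o, 'a, 'p, 'b) texp \<Rightarrow> ('o, 'p) tword" where
  "edom A B (EIde X) = X"
| "edom A B (p \<bullet> q) = edom A B q"
| "edom A B (X \<rhd> p) = X \<otimes>\<^sub>w edom A B p"
| "edom A B (p \<lhd> X) = edom A B p \<otimes>\<^sub>w X"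
| "edom A B (EAss X Y Z) = X \<otimes>\<^sub>w (Y \<otimes>\<^sub>w Z)"
| "edom A B (EAssInv X Y Z) = (X \<otimes>\<^sub>w Y) \<otimes>\<^sub>w Z"
| "edom A B (ERu X) = X \<otimes>\<^sub>w WUnit"
| "edom A B (ERuInv X) = X"
| "edom A B (ELu X) = WUnit \<otimes>\<^sub>w X"
| "edom A B (ELuInv X) = X"
| "edom A B (ESym X Y) = X \<otimes>\<^sub>w Y"
| "edom A B (EAlpha b) = WUnit"
| "edom A B (EBeta a) = WUnit"
| "edom A B (EGamma a a' b) = WGen a b \<otimes>\<^sub>w WGen a' b"
| "edom A B (EDelta a b b') = WGen a b \<otimes>\<^sub>w WGen a b'"
| "edom A B (EArrL f b) = WGen (Dom A f) b"
| "edom A B (EArrR a g) = WGen a (Dom B g)"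

primrec ecod :: "('o, 'a) smcat \<Rightarrow> ('p, 'b) smcat \<Rightarrow> ('o, 'a, 'p, 'b) texp \<Rightarrow> ('o, 'p) tword" where
  "ecod A B (EIde X) = X"
| "ecod A B (p \<bullet> q) = ecod A B p"
| "ecod A B (X \<rhd> p) = X \<otimes>\<^sub>w ecod A B p"
| "ecod A B (p \<lhd> X) = ecod A B p \<otimes>\<^sub>w X"
| "ecod A B (EAss X Y Z) = (X \<otimes>\<^sub>w Y) \<otimes>\<^sub>w Z"
| "ecod A B (EAssInv X Y Z) = X \<otimes>\<^sub>w (Y \<otimes>\<^sub>w Z)"
| "ecod A B (ERu X) = X"
| "ecod A B (ERuInv X) = X \<otimes>\<^sub>w WUnit"
| "ecod A B (ELu X) = X"
| "ecod A B (ELuInv X) = WUnit \<otimes>\<^sub>w X"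
| "ecod A B (ESym X Y) = Y \<otimes>\<^sub>w X"
| "ecod A B (EAlpha b) = WGen (Unit A) b"
| "ecod A B (EBeta a) = WGen a (Unit B)"
| "ecod A B (EGamma a a' b) = WGen (a \<otimes>\<^bsub>A\<^esub> a') b"
| "ecod A B (EDelta a b b') = WGen a (b \<otimes>\<^bsub>B\<^esub> b')"
| "ecod A B (EArrL f b) = WGen (Cod A f) b"
| "ecod A B (EArrR a g) = WGen a (Cod B g)"

primrec wf_exp :: "('o, 'a) smcat \<Rightarrow> ('p, 'b) smcat \<Rightarrow> ('o, 'a, 'p, 'b) texp \<Rightarrow> bool" where
  "wf_exp A B (EIde X) \<longleftrightarrow> wf_word A B X"
| "wf_exp A B (p \<bullet> q) \<longleftrightarrow> wf_exp A B p \<and> wf_exp A B q \<and> edom A B p = ecod A B q"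
| "wf_exp A B (X \<rhd> p) \<longleftrightarrow> wf_word A B X \<and> wf_exp A B p"
| "wf_exp A B (p \<lhd> X) \<longleftrightarrow> wf_exp A B p \<and> wf_word A B X"
| "wf_exp A B (EAss X Y Z) \<longleftrightarrow> wf_word A B X \<and> wf_word A B Y \<and> wf_word A B Z"
| "wf_exp A B (EAssInv X Y Z) \<longleftrightarrow> wf_word A B X \<and> wf_word A B Y \<and> wf_word A B Z"
| "wf_exp A B (ERu X) \<longleftrightarrow> wf_word A B X"
| "wf_exp A B (ERuInv X) \<longleftrightarrow> wf_word A B X"
| "wf_exp A B (ELu X) \<longleftrightarrow> wf_word A B X"
| "wf_exp A B (ELuInv X) \<longleftrightarrow> wf_word A B X"
| "wf_exp A B (ESym X Y) \<longleftrightarrow> wf_word A B X \<and> wf_word A B Y"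
| "wf_exp A B (EAlpha b) \<longleftrightarrow> b \<in> Obj B"
| "wf_exp A B (EBeta a) \<longleftrightarrow> a \<in> Obj A"
| "wf_exp A B (EGamma a a' b) \<longleftrightarrow> a \<in> Obj A \<and> a' \<in> Obj A \<and> b \<in> Obj B"
| "wf_exp A B (EDelta a b b') \<longleftrightarrow> a \<in> Obj A \<and> b \<in> Obj B \<and> b' \<in> Obj B"
| "wf_exp A B (EArrL f b) \<longleftrightarrow> f \<in> Arr A \<and> b \<in> Obj B"
| "wf_exp A B (EArrR a g) \<longleftrightarrow> a \<in> Obj A \<and> g \<in> Arr B"

definition ETens :: "('o, 'a) smcat \<Rightarrow> ('p, 'b) smcat
    \<Rightarrow> ('o, 'a, 'p, 'b) texp \<Rightarrow> ('o, 'a, 'p, 'b) texp \<Rightarrow> ('o, 'a, 'p, 'b) texp" where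
  "ETens A B p q = (p \<lhd> ecod A B q) \<bullet> (edom A B p \<rhd> q)"

definition EMid :: "('o, 'p) tword \<Rightarrow> ('o, 'p) tword \<Rightarrow> ('o, 'p) tword \<Rightarrow> ('o, 'p) tword
    \<Rightarrow> ('o, 'a, 'p, 'b) texp" where
  "EMid X Y Z W =
     EAss X Z (Y \<otimes>\<^sub>w W)
     \<bullet> (X \<rhd> EAssInv Z Y W)
     \<bullet> (X \<rhd> (ESym Y Z \<lhd> W))
     \<bullet> (X \<rhd> EAss Y Z W)
     \<bullet> EAssInv X Y (Z \<otimes>\<^sub>w W)"

text \<open>The defining equations of \<open>A \<otimes> B\<close>.  They carry no side conditions; only their well-formed
  instances are used below.\<close>

inductive tens_eq :: "('o, 'a) smcat \<Rightarrow> ('p, 'b) smcat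
    \<Rightarrow> ('o, 'a, 'p, 'b) texp \<Rightarrow> ('o, 'a, 'p, 'b) texp \<Rightarrow> bool"
  for A :: "('o, 'a) smcat" and B :: "('p, 'b) smcat" where
  \<comment> \<open>category\<close>
  comp_ide: "tens_eq A B (p \<bullet> EIde (edom A B p)) p"
| ide_comp: "tens_eq A B (EIde (ecod A B p) \<bullet> p) p"
| comp_assoc: "tens_eq A B (p \<bullet> (q \<bullet> r)) ((p \<bullet> q) \<bullet> r)"
  \<comment> \<open>bifunctor\<close>
| whl_ide: "tens_eq A B (X \<rhd> EIde Y) (EIde (X \<otimes>\<^sub>w Y))"
| whl_comp: "tens_eq A B (X \<rhd> (p \<bullet> q)) ((X \<rhd> p) \<bullet> (X \<rhd> q))"
| whr_ide: "tens_eq A B (EIde Y \<lhd> X) (EIde (Y \<otimes>\<^sub>w X))"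
| whr_comp: "tens_eq A B ((p \<bullet> q) \<lhd> X) ((p \<lhd> X) \<bullet> (q \<lhd> X))"
| interchange: "tens_eq A B ((p \<lhd> ecod A B q) \<bullet> (edom A B p \<rhd> q))
                            ((ecod A B p \<rhd> q) \<bullet> (p \<lhd> edom A B q))"
  \<comment> \<open>symmetric monoidal structure\<close>
| ass_inv1: "tens_eq A B (EAssInv X Y Z \<bullet> EAss X Y Z) (EIde (X \<otimes>\<^sub>w (Y \<otimes>\<^sub>w Z)))"
| ass_inv2: "tens_eq A B (EAss X Y Z \<bullet> EAssInv X Y Z) (EIde ((X \<otimes>\<^sub>w Y) \<otimes>\<^sub>w Z))"
| ru_inv1: "tens_eq A B (ERuInv X \<bullet> ERu X) (EIde (X \<otimes>\<^sub>w WUnit))"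
| ru_inv2: "tens_eq A B (ERu X \<bullet> ERuInv X) (EIde X)"
| lu_inv1: "tens_eq A B (ELuInv X \<bullet> ELu X) (EIde (WUnit \<otimes>\<^sub>w X))"
| lu_inv2: "tens_eq A B (ELu X \<bullet> ELuInv X) (EIde X)"
| ass_nat: "tens_eq A B (EAss (ecod A B p) (ecod A B q) (ecod A B r) \<bullet> ETens A B p (ETens A B q r))
                        (ETens A B (ETens A B p q) r \<bullet> EAss (edom A B p) (edom A B q) (edom A B r))"
| ru_nat: "tens_eq A B (ERu (ecod A B p) \<bullet> (p \<lhd> WUnit)) (p \<bullet> ERu (edom A B p))"
| lu_nat: "tens_eq A B (ELu (ecod A B p) \<bullet> (WUnit \<rhd> p)) (p \<bullet> ELu (edom A B p))"
| sym_nat: "tens_eq A B (ESym (ecod A B p) (ecod A B q) \<bullet> ETens A B p q)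
                        (ETens A B q p \<bullet> ESym (edom A B p) (edom A B q))"
| pentagon: "tens_eq A B (EAss (X \<otimes>\<^sub>w Y) Z W \<bullet> EAss X Y (Z \<otimes>\<^sub>w W))
                         ((EAss X Y Z \<lhd> W) \<bullet> EAss X (Y \<otimes>\<^sub>w Z) W \<bullet> (X \<rhd> EAss Y Z W))"
| triangle: "tens_eq A B ((ERu X \<lhd> Y) \<bullet> EAss X WUnit Y) (X \<rhd> ELu Y)"
| ru_lu_unit: "tens_eq A B (ERu WUnit) (ELu WUnit)"
| sym_sym: "tens_eq A B (ESym Y X \<bullet> ESym X Y) (EIde (X \<otimes>\<^sub>w Y))"
| sym_unit: "tens_eq A B (ELu X \<bullet> ESym X WUnit) (ERu X)"
| hexagon: "tens_eq A B (EAss Z X Y \<bullet> ESym (X \<otimes>\<^sub>w Y) Z \<bullet> EAss X Y Z)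
                        ((ESym X Z \<lhd> Y) \<bullet> EAss X Z Y \<bullet> (X \<rhd> ESym Y Z))"
  \<comment> \<open>\<open>a \<otimes> -\<close> is a symmetric monoidal functor with structure \<open>\<beta>\<close>, \<open>\<delta>\<close>\<close>
| arrR_ide: "tens_eq A B (EArrR a (Ide B b)) (EIde (WGen a b))"
| arrR_comp: "Cod B g = Dom B g' \<Longrightarrow> tens_eq A B (EArrR a (g' \<cdot>\<^bsub>B\<^esub> g)) (EArrR a g' \<bullet> EArrR a g)"
| delta_nat: "tens_eq A B (EDelta a (Cod B g) (Cod B g') \<bullet> ETens A B (EArrR a g) (EArrR a g'))
                          (EArrR a (g \<star>\<^bsub>B\<^esub> g') \<bullet> EDelta a (Dom B g) (Dom B g'))"
| delta_ass: "tens_eq A B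
    (EArrR a (Ass B b b' b'') \<bullet> EDelta a b (b' \<otimes>\<^bsub>B\<^esub> b'') \<bullet> (WGen a b \<rhd> EDelta a b' b''))
    (EDelta a (b \<otimes>\<^bsub>B\<^esub> b') b'' \<bullet> (EDelta a b b' \<lhd> WGen a b'') \<bullet> EAss (WGen a b) (WGen a b') (WGen a b''))"
| delta_ru: "tens_eq A B (EArrR a (Ru B b) \<bullet> EDelta a b (Unit B) \<bullet> (WGen a b \<rhd> EBeta a)) (ERu (WGen a b))"
| delta_lu: "tens_eq A B (EArrR a (Lu B b) \<bullet> EDelta a (Unit B) b \<bullet> (EBeta a \<lhd> WGen a b)) (ELu (WGen a b))"
| delta_sym: "tens_eq A B (EArrR a (Sym B b b') \<bullet> EDelta a b b')
                          (EDelta a b' b \<bullet> ESym (WGen a b) (WGen a b'))"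
  \<comment> \<open>\<open>- \<otimes> b\<close> is a symmetric monoidal functor with structure \<open>\<alpha>\<close>, \<open>\<gamma>\<close>\<close>
| arrL_ide: "tens_eq A B (EArrL (Ide A a) b) (EIde (WGen a b))"
| arrL_comp: "Cod A f = Dom A f' \<Longrightarrow> tens_eq A B (EArrL (f' \<cdot>\<^bsub>A\<^esub> f) b) (EArrL f' b \<bullet> EArrL f b)"
| gamma_nat: "tens_eq A B (EGamma (Cod A f) (Cod A f') b \<bullet> ETens A B (EArrL f b) (EArrL f' b))
                          (EArrL (f \<star>\<^bsub>A\<^esub> f') b \<bullet> EGamma (Dom A f) (Dom A f') b)"
| gamma_ass: "tens_eq A B
    (EArrL (Ass A a a' a'') b \<bullet> EGamma a (a' \<otimes>\<^bsub>A\<^esub> a'') b \<bullet> (WGen a b \<rhd> EGamma a' a'' b))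
    (EGamma (a \<otimes>\<^bsub>A\<^esub> a') a'' b \<bullet> (EGamma a a' b \<lhd> WGen a'' b) \<bullet> EAss (WGen a b) (WGen a' b) (WGen a'' b))"
| gamma_ru: "tens_eq A B (EArrL (Ru A a) b \<bullet> EGamma a (Unit A) b \<bullet> (WGen a b \<rhd> EAlpha b)) (ERu (WGen a b))"
| gamma_lu: "tens_eq A B (EArrL (Lu A a) b \<bullet> EGamma (Unit A) a b \<bullet> (EAlpha b \<lhd> WGen a b)) (ELu (WGen a b))"
| gamma_sym: "tens_eq A B (EArrL (Sym A a a') b \<bullet> EGamma a a' b)
                          (EGamma a' a b \<bullet> ESym (WGen a b) (WGen a' b))"
  \<comment> \<open>\<open>f \<otimes> -\<close> and \<open>- \<otimes> g\<close> are monoidal natural transformations; the two naturality conditions coincide\<close>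
| arr_nat: "tens_eq A B (EArrL f (Cod B g) \<bullet> EArrR (Dom A f) g) (EArrR (Cod A f) g \<bullet> EArrL f (Dom B g))"
| arrL_unit: "tens_eq A B (EArrL f (Unit B) \<bullet> EBeta (Dom A f)) (EBeta (Cod A f))"
| arrL_tens: "tens_eq A B (EArrL f (b \<otimes>\<^bsub>B\<^esub> b') \<bullet> EDelta (Dom A f) b b')
                          (EDelta (Cod A f) b b' \<bullet> ETens A B (EArrL f b) (EArrL f b'))"
| arrR_unit: "tens_eq A B (EArrR (Unit A) g \<bullet> EAlpha (Dom B g)) (EAlpha (Cod B g))"
| arrR_tens: "tens_eq A B (EArrR (a \<otimes>\<^bsub>A\<^esub> a') g \<bullet> EGamma a a' (Dom B g))
                          (EGamma a a' (Cod B g) \<bullet> ETens A B (EArrR a g) (EArrR a' g))"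
  \<comment> \<open>compatibility of the two structures\<close>
| alpha_tens: "tens_eq A B (EAlpha (b \<otimes>\<^bsub>B\<^esub> b') \<bullet> ERu WUnit)
                           (EDelta (Unit A) b b' \<bullet> ETens A B (EAlpha b) (EAlpha b'))"
| beta_tens: "tens_eq A B (EBeta (a \<otimes>\<^bsub>A\<^esub> a') \<bullet> ERu WUnit)
                          (EGamma a a' (Unit B) \<bullet> ETens A B (EBeta a) (EBeta a'))"
| beta_alpha: "tens_eq A B (EBeta (Unit A)) (EAlpha (Unit B))"
| gamma_delta: "tens_eq A B
    (EGamma a a' (b \<otimes>\<^bsub>B\<^esub> b') \<bullet> ETens A B (EDelta a b b') (EDelta a' b b'))
    (EDelta (a \<otimes>\<^bsub>A\<^esub> a') b b' \<bullet> ETens A B (EGamma a a' b) (EGamma a a' b')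
       \<bullet> EMid (WGen a b) (WGen a b') (WGen a' b) (WGen a' b'))"

inductive tens_cong :: "('o, 'a) smcat \<Rightarrow> ('p, 'b) smcat
    \<Rightarrow> ('o, 'a, 'p, 'b) texp \<Rightarrow> ('o, 'a, 'p, 'b) texp \<Rightarrow> bool"
  for A :: "('o, 'a) smcat" and B :: "('p, 'b) smcat" where
  base: "\<lbrakk>tens_eq A B p q; wf_exp A B p; wf_exp A B q\<rbrakk> \<Longrightarrow> tens_cong A B p q"
| refl: "wf_exp A B p \<Longrightarrow> tens_cong A B p p"
| sym: "tens_cong A B p q \<Longrightarrow> tens_cong A B q p"
| trans: "\<lbrakk>tens_cong A B p q; tens_cong A B q r\<rbrakk> \<Longrightarrow> tens_cong A B p r"
| comp: "\<lbrakk>tens_cong A B p p'; tens_cong A B q q'; edom A B p = ecod A B q\<rbrakk>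
    \<Longrightarrow> tens_cong A B (p \<bullet> q) (p' \<bullet> q')"
| whl: "\<lbrakk>wf_word A B X; tens_cong A B p q\<rbrakk> \<Longrightarrow> tens_cong A B (X \<rhd> p) (X \<rhd> q)"
| whr: "\<lbrakk>wf_word A B X; tens_cong A B p q\<rbrakk> \<Longrightarrow> tens_cong A B (p \<lhd> X) (q \<lhd> X)"

definition ecls :: "('o, 'a) smcat \<Rightarrow> ('p, 'b) smcat
    \<Rightarrow> ('o, 'a, 'p, 'b) texp \<Rightarrow> ('o, 'a, 'p, 'b) texp set" where
  "ecls A B p = {q. tens_cong A B p q}"

definition erep :: "('o, 'a, 'p, 'b) texp set \<Rightarrow> ('o, 'a, 'p, 'b) texp" where
  "erep P = (SOME p. p \<in> P)"

text \<open>Arrows of \<open>A \<otimes> B\<close> are congruence classes of well-formed expressions; operations on classes are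
  computed on chosen representatives.\<close>

definition tens :: "('o, 'a) smcat \<Rightarrow> ('p, 'b) smcat
    \<Rightarrow> (('o, 'p) tword, ('o, 'a, 'p, 'b) texp set) smcat"  (infixl "\<boxtimes>" 70) where
  "A \<boxtimes> B =
    \<lparr> Obj = {X. wf_word A B X},
      Arr = ecls A B ` {p. wf_exp A B p},
      Dom = (\<lambda>P. edom A B (erep P)),
      Cod = (\<lambda>P. ecod A B (erep P)),
      Ide = (\<lambda>X. ecls A B (EIde X)),
      Comp = (\<lambda>P Q. ecls A B (erep P \<bullet> erep Q)),
      Unit = WUnit,
      TensO = (\<otimes>\<^sub>w),
      TensA = (\<lambda>P Q. ecls A B (ETens A B (erep P) (erep Q))),
      Ass = (\<lambda>X Y Z. ecls A B (EAss X Y Z)),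
      Ru = (\<lambda>X. ecls A B (ERu X)),
      Lu = (\<lambda>X. ecls A B (ELu X)),
      Sym = (\<lambda>X Y. ecls A B (ESym X Y)) \<rparr>"

definition eta_obj :: "('o, 'a) smcat \<Rightarrow> ('p, 'b) smcat \<Rightarrow> 'o
    \<Rightarrow> ('p, 'b, ('o, 'p) tword, ('o, 'a, 'p, 'b) texp set) smfun" where
  "eta_obj A B a =
    \<lparr> FO = (\<lambda>b \<in> Obj B. WGen a b),
      FA = (\<lambda>g \<in> Arr B. ecls A B (EArrR a g)),
      F0 = ecls A B (EBeta a),
      F2 = restrict2 (\<lambda>b b'. ecls A B (EDelta a b b')) (Obj B) \<rparr>"

text \<open>\<open>eta A B : A \<rightarrow> [B, A \<otimes> B]\<close>\<close>

definition eta :: "('o, 'a) smcat \<Rightarrow> ('p, 'b) smcat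
    \<Rightarrow> ('o, 'a, ('p, 'b, ('o, 'p) tword, ('o, 'a, 'p, 'b) texp set) smfun,
                ('p, 'b, ('o, 'p) tword, ('o, 'a, 'p, 'b) texp set) smtrans) smfun" where
  "eta A B =
    \<lparr> FO = (\<lambda>a \<in> Obj A. eta_obj A B a),
      FA = (\<lambda>f \<in> Arr A.
             \<lparr> TDom = eta_obj A B (Dom A f), TCod = eta_obj A B (Cod A f),
               TC = (\<lambda>b \<in> Obj B. ecls A B (EArrL f b)) \<rparr>),
      F0 = \<lparr> TDom = const_unit B (A \<boxtimes> B), TCod = eta_obj A B (Unit A),
             TC = (\<lambda>b \<in> Obj B. ecls A B (EAlpha b)) \<rparr>,
      F2 = restrict2 (\<lambda>a a'.
             \<lparr> TDom = fun_tens B (A \<boxtimes> B) (eta_obj A B a) (eta_obj A B a'),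
               TCod = eta_obj A B (a \<otimes>\<^bsub>A\<^esub> a'),
               TC = (\<lambda>b \<in> Obj B. ecls A B (EGamma a a' b)) \<rparr>) (Obj A) \<rparr>"


section \<open>The functors \<open>En\<close> and \<open>Rn\<close>\<close>

text \<open>For \<open>F : A \<rightarrow> [B, C]\<close>, \<open>En A B C F : A \<otimes> B \<rightarrow> C\<close> is defined by recursion on formal words and
  expressions, evaluated at a representative of each class of expressions.\<close>

primrec en_word :: "('q, 'c) smcat
    \<Rightarrow> ('o, 'a, ('p, 'b, 'q, 'c) smfun, ('p, 'b, 'q, 'c) smtrans) smfun
    \<Rightarrow> ('o, 'p) tword \<Rightarrow> 'q" where
  "en_word C F WUnit = Unit C"
| "en_word C F (WGen a b) = FO (FO F a) b"
| "en_word C F (X \<otimes>\<^sub>w Y) = en_word C F X \<otimes>\<^bsub>C\<^esub> en_word C F Y"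

primrec en_exp :: "('q, 'c) smcat
    \<Rightarrow> ('o, 'a, ('p, 'b, 'q, 'c) smfun, ('p, 'b, 'q, 'c) smtrans) smfun
    \<Rightarrow> ('o, 'a, 'p, 'b) texp \<Rightarrow> 'c" where
  "en_exp C F (EIde X) = Ide C (en_word C F X)"
| "en_exp C F (p \<bullet> q) = en_exp C F p \<cdot>\<^bsub>C\<^esub> en_exp C F q"
| "en_exp C F (X \<rhd> p) = Ide C (en_word C F X) \<star>\<^bsub>C\<^esub> en_exp C F p"
| "en_exp C F (p \<lhd> X) = en_exp C F p \<star>\<^bsub>C\<^esub> Ide C (en_word C F X)"
| "en_exp C F (EAss X Y Z) = Ass C (en_word C F X) (en_word C F Y) (en_word C F Z)"
| "en_exp C F (EAssInv X Y Z) = inv_arr C (Ass C (en_word C F X) (en_word C F Y) (en_word C F Z))"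
| "en_exp C F (ERu X) = Ru C (en_word C F X)"
| "en_exp C F (ERuInv X) = inv_arr C (Ru C (en_word C F X))"
| "en_exp C F (ELu X) = Lu C (en_word C F X)"
| "en_exp C F (ELuInv X) = inv_arr C (Lu C (en_word C F X))"
| "en_exp C F (ESym X Y) = Sym C (en_word C F X) (en_word C F Y)"
| "en_exp C F (EAlpha b) = TC (F0 F) b"
| "en_exp C F (EBeta a) = F0 (FO F a)"
| "en_exp C F (EGamma a a' b) = TC (F2 F a a') b"
| "en_exp C F (EDelta a b b') = F2 (FO F a) b b'"
| "en_exp C F (EArrL f b) = TC (FA F f) b"
| "en_exp C F (EArrR a g) = FA (FO F a) g"

definition En :: "('o, 'a) smcat \<Rightarrow> ('p, 'b) smcat \<Rightarrow> ('q, 'c) smcat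
    \<Rightarrow> ('o, 'a, ('p, 'b, 'q, 'c) smfun, ('p, 'b, 'q, 'c) smtrans) smfun
    \<Rightarrow> (('o, 'p) tword, ('o, 'a, 'p, 'b) texp set, 'q, 'c) smfun" where
  "En A B C F =
    \<lparr> FO = (\<lambda>X \<in> Obj (A \<boxtimes> B). en_word C F X),
      FA = (\<lambda>P \<in> Arr (A \<boxtimes> B). en_exp C F (erep P)),
      F0 = Ide C (Unit C),
      F2 = restrict2 (\<lambda>X Y. Ide C (en_word C F X \<otimes>\<^bsub>C\<^esub> en_word C F Y)) (Obj (A \<boxtimes> B)) \<rparr>"

text \<open>\<open>Rn A B C : [A \<otimes> B, C] \<rightarrow> [A, [B, C]]\<close>\<close>

definition Rn :: "('o, 'a) smcat \<Rightarrow> ('p, 'b) smcat \<Rightarrow> ('q, 'c) smcat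
    \<Rightarrow> ((('o, 'p) tword, ('o, 'a, 'p, 'b) texp set, 'q, 'c) smfun,
        (('o, 'p) tword, ('o, 'a, 'p, 'b) texp set, 'q, 'c) smtrans,
        ('o, 'a, ('p, 'b, 'q, 'c) smfun, ('p, 'b, 'q, 'c) smtrans) smfun,
        ('o, 'a, ('p, 'b, 'q, 'c) smfun, ('p, 'b, 'q, 'c) smtrans) smtrans) smfun" where
  "Rn A B C =
    (let rn = (\<lambda>F. smf_comp A (ihom B C) (postcomp B (A \<boxtimes> B) C F) (eta A B)) in
    \<lparr> FO = (\<lambda>F \<in> Obj (ihom (A \<boxtimes> B) C). rn F),
      FA = (\<lambda>\<sigma> \<in> Arr (ihom (A \<boxtimes> B) C).
             whisker_trans A (ihom B C) (postcomp_trans B (A \<boxtimes> B) C \<sigma>) (eta A B)),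
      F0 = Ide (ihom A (ihom B C)) (const_unit A (ihom B C)),
      F2 = restrict2 (\<lambda>F G. Ide (ihom A (ihom B C)) (fun_tens A (ihom B C) (rn F) (rn G)))
             (Obj (ihom (A \<boxtimes> B) C)) \<rparr>)"


section \<open>Tensor on 1-cells and the associativity arrow\<close>

text \<open>\<open>tens_fun_id A B C F\<close> is \<open>F \<otimes> 1\<^sub>B : A \<otimes> B \<rightarrow> C \<otimes> B\<close> for \<open>F : A \<rightarrow> C\<close>, and
  \<open>tens_id_fun A B D G\<close> is \<open>1\<^sub>A \<otimes> G : A \<otimes> B \<rightarrow> A \<otimes> D\<close> for \<open>G : B \<rightarrow> D\<close>.\<close>

definition tens_fun_id :: "('o, 'a) smcat \<Rightarrow> ('p, 'b) smcat \<Rightarrow> ('q, 'c) smcat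
    \<Rightarrow> ('o, 'a, 'q, 'c) smfun
    \<Rightarrow> (('o, 'p) tword, ('o, 'a, 'p, 'b) texp set, ('q, 'p) tword, ('q, 'c, 'p, 'b) texp set) smfun"
  where
  "tens_fun_id A B C F = En A B (C \<boxtimes> B) (smf_comp A (ihom B (C \<boxtimes> B)) (eta C B) F)"

definition tens_id_fun :: "('o, 'a) smcat \<Rightarrow> ('p, 'b) smcat \<Rightarrow> ('q, 'c) smcat
    \<Rightarrow> ('p, 'b, 'q, 'c) smfun
    \<Rightarrow> (('o, 'p) tword, ('o, 'a, 'p, 'b) texp set, ('o, 'q) tword, ('o, 'a, 'q, 'c) texp set) smfun"
  where
  "tens_id_fun A B D G =
     En A B (A \<boxtimes> D) (smf_comp A (ihom B (A \<boxtimes> D)) (precomp B D (A \<boxtimes> D) G) (eta A D))"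

definition assoc_fun :: "('o, 'a) smcat \<Rightarrow> ('p, 'b) smcat \<Rightarrow> ('q, 'c) smcat
    \<Rightarrow> ((('o, 'p) tword, 'q) tword, (('o, 'p) tword, ('o, 'a, 'p, 'b) texp set, 'q, 'c) texp set,
        ('o, ('p, 'q) tword) tword, ('o, 'a, ('p, 'q) tword, ('p, 'b, 'q, 'c) texp set) texp set) smfun"
  where
  "assoc_fun A B C =
    (let X = A \<boxtimes> (B \<boxtimes> C);
         K = smf_comp A (ihom B (ihom C X)) (Rn B C X) (eta A (B \<boxtimes> C))
     in En (A \<boxtimes> B) C X (En A B (ihom C X) K))"

end

(* A strict functor H out of a tensor product is determined by its values on generators, that is, by
   the functor Rn H obtained by currying, and Rn (En F) = F.  Both sides of the claim are strict
   composites, so it suffices to compare them after currying three times, as functors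
   A -> [B, [C, [D, T]]] into the common target T.  Since currying turns G H
   into [1, G] (Rn H) and Rn is natural,
   the left-hand side becomes [B, Rn] Rn eta and the right-hand side Rn Rn [A', 1] eta, where A' is the
   associativity arrow of B, C, D; these agree because Rn (Rn (H A')) and [1, Rn] (Rn H) are both
   [1, [1, H]] applied to the doubly curried A'.

   The equations for the canonical interchange, on which the internal hom depends, are proved by a
   fragment of coherence for symmetric monoidal categories. *)

theory Submission
  imports Defs
begin

section \<open>Symmetric monoidal categories in untyped style\<close>

text \<open>The claim is an equality of records between functors whose arrow part acts on congruence
  classes. Compared directly, the two sides would have to be followed on six kinds of generating
  arrows, whose entries are again classes, through three nested tensor products; after currying,
  each generator becomes a component of some structure map in an iterated internal hom. The price is
  that currying is injective on strict functors: functors that are not strict may agree on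
  generators and differ at composite words. Hence every functor met between two curryings has to be
  shown strict, and for this \<open>En F\<close>, \<open>Rn\<close>, \<open>[F, 1]\<close>, and
  \<open>[A, F]\<close> for strict \<open>F\<close> are shown to be strict. The last comparison
  takes place after a copy of \<open>eta\<close>, whose structure maps are 2-cells; so it is an
  equality of functors on a whole internal hom, to be checked on 2-cells as well as on 1-cells. The
  interchange enters because the tensor of two functors has \<open>mid\<close> in its
  \<open>F2\<close>; even the symmetric monoidal structure of \<open>ihom A B\<close> rests on
  equations between composites of \<open>mid\<close>.\<close>

lemma Hom_iff: "f \<in> Hom C a b \<longleftrightarrow> f \<in> Arr C \<and> Dom C f = a \<and> Cod C f = b"
  by (auto simp: Hom_def)

context smc
begin

declare dom_obj [simp] cod_obj [simp] unit_obj [simp] tens_obj [simp]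

lemma ide_arr [simp]: "a \<in> Obj C \<Longrightarrow> Ide C a \<in> Arr C"
  and dom_ide [simp]: "a \<in> Obj C \<Longrightarrow> Dom C (Ide C a) = a"
  and cod_ide [simp]: "a \<in> Obj C \<Longrightarrow> Cod C (Ide C a) = a"
  using ide_hom[of a] by (auto simp: Hom_iff)

lemma comp_arr [simp]: "\<lbrakk>g \<in> Arr C; f \<in> Arr C; Dom C g = Cod C f\<rbrakk> \<Longrightarrow> g \<cdot> f \<in> Arr C"
  and dom_comp [simp]: "\<lbrakk>g \<in> Arr C; f \<in> Arr C; Dom C g = Cod C f\<rbrakk> \<Longrightarrow> Dom C (g \<cdot> f) = Dom C f"
  and cod_comp [simp]: "\<lbrakk>g \<in> Arr C; f \<in> Arr C; Dom C g = Cod C f\<rbrakk> \<Longrightarrow> Cod C (g \<cdot> f) = Cod C g"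
  using comp_hom[of f "Dom C f" "Cod C f" g "Cod C g"] by (auto simp: Hom_iff)

lemma comp_ide' [simp]: "\<lbrakk>f \<in> Arr C; Dom C f = a\<rbrakk> \<Longrightarrow> f \<cdot> Ide C a = f"
  using comp_ide[of f a "Cod C f"] by (auto simp: Hom_iff)

lemma ide_comp' [simp]: "\<lbrakk>f \<in> Arr C; Cod C f = a\<rbrakk> \<Longrightarrow> Ide C a \<cdot> f = f"
  using ide_comp[of f "Dom C f" a] by (auto simp: Hom_iff)

text \<open>Composites are kept nested to the right throughout.\<close>

lemma comp_assoc' [simp]:
  "\<lbrakk>h \<in> Arr C; g \<in> Arr C; f \<in> Arr C; Dom C h = Cod C g; Dom C g = Cod C f\<rbrakk>
    \<Longrightarrow> (h \<cdot> g) \<cdot> f = h \<cdot> (g \<cdot> f)"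
  using comp_assoc[of f "Dom C f" "Cod C f" g "Cod C g" h "Cod C h"] by (auto simp: Hom_iff)

lemma tens_arr [simp]: "\<lbrakk>f \<in> Arr C; g \<in> Arr C\<rbrakk> \<Longrightarrow> f \<star> g \<in> Arr C"
  and dom_tens [simp]: "\<lbrakk>f \<in> Arr C; g \<in> Arr C\<rbrakk> \<Longrightarrow> Dom C (f \<star> g) = Dom C f \<otimes> Dom C g"
  and cod_tens [simp]: "\<lbrakk>f \<in> Arr C; g \<in> Arr C\<rbrakk> \<Longrightarrow> Cod C (f \<star> g) = Cod C f \<otimes> Cod C g"
  using tens_hom[of f "Dom C f" "Cod C f" g "Dom C g" "Cod C g"] by (auto simp: Hom_iff)

declare tens_ide [simp]

lemma merge:
  "\<lbrakk>g \<in> Arr C; f \<in> Arr C; Dom C g = Cod C f; g' \<in> Arr C; f' \<in> Arr C; Dom C g' = Cod C f'\<rbrakk>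
    \<Longrightarrow> (g \<star> g') \<cdot> (f \<star> f') = (g \<cdot> f) \<star> (g' \<cdot> f')"
  using tens_comp[of f "Dom C f" "Cod C f" g "Cod C g" f' "Dom C f'" "Cod C f'" g' "Cod C g'"]
  by (auto simp: Hom_iff)

text \<open>The suffix \<open>_r\<close> marks the version of a rule that fires inside a composite
  nested to the right, where a further factor \<open>k\<close> follows the two that are
  rewritten.\<close>

lemma merge_r:
  "\<lbrakk>g \<in> Arr C; f \<in> Arr C; Dom C g = Cod C f; g' \<in> Arr C; f' \<in> Arr C; Dom C g' = Cod C f';
    k \<in> Arr C; Cod C k = Dom C f \<otimes> Dom C f'\<rbrakk>
    \<Longrightarrow> (g \<star> g') \<cdot> ((f \<star> f') \<cdot> k) = ((g \<cdot> f) \<star> (g' \<cdot> f')) \<cdot> k"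
  by (simp flip: comp_assoc' merge)

lemma ass_arr [simp]: "\<lbrakk>a \<in> Obj C; b \<in> Obj C; c \<in> Obj C\<rbrakk> \<Longrightarrow> Ass C a b c \<in> Arr C"
  and dom_ass [simp]: "\<lbrakk>a \<in> Obj C; b \<in> Obj C; c \<in> Obj C\<rbrakk> \<Longrightarrow> Dom C (Ass C a b c) = a \<otimes> (b \<otimes> c)"
  and cod_ass [simp]: "\<lbrakk>a \<in> Obj C; b \<in> Obj C; c \<in> Obj C\<rbrakk> \<Longrightarrow> Cod C (Ass C a b c) = (a \<otimes> b) \<otimes> c"
  using ass_hom[of a b c] by (auto simp: Hom_iff)

lemma ru_arr [simp]: "a \<in> Obj C \<Longrightarrow> Ru C a \<in> Arr C"
  and dom_ru [simp]: "a \<in> Obj C \<Longrightarrow> Dom C (Ru C a) = a \<otimes> Unit C"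
  and cod_ru [simp]: "a \<in> Obj C \<Longrightarrow> Cod C (Ru C a) = a"
  using ru_hom[of a] by (auto simp: Hom_iff)

lemma lu_arr [simp]: "a \<in> Obj C \<Longrightarrow> Lu C a \<in> Arr C"
  and dom_lu [simp]: "a \<in> Obj C \<Longrightarrow> Dom C (Lu C a) = Unit C \<otimes> a"
  and cod_lu [simp]: "a \<in> Obj C \<Longrightarrow> Cod C (Lu C a) = a"
  using lu_hom[of a] by (auto simp: Hom_iff)

lemma sym_arr [simp]: "\<lbrakk>a \<in> Obj C; b \<in> Obj C\<rbrakk> \<Longrightarrow> Sym C a b \<in> Arr C"
  and dom_sym [simp]: "\<lbrakk>a \<in> Obj C; b \<in> Obj C\<rbrakk> \<Longrightarrow> Dom C (Sym C a b) = a \<otimes> b"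
  and cod_sym [simp]: "\<lbrakk>a \<in> Obj C; b \<in> Obj C\<rbrakk> \<Longrightarrow> Cod C (Sym C a b) = b \<otimes> a"
  using sym_hom[of a b] by (auto simp: Hom_iff)

section \<open>Inverses and isomorphisms\<close>

lemma inverse_arrows_unique:
  assumes "inverse_arrows C f g" "inverse_arrows C f h" shows "g = h"
proof -
  have *: "g \<in> Arr C" "h \<in> Arr C" "f \<in> Arr C" "Dom C g = Cod C f" "Dom C h = Cod C f"
    "Cod C g = Dom C f" "Cod C h = Dom C f" "g \<cdot> f = Ide C (Dom C f)" "f \<cdot> h = Ide C (Cod C f)"
    using assms by (auto simp: inverse_arrows_def Hom_iff)
  have "g = g \<cdot> (f \<cdot> h)" using * by (metis comp_ide')
  also have "\<dots> = (g \<cdot> f) \<cdot> h" using * by (metis comp_assoc')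
  also have "\<dots> = h" using * by (metis ide_comp')
  finally show ?thesis .
qed

lemma inv_arr_eq: "inverse_arrows C f g \<Longrightarrow> inv_arr C f = g"
  unfolding inv_arr_def using inverse_arrows_unique by (blast intro: the_equality)

lemma inverse_arrows_inv: "iso_arr C f \<Longrightarrow> inverse_arrows C f (inv_arr C f)"
  unfolding iso_arr_def using inv_arr_eq by auto

lemma inverse_arrowsI:
  "\<lbrakk>f \<in> Arr C; g \<in> Arr C; Dom C g = Cod C f; Cod C g = Dom C f;
    g \<cdot> f = Ide C (Dom C f); f \<cdot> g = Ide C (Cod C f)\<rbrakk> \<Longrightarrow> inverse_arrows C f g"
  by (auto simp: inverse_arrows_def Hom_iff)

lemma iso_arr_arr: "iso_arr C f \<Longrightarrow> f \<in> Arr C"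
  by (auto simp: iso_arr_def inverse_arrows_def)

lemma inv_arr [simp]: "iso_arr C f \<Longrightarrow> inv_arr C f \<in> Arr C"
  and dom_inv [simp]: "iso_arr C f \<Longrightarrow> Dom C (inv_arr C f) = Cod C f"
  and cod_inv [simp]: "iso_arr C f \<Longrightarrow> Cod C (inv_arr C f) = Dom C f"
  and inv_comp [simp]: "iso_arr C f \<Longrightarrow> inv_arr C f \<cdot> f = Ide C (Dom C f)"
  and comp_inv [simp]: "iso_arr C f \<Longrightarrow> f \<cdot> inv_arr C f = Ide C (Cod C f)"
  using inverse_arrows_inv[of f] by (auto simp: inverse_arrows_def Hom_iff)

lemma inv_comp_r [simp]:
  "\<lbrakk>iso_arr C f; k \<in> Arr C; Cod C k = Dom C f\<rbrakk> \<Longrightarrow> inv_arr C f \<cdot> (f \<cdot> k) = k"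
  by (simp add: iso_arr_arr flip: comp_assoc')

lemma comp_inv_r [simp]:
  "\<lbrakk>iso_arr C f; k \<in> Arr C; Cod C k = Cod C f\<rbrakk> \<Longrightarrow> f \<cdot> (inv_arr C f \<cdot> k) = k"
  by (simp add: iso_arr_arr flip: comp_assoc')

declare ass_iso [simp] ru_iso [simp] lu_iso [simp]

lemma inv_ide [simp]: "a \<in> Obj C \<Longrightarrow> inv_arr C (Ide C a) = Ide C a"
  and ide_iso [simp]: "a \<in> Obj C \<Longrightarrow> iso_arr C (Ide C a)"
proof -
  assume "a \<in> Obj C"
  then have "inverse_arrows C (Ide C a) (Ide C a)" by (auto intro!: inverse_arrowsI)
  then show "inv_arr C (Ide C a) = Ide C a" "iso_arr C (Ide C a)"
    by (auto simp: inv_arr_eq iso_arr_def)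
qed

lemma
  assumes "iso_arr C f" "iso_arr C g"
  shows inv_tens [simp]: "inv_arr C (f \<star> g) = inv_arr C f \<star> inv_arr C g"
    and tens_iso [simp]: "iso_arr C (f \<star> g)"
proof -
  have "inverse_arrows C (f \<star> g) (inv_arr C f \<star> inv_arr C g)"
    using assms by (auto intro!: inverse_arrowsI simp: merge iso_arr_arr)
  then show "inv_arr C (f \<star> g) = inv_arr C f \<star> inv_arr C g" "iso_arr C (f \<star> g)"
    by (auto simp: inv_arr_eq iso_arr_def)
qed

lemma
  assumes "iso_arr C f" "iso_arr C g" "Dom C g = Cod C f"
  shows inv_of_comp: "inv_arr C (g \<cdot> f) = inv_arr C f \<cdot> inv_arr C g"
    and comp_iso [simp]: "iso_arr C (g \<cdot> f)"
proof -
  have "inverse_arrows C (g \<cdot> f) (inv_arr C f \<cdot> inv_arr C g)"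
    using assms by (auto intro!: inverse_arrowsI simp: iso_arr_arr)
  then show "inv_arr C (g \<cdot> f) = inv_arr C f \<cdot> inv_arr C g" "iso_arr C (g \<cdot> f)"
    by (auto simp: inv_arr_eq iso_arr_def)
qed

lemma
  assumes "iso_arr C f"
  shows inv_inv [simp]: "inv_arr C (inv_arr C f) = f"
    and inv_iso [simp]: "iso_arr C (inv_arr C f)"
proof -
  have "inverse_arrows C (inv_arr C f) f"
    using assms by (auto intro!: inverse_arrowsI simp: iso_arr_arr)
  then show "inv_arr C (inv_arr C f) = f" "iso_arr C (inv_arr C f)"
    by (auto simp: inv_arr_eq iso_arr_def)
qed

lemma iso_cancel_left:
  "\<lbrakk>h \<cdot> f = h \<cdot> g; iso_arr C h; f \<in> Arr C; g \<in> Arr C; Cod C f = Dom C h; Cod C g = Dom C h\<rbrakk>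
    \<Longrightarrow> f = g"
  by (metis inv_comp_r)

lemma iso_cancel_right:
  assumes "f \<cdot> h = g \<cdot> h" "iso_arr C h" "f \<in> Arr C" "g \<in> Arr C"
    "Dom C f = Cod C h" "Dom C g = Cod C h"
  shows "f = g"
proof -
  have "(f \<cdot> h) \<cdot> inv_arr C h = (g \<cdot> h) \<cdot> inv_arr C h" using assms(1) by simp
  then show ?thesis using assms(2-) by (simp add: iso_arr_arr)
qed

text \<open>Lets naturality squares be reused for inverse associators, and turns the conditions on a
  transformation with invertible components around.\<close>

lemma inv_square:
  assumes "h \<cdot> f = g \<cdot> k" "iso_arr C h" "iso_arr C k" "f \<in> Arr C" "g \<in> Arr C"
    "Cod C f = Dom C h" "Dom C g = Cod C k" "Dom C f = Dom C k" "Cod C g = Cod C h"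
  shows "inv_arr C h \<cdot> g = f \<cdot> inv_arr C k"
proof (rule iso_cancel_left)
  have "h \<cdot> (f \<cdot> inv_arr C k) = (h \<cdot> f) \<cdot> inv_arr C k" using assms(2-) by (simp add: iso_arr_arr)
  also have "\<dots> = g" using assms by (simp add: iso_arr_arr)
  finally show "h \<cdot> (inv_arr C h \<cdot> g) = h \<cdot> (f \<cdot> inv_arr C k)" using assms by simp
qed (use assms in \<open>auto simp: iso_arr_arr\<close>)

lemma sym_sym' [simp]: "\<lbrakk>a \<in> Obj C; b \<in> Obj C\<rbrakk> \<Longrightarrow> Sym C b a \<cdot> Sym C a b = Ide C (a \<otimes> b)"
  by (rule sym_sym)

lemma
  assumes "a \<in> Obj C" "b \<in> Obj C"
  shows inv_sym [simp]: "inv_arr C (Sym C a b) = Sym C b a"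
    and sym_iso [simp]: "iso_arr C (Sym C a b)"
proof -
  have "inverse_arrows C (Sym C a b) (Sym C b a)"
    using assms by (auto intro!: inverse_arrowsI)
  then show "inv_arr C (Sym C a b) = Sym C b a" "iso_arr C (Sym C a b)"
    by (auto simp: inv_arr_eq iso_arr_def)
qed

section \<open>Naturality as rewrite rules\<close>

lemma ass_nat':
  "\<lbrakk>f \<in> Arr C; g \<in> Arr C; h \<in> Arr C; Cod C f = a'; Cod C g = b'; Cod C h = c'\<rbrakk>
    \<Longrightarrow> Ass C a' b' c' \<cdot> (f \<star> (g \<star> h)) = ((f \<star> g) \<star> h) \<cdot> Ass C (Dom C f) (Dom C g) (Dom C h)"
  by (rule ass_nat) (auto simp: Hom_iff)

lemma ass_inv_nat:
  "\<lbrakk>f \<in> Arr C; g \<in> Arr C; h \<in> Arr C; Cod C f = a'; Cod C g = b'; Cod C h = c'\<rbrakk>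
    \<Longrightarrow> inv_arr C (Ass C a' b' c') \<cdot> ((f \<star> g) \<star> h)
      = (f \<star> (g \<star> h)) \<cdot> inv_arr C (Ass C (Dom C f) (Dom C g) (Dom C h))"
  using ass_nat'[of f g h a' b' c'] by (intro inv_square) auto

lemma sym_nat':
  "\<lbrakk>f \<in> Arr C; g \<in> Arr C; Cod C f = a'; Cod C g = b'\<rbrakk>
    \<Longrightarrow> Sym C a' b' \<cdot> (f \<star> g) = (g \<star> f) \<cdot> Sym C (Dom C f) (Dom C g)"
  by (rule sym_nat) (auto simp: Hom_iff)

lemma lu_nat': "\<lbrakk>f \<in> Arr C; Cod C f = a\<rbrakk> \<Longrightarrow> Lu C a \<cdot> (Ide C (Unit C) \<star> f) = f \<cdot> Lu C (Dom C f)"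
  by (rule lu_nat) (auto simp: Hom_iff)

lemma ru_nat': "\<lbrakk>f \<in> Arr C; Cod C f = a\<rbrakk> \<Longrightarrow> Ru C a \<cdot> (f \<star> Ide C (Unit C)) = f \<cdot> Ru C (Dom C f)"
  by (rule ru_nat) (auto simp: Hom_iff)

lemma ass_nat_r:
  "\<lbrakk>f \<in> Arr C; g \<in> Arr C; h \<in> Arr C; Cod C f = a'; Cod C g = b'; Cod C h = c'; k \<in> Arr C;
    Cod C k = Dom C f \<otimes> (Dom C g \<otimes> Dom C h)\<rbrakk>
    \<Longrightarrow> Ass C a' b' c' \<cdot> ((f \<star> (g \<star> h)) \<cdot> k)
      = ((f \<star> g) \<star> h) \<cdot> (Ass C (Dom C f) (Dom C g) (Dom C h) \<cdot> k)"
  by (auto simp: ass_nat' simp flip: comp_assoc')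

lemma ass_inv_nat_r:
  "\<lbrakk>f \<in> Arr C; g \<in> Arr C; h \<in> Arr C; Cod C f = a'; Cod C g = b'; Cod C h = c'; k \<in> Arr C;
    Cod C k = (Dom C f \<otimes> Dom C g) \<otimes> Dom C h\<rbrakk>
    \<Longrightarrow> inv_arr C (Ass C a' b' c') \<cdot> (((f \<star> g) \<star> h) \<cdot> k)
      = (f \<star> (g \<star> h)) \<cdot> (inv_arr C (Ass C (Dom C f) (Dom C g) (Dom C h)) \<cdot> k)"
  by (auto simp: ass_inv_nat simp flip: comp_assoc')

text \<open>By naturality of the unitor, tensoring with the unit is conjugation with isomorphisms,
  so it loses nothing.\<close>

lemma lu_inj:
  assumes "Ide C (Unit C) \<star> f = Ide C (Unit C) \<star> g" "f \<in> Arr C" "g \<in> Arr C"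
    "Dom C f = Dom C g" "Cod C f = Cod C g"
  shows "f = g"
proof -
  have "f \<cdot> Lu C (Dom C f) = g \<cdot> Lu C (Dom C f)"
    using assms lu_nat'[of f "Cod C f"] lu_nat'[of g "Cod C g"] by metis
  then show ?thesis using assms by (auto intro: iso_cancel_right)
qed

lemma ru_inj:
  assumes "f \<star> Ide C (Unit C) = g \<star> Ide C (Unit C)" "f \<in> Arr C" "g \<in> Arr C"
    "Dom C f = Dom C g" "Cod C f = Cod C g"
  shows "f = g"
proof -
  have "f \<cdot> Ru C (Dom C f) = g \<cdot> Ru C (Dom C f)"
    using assms ru_nat'[of f "Cod C f"] ru_nat'[of g "Cod C g"] by metis
  then show ?thesis using assms by (auto intro: iso_cancel_right)
qed

lemma pentagon':
  assumes "a \<in> Obj C" "b \<in> Obj C" "c \<in> Obj C" "d \<in> Obj C"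
  shows "Ass C (a \<otimes> b) c d \<cdot> Ass C a b (c \<otimes> d)
    = (Ass C a b c \<star> Ide C d) \<cdot> (Ass C a (b \<otimes> c) d \<cdot> (Ide C a \<star> Ass C b c d))"
  using pentagon[OF assms] assms by simp

text \<open>Kelly's argument: both sides become equal after tensoring with the unit.\<close>

lemma lu_tens:
  assumes [simp]: "a \<in> Obj C" "b \<in> Obj C"
  shows "(Lu C a \<star> Ide C b) \<cdot> Ass C (Unit C) a b = Lu C (a \<otimes> b)"
proof (rule lu_inj)
  let ?I = "Unit C"
  have "Ass C ?I a b \<cdot> (Ide C ?I \<star> Lu C (a \<otimes> b))
      = Ass C ?I a b \<cdot> ((Ru C ?I \<star> Ide C (a \<otimes> b)) \<cdot> Ass C ?I ?I (a \<otimes> b))"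
    using triangle[of ?I "a \<otimes> b"] by simp
  also have "\<dots> = (Ass C ?I a b \<cdot> (Ru C ?I \<star> (Ide C a \<star> Ide C b))) \<cdot> Ass C ?I ?I (a \<otimes> b)" by simp
  also have "\<dots> = ((Ru C ?I \<star> Ide C a) \<star> Ide C b) \<cdot> (Ass C (?I \<otimes> ?I) a b \<cdot> Ass C ?I ?I (a \<otimes> b))"
    by (subst ass_nat') auto
  also have "\<dots> = ((Ru C ?I \<star> Ide C a) \<star> Ide C b) \<cdot>
      ((Ass C ?I ?I a \<star> Ide C b) \<cdot> (Ass C ?I (?I \<otimes> a) b \<cdot> (Ide C ?I \<star> Ass C ?I a b)))"
    by (simp add: pentagon')
  also have "\<dots> = ((Ide C ?I \<star> Lu C a) \<star> Ide C b) \<cdot> (Ass C ?I (?I \<otimes> a) b \<cdot> (Ide C ?I \<star> Ass C ?I a b))"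
    using triangle[of ?I a] by (simp add: merge_r)
  also have "\<dots> = (Ass C ?I a b \<cdot> (Ide C ?I \<star> (Lu C a \<star> Ide C b))) \<cdot> (Ide C ?I \<star> Ass C ?I a b)"
    by (subst ass_nat') auto
  also have "\<dots> = Ass C ?I a b \<cdot> (Ide C ?I \<star> ((Lu C a \<star> Ide C b) \<cdot> Ass C ?I a b))"
    by (simp add: merge)
  finally show "Ide C ?I \<star> ((Lu C a \<star> Ide C b) \<cdot> Ass C ?I a b) = Ide C ?I \<star> Lu C (a \<otimes> b)"
    by (auto dest: iso_cancel_left)
qed auto

end

section \<open>Coherence\<close>

text \<open>Tensoring an arrow between bracketed tensor products on the right with \<open>Z\<close> and conjugating with
  the canonical arrows to \<open>x\<^sub>1 \<otimes> (x\<^sub>2 \<otimes> \<dots> (x\<^sub>n \<otimes> Z))\<close> turns associators and unitors into identities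
  and symmetries into sequences of adjacent swaps; as \<open>Z\<close> may be the unit this loses no
  information.  A canonical arrow is thus determined by a list of positions at which to swap.\<close>

datatype 'o tree = TU | TL 'o | TN "'o tree" "'o tree"

primrec ev :: "('o, 'a) smcat \<Rightarrow> 'o tree \<Rightarrow> 'o" where
  "ev C TU = Unit C"
| "ev C (TL x) = x"
| "ev C (TN s t) = ev C s \<otimes>\<^bsub>C\<^esub> ev C t"

primrec leaves :: "'o tree \<Rightarrow> 'o list" where
  "leaves TU = []"
| "leaves (TL x) = [x]"
| "leaves (TN s t) = leaves s @ leaves t"

primrec rtens :: "('o, 'a) smcat \<Rightarrow> 'o list \<Rightarrow> 'o \<Rightarrow> 'o" where
  "rtens C [] Z = Z"
| "rtens C (x # xs) Z = x \<otimes>\<^bsub>C\<^esub> rtens C xs Z"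

primrec lift :: "('o, 'a) smcat \<Rightarrow> 'o list \<Rightarrow> 'a \<Rightarrow> 'a" where
  "lift C [] h = h"
| "lift C (x # xs) h = Ide C x \<star>\<^bsub>C\<^esub> lift C xs h"

text \<open>The spare factor \<open>Z\<close> makes bracketing to the right a structural recursion:
  while the left subtree is flattened, the flattened right subtree followed by \<open>Z\<close>
  plays the part of \<open>Z\<close>.\<close>

primrec can :: "('o, 'a) smcat \<Rightarrow> 'o tree \<Rightarrow> 'o \<Rightarrow> 'a" where
  "can C TU Z = Lu C Z"
| "can C (TL x) Z = Ide C (x \<otimes>\<^bsub>C\<^esub> Z)"
| "can C (TN s t) Z = can C s (rtens C (leaves t) Z) \<cdot>\<^bsub>C\<^esub>
     ((Ide C (ev C s) \<star>\<^bsub>C\<^esub> can C t Z) \<cdot>\<^bsub>C\<^esub> inv_arr C (Ass C (ev C s) (ev C t) Z))"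

text \<open>Position \<open>i\<close> exchanges the entries \<open>i\<close> and
  \<open>i + 1\<close>. A position out of range changes nothing, and \<open>swap_arr\<close> is then
  an identity, so typing facts hold for every list of positions.\<close>

fun swap :: "nat \<Rightarrow> 'o list \<Rightarrow> 'o list" where
  "swap 0 (x # y # xs) = y # x # xs"
| "swap (Suc i) (x # xs) = x # swap i xs"
| "swap _ xs = xs"

fun swap_arr :: "('o, 'a) smcat \<Rightarrow> nat \<Rightarrow> 'o list \<Rightarrow> 'o \<Rightarrow> 'a" where
  "swap_arr C 0 (x # y # xs) Z = inv_arr C (Ass C y x (rtens C xs Z)) \<cdot>\<^bsub>C\<^esub>
     ((Sym C x y \<star>\<^bsub>C\<^esub> Ide C (rtens C xs Z)) \<cdot>\<^bsub>C\<^esub> Ass C x y (rtens C xs Z))"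
| "swap_arr C (Suc i) (x # xs) Z = Ide C x \<star>\<^bsub>C\<^esub> swap_arr C i xs Z"
| "swap_arr C _ xs Z = Ide C (rtens C xs Z)"

text \<open>Positions are listed in order of execution, which is opposite to the applicative order
  of composing the arrows.\<close>

primrec swaps :: "nat list \<Rightarrow> 'o list \<Rightarrow> 'o list" where
  "swaps [] xs = xs"
| "swaps (n # ns) xs = swaps ns (swap n xs)"

primrec swaps_arr :: "('o, 'a) smcat \<Rightarrow> nat list \<Rightarrow> 'o list \<Rightarrow> 'o \<Rightarrow> 'a" where
  "swaps_arr C [] xs Z = Ide C (rtens C xs Z)"
| "swaps_arr C (n # ns) xs Z = swaps_arr C ns (swap n xs) Z \<cdot>\<^bsub>C\<^esub> swap_arr C n xs Z"

lemma length_swap [simp]: "length (swap i xs) = length xs"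
  by (induction i xs rule: swap.induct) auto

lemma set_swap [simp]: "set (swap i xs) = set xs"
  by (induction i xs rule: swap.induct) auto

lemma length_swaps [simp]: "length (swaps ns xs) = length xs"
  by (induction ns arbitrary: xs) auto

lemma set_swaps [simp]: "set (swaps ns xs) = set xs"
  by (induction ns arbitrary: xs) auto

lemma swaps_append [simp]: "swaps (ms @ ns) xs = swaps ns (swaps ms xs)"
  by (induction ms arbitrary: xs) auto

lemma rtens_append [simp]: "rtens C (xs @ ys) Z = rtens C xs (rtens C ys Z)"
  by (induction xs) auto

lemma lift_append [simp]: "lift C (xs @ ys) h = lift C xs (lift C ys h)"
  by (induction xs) auto

text \<open>The bound keeps a swap at the end of \<open>xs\<close> from reaching into
  \<open>ys\<close>.\<close>

lemma swap_append: "Suc i < length xs \<Longrightarrow> swap i (xs @ ys) = swap i xs @ ys"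
  by (induction i xs rule: swap.induct) auto

lemma swap_arr_append: "Suc i < length xs \<Longrightarrow> swap_arr C i (xs @ ys) Z = swap_arr C i xs (rtens C ys Z)"
  by (induction i xs rule: swap.induct) auto

lemma swaps_append_right:
  "\<forall>i \<in> set ns. Suc i < length xs \<Longrightarrow> swaps ns (xs @ ys) = swaps ns xs @ ys"
  by (induction ns arbitrary: xs) (auto simp: swap_append)

lemma swaps_arr_append_right:
  "\<forall>i \<in> set ns. Suc i < length xs \<Longrightarrow> swaps_arr C ns (xs @ ys) Z = swaps_arr C ns xs (rtens C ys Z)"
  by (induction ns arbitrary: xs) (auto simp: swap_append swap_arr_append)

lemma swap_append_left: "swap (i + length ys) (ys @ xs) = ys @ swap i xs"
  by (induction ys) auto

lemma swap_arr_append_left: "swap_arr C (i + length ys) (ys @ xs) Z = lift C ys (swap_arr C i xs Z)"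
  by (induction ys) auto

lemma swaps_append_left: "swaps (map (\<lambda>i. i + length ys) ns) (ys @ xs) = ys @ swaps ns xs"
  by (induction ns arbitrary: xs) (auto simp: swap_append_left)

context smc
begin

section \<open>Flattening and swaps as arrows\<close>

abbreviation "leaves_obj t \<equiv> set (leaves t) \<subseteq> Obj C"

lemma ev_obj [simp]: "leaves_obj t \<Longrightarrow> ev C t \<in> Obj C"
  by (induction t) auto

lemma rtens_obj [simp]: "\<lbrakk>set xs \<subseteq> Obj C; Z \<in> Obj C\<rbrakk> \<Longrightarrow> rtens C xs Z \<in> Obj C"
  by (induction xs) auto

lemma lift_typing [simp]:
  assumes "set xs \<subseteq> Obj C" "h \<in> Arr C"
  shows "lift C xs h \<in> Arr C" "Dom C (lift C xs h) = rtens C xs (Dom C h)"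
    "Cod C (lift C xs h) = rtens C xs (Cod C h)"
  using assms(1) by (induction xs) (use assms(2) in auto)

lemma lift_comp:
  "\<lbrakk>set xs \<subseteq> Obj C; h \<in> Arr C; k \<in> Arr C; Dom C h = Cod C k\<rbrakk>
    \<Longrightarrow> lift C xs (h \<cdot> k) = lift C xs h \<cdot> lift C xs k"
  by (induction xs) (auto simp: merge)

lemma lift_ide: "\<lbrakk>set xs \<subseteq> Obj C; a \<in> Obj C\<rbrakk> \<Longrightarrow> lift C xs (Ide C a) = Ide C (rtens C xs a)"
  by (induction xs) auto

lemma can_typing [simp]:
  assumes "leaves_obj t" "Z \<in> Obj C"
  shows "iso_arr C (can C t Z)" "can C t Z \<in> Arr C" "Dom C (can C t Z) = ev C t \<otimes> Z"
    "Cod C (can C t Z) = rtens C (leaves t) Z"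
proof -
  have "iso_arr C (can C t Z) \<and> can C t Z \<in> Arr C \<and> Dom C (can C t Z) = ev C t \<otimes> Z
      \<and> Cod C (can C t Z) = rtens C (leaves t) Z"
    using assms by (induction t arbitrary: Z) auto
  then show "iso_arr C (can C t Z)" "can C t Z \<in> Arr C" "Dom C (can C t Z) = ev C t \<otimes> Z"
    "Cod C (can C t Z) = rtens C (leaves t) Z" by auto
qed

text \<open>Moves a change of the spare factor past the flattening of \<open>t\<close>; this is how
  the swaps of a right-hand factor get past the leaves to its left.\<close>

lemma can_nat:
  "\<lbrakk>leaves_obj t; h \<in> Arr C\<rbrakk>
    \<Longrightarrow> can C t (Cod C h) \<cdot> (Ide C (ev C t) \<star> h) = lift C (leaves t) h \<cdot> can C t (Dom C h)"
proof (induction t arbitrary: h)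
  case TU
  then show ?case by (simp add: lu_nat')
next
  case (TL x)
  then show ?case by simp
next
  case (TN s t)
  then have [simp]: "leaves_obj s" "leaves_obj t" "h \<in> Arr C" by auto
  let ?s = "ev C s" and ?t = "ev C t"
  have "can C (TN s t) (Cod C h) \<cdot> (Ide C (ev C (TN s t)) \<star> h)
    = can C s (rtens C (leaves t) (Cod C h)) \<cdot> ((Ide C ?s \<star> can C t (Cod C h))
      \<cdot> (inv_arr C (Ass C ?s ?t (Cod C h)) \<cdot> ((Ide C ?s \<star> Ide C ?t) \<star> h)))" by simp
  also have "\<dots> = can C s (rtens C (leaves t) (Cod C h)) \<cdot> ((Ide C ?s \<star> lift C (leaves t) h)
      \<cdot> ((Ide C ?s \<star> can C t (Dom C h)) \<cdot> inv_arr C (Ass C ?s ?t (Dom C h))))"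
    by (simp add: ass_inv_nat merge_r TN.IH(2) del: tens_ide)
  also have "\<dots> = (can C s (Cod C (lift C (leaves t) h)) \<cdot> (Ide C ?s \<star> lift C (leaves t) h))
      \<cdot> ((Ide C ?s \<star> can C t (Dom C h)) \<cdot> inv_arr C (Ass C ?s ?t (Dom C h)))" by simp
  also have "\<dots> = lift C (leaves (TN s t)) h \<cdot> can C (TN s t) (Dom C h)"
    unfolding TN.IH(1)[OF \<open>leaves_obj s\<close> lift_typing(1)[OF \<open>leaves_obj t\<close> \<open>h \<in> Arr C\<close>]]
    by simp
  finally show ?case .
qed

lemma swap_arr_typing [simp]:
  assumes "set xs \<subseteq> Obj C" "Z \<in> Obj C"
  shows "swap_arr C i xs Z \<in> Arr C" "Dom C (swap_arr C i xs Z) = rtens C xs Z"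
    "Cod C (swap_arr C i xs Z) = rtens C (swap i xs) Z"
  using assms(1) by (induction i xs rule: swap.induct) (use assms(2) in auto)

lemma swaps_arr_typing [simp]:
  assumes "set xs \<subseteq> Obj C" "Z \<in> Obj C"
  shows "swaps_arr C ns xs Z \<in> Arr C" "Dom C (swaps_arr C ns xs Z) = rtens C xs Z"
    "Cod C (swaps_arr C ns xs Z) = rtens C (swaps ns xs) Z"
  using assms(1) by (induction ns arbitrary: xs) (use assms(2) in auto)

lemma swaps_arr_append [simp]:
  "\<lbrakk>set xs \<subseteq> Obj C; Z \<in> Obj C\<rbrakk>
    \<Longrightarrow> swaps_arr C (ms @ ns) xs Z = swaps_arr C ns (swaps ms xs) Z \<cdot> swaps_arr C ms xs Z"
  by (induction ms arbitrary: xs) auto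

lemma swaps_arr_append_left:
  "\<lbrakk>set xs \<subseteq> Obj C; set ys \<subseteq> Obj C; Z \<in> Obj C\<rbrakk>
    \<Longrightarrow> swaps_arr C (map (\<lambda>i. i + length ys) ns) (ys @ xs) Z = lift C ys (swaps_arr C ns xs Z)"
  by (induction ns arbitrary: xs)
    (auto simp: swap_append_left swap_arr_append_left lift_ide lift_comp)

lemma swap_arr_involution:
  "\<lbrakk>set xs \<subseteq> Obj C; Z \<in> Obj C\<rbrakk>
    \<Longrightarrow> swap_arr C i (swap i xs) Z \<cdot> swap_arr C i xs Z = Ide C (rtens C xs Z)"
  by (induction i xs rule: swap.induct) (auto simp: merge merge_r)

lemma swap_arr_nat:
  assumes [simp]: "x \<in> Obj C" "y \<in> Obj C" "h \<in> Arr C"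
  shows "swap_arr C 0 [x, y] (Cod C h) \<cdot> (Ide C x \<star> (Ide C y \<star> h))
    = (Ide C y \<star> (Ide C x \<star> h)) \<cdot> swap_arr C 0 [x, y] (Dom C h)"
  using ass_inv_nat_r[of "Ide C y" "Ide C x" h y x "Cod C h"
      "(Sym C x y \<star> Ide C (Dom C h)) \<cdot> Ass C x y (Dom C h)"]
  by (simp add: ass_nat' merge merge_r)

text \<open>If the first position is 0, the other is \<open>k + 2\<close> and acts behind both
  exchanged entries, so the claim is naturality of the swap at the head; otherwise a common first
  entry is stripped off.\<close>

lemma swap_arr_far_commute:
  assumes "set xs \<subseteq> Obj C" "Z \<in> Obj C" "Suc i < j" "Suc j < length xs"
  shows "swap_arr C i (swap j xs) Z \<cdot> swap_arr C j xs Z = swap_arr C j (swap i xs) Z \<cdot> swap_arr C i xs Z"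
    and "swap i (swap j xs) = swap j (swap i xs)"
proof -
  have "swap_arr C i (swap j xs) Z \<cdot> swap_arr C j xs Z = swap_arr C j (swap i xs) Z \<cdot> swap_arr C i xs Z
    \<and> swap i (swap j xs) = swap j (swap i xs)"
    using assms
  proof (induction i xs arbitrary: j rule: swap.induct)
    case (1 x y xs)
    have "Suc 0 < j" using 1 by simp
    then obtain k where j: "j = Suc (Suc k)" by (auto dest: less_imp_Suc_add)
    show ?case using swap_arr_nat[of x y "swap_arr C k xs Z"] 1 by (simp add: j)
  next
    case (2 i x xs)
    have "0 < j" using 2 by simp
    then obtain k where "j = Suc k" by (auto dest: less_imp_Suc_add)
    then show ?case using 2 by (auto simp: merge)
  qed auto
  then show "swap_arr C i (swap j xs) Z \<cdot> swap_arr C j xs Z = swap_arr C j (swap i xs) Z \<cdot> swap_arr C i xs Z"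
    and "swap i (swap j xs) = swap j (swap i xs)" by auto
qed

text \<open>Quantifying over \<open>Z\<close> makes the notion stable under tensoring, because the
  leaves of a neighbouring factor can be absorbed into \<open>Z\<close>. The bound on the positions
  keeps the swaps away from those leaves and from \<open>Z\<close>.\<close>

definition normal_form :: "'o tree \<Rightarrow> 'o tree \<Rightarrow> 'a \<Rightarrow> nat list \<Rightarrow> bool" where
  "normal_form s t f ns \<longleftrightarrow>
     leaves_obj s \<and> f \<in> Arr C \<and> Dom C f = ev C s \<and> Cod C f = ev C t \<and>
     leaves t = swaps ns (leaves s) \<and> (\<forall>i \<in> set ns. Suc i < length (leaves s)) \<and>
     (\<forall>Z \<in> Obj C. can C t Z \<cdot> (f \<star> Ide C Z) = swaps_arr C ns (leaves s) Z \<cdot> can C s Z)"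

text \<open>With the unit for \<open>Z\<close>, the flattening of \<open>t\<close> and then the
  factor \<open>Ide C (Unit C)\<close> can be cancelled. Equality of arrows thus becomes a relation
  between words in adjacent swaps.\<close>

lemma nf_eq:
  assumes "normal_form s t f ms" "normal_form s t g ns"
    "\<And>Z. Z \<in> Obj C \<Longrightarrow> swaps_arr C ms (leaves s) Z = swaps_arr C ns (leaves s) Z"
  shows "f = g"
proof (rule ru_inj)
  have [simp]: "leaves_obj s" "leaves_obj t"
    "f \<in> Arr C" "Dom C f = ev C s" "Cod C f = ev C t" "g \<in> Arr C" "Dom C g = ev C s" "Cod C g = ev C t"
    using assms(1,2) by (auto simp: normal_form_def)
  have "can C t (Unit C) \<cdot> (f \<star> Ide C (Unit C)) = can C t (Unit C) \<cdot> (g \<star> Ide C (Unit C))"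
    using assms(1,2) by (simp add: normal_form_def assms(3))
  then show "f \<star> Ide C (Unit C) = g \<star> Ide C (Unit C)"
    by (rule iso_cancel_left) simp_all
  show "f \<in> Arr C" "g \<in> Arr C" "Dom C f = Dom C g" "Cod C f = Cod C g" by simp_all
qed

lemma nf_ide: "leaves_obj s \<Longrightarrow> normal_form s s (Ide C (ev C s)) []"
  by (simp add: normal_form_def)

lemma nf_comp:
  assumes f: "normal_form s t f ms" and g: "normal_form t u g ns"
  shows "normal_form s u (g \<cdot> f) (ms @ ns)"
proof -
  have [simp]: "leaves_obj s" "leaves_obj t" "leaves_obj u"
    "f \<in> Arr C" "g \<in> Arr C" "Dom C f = ev C s" "Cod C f = ev C t" "Dom C g = ev C t" "Cod C g = ev C u"
    "leaves t = swaps ms (leaves s)" "leaves u = swaps ns (leaves t)" "length (leaves t) = length (leaves s)"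
    using assms by (auto simp: normal_form_def)
  have "can C u Z \<cdot> ((g \<cdot> f) \<star> Ide C Z) = swaps_arr C (ms @ ns) (leaves s) Z \<cdot> can C s Z"
    if [simp]: "Z \<in> Obj C" for Z
  proof -
    have "can C u Z \<cdot> ((g \<cdot> f) \<star> Ide C Z) = (can C u Z \<cdot> (g \<star> Ide C Z)) \<cdot> (f \<star> Ide C Z)"
      by (simp add: merge)
    also have "\<dots> = swaps_arr C ns (leaves t) Z \<cdot> (can C t Z \<cdot> (f \<star> Ide C Z))"
      using g by (simp add: normal_form_def)
    also have "\<dots> = swaps_arr C (ms @ ns) (leaves s) Z \<cdot> can C s Z"
      using f by (simp add: normal_form_def)
    finally show ?thesis .
  qed
  then show ?thesis using assms by (auto simp: normal_form_def)
qed

text \<open>Meant for associators and unitors, whose lists are empty; the inverse of a symmetry is a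
  symmetry again.\<close>

lemma nf_inv:
  assumes f: "normal_form s t f []" and [simp]: "iso_arr C f"
  shows "normal_form t s (inv_arr C f) []"
proof -
  have [simp]: "leaves_obj s" "f \<in> Arr C" "Dom C f = ev C s" "Cod C f = ev C t"
    "leaves t = leaves s" using f by (auto simp: normal_form_def)
  have "can C s Z \<cdot> (inv_arr C f \<star> Ide C Z) = can C t Z" if [simp]: "Z \<in> Obj C" for Z
  proof -
    have "can C t Z \<cdot> (f \<star> Ide C Z) = can C s Z" using f by (simp add: normal_form_def)
    then have "can C s Z \<cdot> (inv_arr C f \<star> Ide C Z) = (can C t Z \<cdot> (f \<star> Ide C Z)) \<cdot> (inv_arr C f \<star> Ide C Z)"
      by simp
    then show ?thesis by (simp add: merge)
  qed
  then show ?thesis using f by (auto simp: normal_form_def)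
qed

lemma nf_right:
  assumes f: "normal_form s t f ns" and u [simp]: "leaves_obj u"
  shows "normal_form (TN s u) (TN t u) (f \<star> Ide C (ev C u)) ns"
proof -
  have [simp]: "leaves_obj s" "leaves_obj t"
    "f \<in> Arr C" "Dom C f = ev C s" "Cod C f = ev C t" "leaves t = swaps ns (leaves s)"
    using f by (auto simp: normal_form_def)
  have ns: "\<forall>i \<in> set ns. Suc i < length (leaves s)" using f by (auto simp: normal_form_def)
  have "can C (TN t u) Z \<cdot> ((f \<star> Ide C (ev C u)) \<star> Ide C Z)
      = swaps_arr C ns (leaves (TN s u)) Z \<cdot> can C (TN s u) Z"
    if [simp]: "Z \<in> Obj C" for Z
  proof -
    let ?U = "rtens C (leaves u) Z"
    have "can C (TN t u) Z \<cdot> ((f \<star> Ide C (ev C u)) \<star> Ide C Z)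
      = (can C t ?U \<cdot> (f \<star> Ide C ?U)) \<cdot> ((Ide C (ev C s) \<star> can C u Z) \<cdot> inv_arr C (Ass C (ev C s) (ev C u) Z))"
      by (simp add: ass_inv_nat merge_r)
    also have "\<dots> = swaps_arr C ns (leaves (TN s u)) Z \<cdot> can C (TN s u) Z"
      using f by (simp add: normal_form_def swaps_arr_append_right)
    finally show ?thesis .
  qed
  then show ?thesis using f ns by (auto simp: normal_form_def swaps_append_right)
qed

text \<open>By \<open>can_nat\<close> the swaps pass the leaves of \<open>u\<close>, which shifts
  every position by the number of these leaves.\<close>

lemma nf_left:
  assumes f: "normal_form s t f ns" and u [simp]: "leaves_obj u"
  shows "normal_form (TN u s) (TN u t) (Ide C (ev C u) \<star> f) (map (\<lambda>i. i + length (leaves u)) ns)"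
proof -
  have [simp]: "leaves_obj s" "leaves_obj t"
    "f \<in> Arr C" "Dom C f = ev C s" "Cod C f = ev C t" "leaves t = swaps ns (leaves s)"
    using f by (auto simp: normal_form_def)
  have "can C (TN u t) Z \<cdot> ((Ide C (ev C u) \<star> f) \<star> Ide C Z)
      = swaps_arr C (map (\<lambda>i. i + length (leaves u)) ns) (leaves (TN u s)) Z \<cdot> can C (TN u s) Z"
    if [simp]: "Z \<in> Obj C" for Z
  proof -
    let ?T = "rtens C (leaves t) Z" and ?sw = "swaps_arr C ns (leaves s) Z"
    have "can C (TN u t) Z \<cdot> ((Ide C (ev C u) \<star> f) \<star> Ide C Z)
      = can C u ?T \<cdot> ((Ide C (ev C u) \<star> (can C t Z \<cdot> (f \<star> Ide C Z))) \<cdot> inv_arr C (Ass C (ev C u) (ev C s) Z))"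
      by (simp add: ass_inv_nat merge_r)
    also have "can C t Z \<cdot> (f \<star> Ide C Z) = ?sw \<cdot> can C s Z"
      using f by (simp add: normal_form_def)
    also have "can C u ?T \<cdot> ((Ide C (ev C u) \<star> (?sw \<cdot> can C s Z)) \<cdot> inv_arr C (Ass C (ev C u) (ev C s) Z))
      = (can C u (Cod C ?sw) \<cdot> (Ide C (ev C u) \<star> ?sw))
        \<cdot> ((Ide C (ev C u) \<star> can C s Z) \<cdot> inv_arr C (Ass C (ev C u) (ev C s) Z))"
      by (simp add: merge_r)
    also have "\<dots> = swaps_arr C (map (\<lambda>i. i + length (leaves u)) ns) (leaves (TN u s)) Z \<cdot> can C (TN u s) Z"
      by (subst can_nat) (simp_all add: swaps_arr_append_left)
    finally show ?thesis .
  qed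
  then show ?thesis using f by (auto simp: normal_form_def swaps_append_left)
qed

text \<open>This is the pentagon with \<open>Z\<close> as fourth object, rewritten in terms of
  inverse associators; naturality of the associator then brings the flattening of \<open>u\<close>
  into place.\<close>

lemma nf_ass:
  assumes [simp]: "leaves_obj s" "leaves_obj t" "leaves_obj u"
  shows "normal_form (TN s (TN t u)) (TN (TN s t) u) (Ass C (ev C s) (ev C t) (ev C u)) []"
proof -
  have "can C (TN (TN s t) u) Z \<cdot> (Ass C (ev C s) (ev C t) (ev C u) \<star> Ide C Z) = can C (TN s (TN t u)) Z"
    if [simp]: "Z \<in> Obj C" for Z
  proof -
    let ?s = "ev C s" and ?t = "ev C t" and ?u = "ev C u" and ?U = "rtens C (leaves u) Z"
    let ?T = "rtens C (leaves t) ?U"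
    have p: "(Ass C ?s ?t ?u \<star> Ide C Z) \<cdot> (Ass C ?s (?t \<otimes> ?u) Z \<cdot> (Ide C ?s \<star> Ass C ?t ?u Z))
        = Ass C (?s \<otimes> ?t) ?u Z \<cdot> Ass C ?s ?t (?u \<otimes> Z)"
      by (simp add: pentagon')
    have "inv_arr C (Ass C ?s ?t (?u \<otimes> Z)) \<cdot> (inv_arr C (Ass C (?s \<otimes> ?t) ?u Z) \<cdot> (Ass C ?s ?t ?u \<star> Ide C Z))
        = (Ide C ?s \<star> inv_arr C (Ass C ?t ?u Z)) \<cdot> inv_arr C (Ass C ?s (?t \<otimes> ?u) Z)"
    proof (rule iso_cancel_right[where h = "Ass C ?s (?t \<otimes> ?u) Z \<cdot> (Ide C ?s \<star> Ass C ?t ?u Z)"])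
      show "(inv_arr C (Ass C ?s ?t (?u \<otimes> Z)) \<cdot> (inv_arr C (Ass C (?s \<otimes> ?t) ?u Z) \<cdot> (Ass C ?s ?t ?u \<star> Ide C Z)))
            \<cdot> (Ass C ?s (?t \<otimes> ?u) Z \<cdot> (Ide C ?s \<star> Ass C ?t ?u Z))
          = ((Ide C ?s \<star> inv_arr C (Ass C ?t ?u Z)) \<cdot> inv_arr C (Ass C ?s (?t \<otimes> ?u) Z))
            \<cdot> (Ass C ?s (?t \<otimes> ?u) Z \<cdot> (Ide C ?s \<star> Ass C ?t ?u Z))"
        by (simp add: p merge)
    qed simp_all
    note q = this
    have "can C (TN (TN s t) u) Z \<cdot> (Ass C ?s ?t ?u \<star> Ide C Z)
      = can C s ?T \<cdot> ((Ide C ?s \<star> can C t ?U) \<cdot> (inv_arr C (Ass C ?s ?t ?U)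
        \<cdot> (((Ide C ?s \<star> Ide C ?t) \<star> can C u Z)
        \<cdot> (inv_arr C (Ass C (?s \<otimes> ?t) ?u Z) \<cdot> (Ass C ?s ?t ?u \<star> Ide C Z)))))"
      by simp
    also have "\<dots> = can C s ?T \<cdot> ((Ide C ?s \<star> can C t ?U) \<cdot> ((Ide C ?s \<star> (Ide C ?t \<star> can C u Z))
        \<cdot> (inv_arr C (Ass C ?s ?t (?u \<otimes> Z))
        \<cdot> (inv_arr C (Ass C (?s \<otimes> ?t) ?u Z) \<cdot> (Ass C ?s ?t ?u \<star> Ide C Z)))))"
      by (simp add: ass_inv_nat_r del: tens_ide)
    also have "\<dots> = can C (TN s (TN t u)) Z"
      unfolding q by (simp add: merge merge_r)
    finally show ?thesis .
  qed
  then show ?thesis by (simp add: normal_form_def)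
qed

text \<open>The triangle with \<open>Z\<close> as right-hand factor.\<close>

lemma nf_ru:
  assumes [simp]: "leaves_obj s"
  shows "normal_form (TN s TU) s (Ru C (ev C s)) []"
proof -
  have "can C s Z \<cdot> ((Ide C (ev C s) \<star> Lu C Z) \<cdot> inv_arr C (Ass C (ev C s) (Unit C) Z))
      = can C s Z \<cdot> (Ru C (ev C s) \<star> Ide C Z)" if [simp]: "Z \<in> Obj C" for Z
    by (simp flip: triangle)
  then show ?thesis by (simp add: normal_form_def)
qed

text \<open>Here \<open>lu_tens\<close> takes the place that the triangle has in
  \<open>nf_ru\<close>.\<close>

lemma nf_lu:
  assumes [simp]: "leaves_obj s"
  shows "normal_form (TN TU s) s (Lu C (ev C s)) []"
proof -
  have "can C (TN TU s) Z = can C s Z \<cdot> (Lu C (ev C s) \<star> Ide C Z)" if [simp]: "Z \<in> Obj C" for Z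
  proof -
    have "can C (TN TU s) Z = (Lu C (Cod C (can C s Z)) \<cdot> (Ide C (Unit C) \<star> can C s Z))
        \<cdot> inv_arr C (Ass C (Unit C) (ev C s) Z)" by simp
    also have "\<dots> = (can C s Z \<cdot> ((Lu C (ev C s) \<star> Ide C Z) \<cdot> Ass C (Unit C) (ev C s) Z))
        \<cdot> inv_arr C (Ass C (Unit C) (ev C s) Z)"
      by (subst lu_nat') (simp_all add: lu_tens)
    also have "\<dots> = can C s Z \<cdot> (Lu C (ev C s) \<star> Ide C Z)" by simp
    finally show ?thesis .
  qed
  then show ?thesis by (simp add: normal_form_def del: can.simps)
qed

text \<open>Holds by computation: \<open>swap_arr\<close> at position 0 is the symmetry conjugated
  with exactly the associators that make up \<open>can\<close> of a tree with two leaves.\<close>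

lemma nf_sym: "\<lbrakk>x \<in> Obj C; y \<in> Obj C\<rbrakk> \<Longrightarrow> normal_form (TN (TL x) (TL y)) (TN (TL y) (TL x)) (Sym C (ev C (TL x)) (ev C (TL y))) [0]"
  by (simp add: normal_form_def)

text \<open>A symmetry with the unit is a composite of unitors, so passing the unit costs no
  swap.\<close>

lemma nf_sym_unit:
  assumes [simp]: "leaves_obj s"
  shows "normal_form (TN s TU) (TN TU s) (Sym C (ev C s) (ev C TU)) []"
    and "normal_form (TN TU s) (TN s TU) (Sym C (ev C TU) (ev C s)) []"
proof -
  have "Sym C (ev C s) (Unit C) = inv_arr C (Lu C (ev C s)) \<cdot> Ru C (ev C s)"
    by (simp flip: sym_unit)
  then show *: "normal_form (TN s TU) (TN TU s) (Sym C (ev C s) (ev C TU)) []"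
    using nf_comp[OF nf_ru[of s] nf_inv[OF nf_lu[of s]]] by simp
  from nf_inv[OF *] show "normal_form (TN TU s) (TN s TU) (Sym C (ev C TU) (ev C s)) []" by simp
qed

text \<open>Solved for the symmetry of a tensor product, so that symmetries between words reduce to
  symmetries between leaves; inverting it yields \<open>hexagon_right\<close>.\<close>

lemma hexagon_left:
  assumes [simp]: "a \<in> Obj C" "b \<in> Obj C" "c \<in> Obj C"
  shows "Sym C (a \<otimes> b) c = inv_arr C (Ass C c a b) \<cdot> ((Sym C a c \<star> Ide C b) \<cdot> (Ass C a c b
    \<cdot> ((Ide C a \<star> Sym C b c) \<cdot> inv_arr C (Ass C a b c))))"
proof -
  have "Ass C c a b \<cdot> (Sym C (a \<otimes> b) c \<cdot> Ass C a b c)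
      = (Sym C a c \<star> Ide C b) \<cdot> (Ass C a c b \<cdot> (Ide C a \<star> Sym C b c))"
    using hexagon[of a b c] by simp
  then have "inv_arr C (Ass C c a b) \<cdot> ((Ass C c a b \<cdot> (Sym C (a \<otimes> b) c \<cdot> Ass C a b c)) \<cdot> inv_arr C (Ass C a b c))
      = inv_arr C (Ass C c a b) \<cdot> (((Sym C a c \<star> Ide C b) \<cdot> (Ass C a c b \<cdot> (Ide C a \<star> Sym C b c)))
        \<cdot> inv_arr C (Ass C a b c))"
    by (simp only:)
  then show ?thesis by simp
qed

lemma hexagon_right:
  assumes [simp]: "a \<in> Obj C" "b \<in> Obj C" "c \<in> Obj C"
  shows "Sym C a (b \<otimes> c) = Ass C b c a \<cdot> ((Ide C b \<star> Sym C a c) \<cdot> (inv_arr C (Ass C b a c)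
    \<cdot> ((Sym C a b \<star> Ide C c) \<cdot> Ass C a b c)))"
proof -
  have "inv_arr C (Sym C (b \<otimes> c) a) = Ass C b c a \<cdot> ((Ide C b \<star> Sym C a c) \<cdot> (inv_arr C (Ass C b a c)
    \<cdot> ((Sym C a b \<star> Ide C c) \<cdot> Ass C a b c)))"
    by (subst hexagon_left) (simp_all add: inv_of_comp)
  then show ?thesis by simp
qed

text \<open>The word \<open>t\<close> passes \<open>u\<close> first, while \<open>s\<close> still
  stands to the left of both; hence the shifted list precedes \<open>ms\<close>.\<close>

lemma nf_sym_left:
  assumes s: "normal_form (TN s u) (TN u s) (Sym C (ev C s) (ev C u)) ms"
    and t: "normal_form (TN t u) (TN u t) (Sym C (ev C t) (ev C u)) ns"
  shows "normal_form (TN (TN s t) u) (TN u (TN s t)) (Sym C (ev C (TN s t)) (ev C u))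
    (map (\<lambda>i. i + length (leaves s)) ns @ ms)"
proof -
  have [simp]: "leaves_obj s" "leaves_obj t" "leaves_obj u"
    using assms by (auto simp: normal_form_def)
  show ?thesis
    using nf_comp[OF nf_comp[OF nf_comp[OF nf_comp[OF nf_inv[OF nf_ass] nf_left[OF t]] nf_ass] nf_right[OF s]]
      nf_inv[OF nf_ass]]
    by (simp add: hexagon_left)
qed

lemma nf_sym_right:
  assumes t: "normal_form (TN s t) (TN t s) (Sym C (ev C s) (ev C t)) ms"
    and u: "normal_form (TN s u) (TN u s) (Sym C (ev C s) (ev C u)) ns"
  shows "normal_form (TN s (TN t u)) (TN (TN t u) s) (Sym C (ev C s) (ev C (TN t u)))
    (ms @ map (\<lambda>i. i + length (leaves t)) ns)"
proof -
  have [simp]: "leaves_obj s" "leaves_obj t" "leaves_obj u"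
    using assms by (auto simp: normal_form_def)
  show ?thesis
    using nf_comp[OF nf_comp[OF nf_comp[OF nf_comp[OF nf_ass nf_right[OF t]] nf_inv[OF nf_ass]] nf_left[OF u]]
      nf_ass]
    by (simp add: hexagon_right)
qed

section \<open>The interchange in normal form\<close>

lemma mid_typing [simp]:
  assumes [simp]: "a \<in> Obj C" "b \<in> Obj C" "c \<in> Obj C" "d \<in> Obj C"
  shows "mid C a b c d \<in> Arr C" "Dom C (mid C a b c d) = (a \<otimes> b) \<otimes> (c \<otimes> d)"
    "Cod C (mid C a b c d) = (a \<otimes> c) \<otimes> (b \<otimes> d)"
  by (simp_all add: mid_def)

lemma nf_mid:
  assumes t: "normal_form (TN t u) (TN u t) (Sym C (ev C t) (ev C u)) ns"
    and [simp]: "leaves_obj s" "leaves_obj v"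
  shows "normal_form (TN (TN s t) (TN u v)) (TN (TN s u) (TN t v)) (mid C (ev C s) (ev C t) (ev C u) (ev C v))
    (map (\<lambda>i. i + length (leaves s)) ns)"
proof -
  have [simp]: "leaves_obj t" "leaves_obj u"
    using assms by (auto simp: normal_form_def)
  show ?thesis
    using nf_comp[OF nf_comp[OF nf_comp[OF nf_comp[OF nf_inv[OF nf_ass] nf_left[OF nf_ass]]
      nf_left[OF nf_right[OF t]]] nf_left[OF nf_inv[OF nf_ass]]] nf_ass]
    by (simp add: mid_def)
qed

lemma mid_nat:
  assumes [simp]: "f \<in> Arr C" "g \<in> Arr C" "h \<in> Arr C" "k \<in> Arr C"
  shows "mid C (Cod C f) (Cod C g) (Cod C h) (Cod C k) \<cdot> ((f \<star> g) \<star> (h \<star> k))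
    = ((f \<star> h) \<star> (g \<star> k)) \<cdot> mid C (Dom C f) (Dom C g) (Dom C h) (Dom C k)"
proof -
  \<comment> \<open>The inner part of \<open>mid\<close>, which exchanges \<open>b\<close> and
    \<open>c\<close> in front of \<open>d\<close>. It is natural by itself, and the outer
    associators only regroup the object \<open>a\<close>.\<close>
  define M where "M b c d = inv_arr C (Ass C c b d) \<cdot> ((Sym C b c \<star> Ide C d) \<cdot> Ass C b c d)" for b c d
  have M [simp]: "M b c d \<in> Arr C" "Dom C (M b c d) = b \<otimes> (c \<otimes> d)" "Cod C (M b c d) = c \<otimes> (b \<otimes> d)"
    if "b \<in> Obj C" "c \<in> Obj C" "d \<in> Obj C" for b c d
    using that by (simp_all add: M_def)
  have mid_M: "mid C a b c d = Ass C a c (b \<otimes> d) \<cdot> ((Ide C a \<star> M b c d) \<cdot> inv_arr C (Ass C a b (c \<otimes> d)))"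
    if "a \<in> Obj C" "b \<in> Obj C" "c \<in> Obj C" "d \<in> Obj C" for a b c d
    using that by (simp add: mid_def M_def merge_r)
  have "M (Cod C g) (Cod C h) (Cod C k) \<cdot> (g \<star> (h \<star> k))
      = inv_arr C (Ass C (Cod C h) (Cod C g) (Cod C k))
        \<cdot> (((h \<star> g) \<star> k) \<cdot> ((Sym C (Dom C g) (Dom C h) \<star> Ide C (Dom C k)) \<cdot> Ass C (Dom C g) (Dom C h) (Dom C k)))"
    by (simp add: M_def ass_nat' merge_r sym_nat')
  also have "\<dots> = (h \<star> (g \<star> k)) \<cdot> M (Dom C g) (Dom C h) (Dom C k)"
    by (subst ass_inv_nat_r) (simp_all add: M_def)
  finally have nat: "M (Cod C g) (Cod C h) (Cod C k) \<cdot> (g \<star> (h \<star> k)) = (h \<star> (g \<star> k)) \<cdot> M (Dom C g) (Dom C h) (Dom C k)" .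
  have "mid C (Cod C f) (Cod C g) (Cod C h) (Cod C k) \<cdot> ((f \<star> g) \<star> (h \<star> k))
      = Ass C (Cod C f) (Cod C h) (Cod C g \<otimes> Cod C k) \<cdot> ((f \<star> (h \<star> (g \<star> k)))
        \<cdot> ((Ide C (Dom C f) \<star> M (Dom C g) (Dom C h) (Dom C k)) \<cdot> inv_arr C (Ass C (Dom C f) (Dom C g) (Dom C h \<otimes> Dom C k))))"
    by (simp add: mid_M ass_inv_nat merge_r nat)
  also have "\<dots> = ((f \<star> h) \<star> (g \<star> k)) \<cdot> mid C (Dom C f) (Dom C g) (Dom C h) (Dom C k)"
    by (subst ass_nat_r) (simp_all add: mid_M)
  finally show ?thesis .
qed

lemma mid_nat_r:
  assumes [simp]: "f \<in> Arr C" "g \<in> Arr C" "h \<in> Arr C" "k \<in> Arr C" "l \<in> Arr C"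
    and "Cod C l = (Dom C f \<otimes> Dom C g) \<otimes> (Dom C h \<otimes> Dom C k)"
  shows "mid C (Cod C f) (Cod C g) (Cod C h) (Cod C k) \<cdot> (((f \<star> g) \<star> (h \<star> k)) \<cdot> l)
    = ((f \<star> h) \<star> (g \<star> k)) \<cdot> (mid C (Dom C f) (Dom C g) (Dom C h) (Dom C k) \<cdot> l)"
  using assms by (simp add: mid_nat flip: comp_assoc')

lemma nf_tens:
  assumes f: "normal_form s t f ms" and g: "normal_form u v g ns"
  shows "normal_form (TN s u) (TN t v) (f \<star> g) (ms @ map (\<lambda>i. i + length (leaves s)) ns)"
proof -
  have [simp]: "leaves_obj t" "leaves_obj u" "f \<in> Arr C" "g \<in> Arr C"
    "Cod C f = ev C t" "Dom C g = ev C u" and l: "length (leaves t) = length (leaves s)"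
    using assms by (auto simp: normal_form_def)
  show ?thesis
    using nf_comp[OF nf_right[OF f] nf_left[OF g]] by (simp add: merge l)
qed

text \<open>Together with \<open>swaps_arr_cancel\<close>, these are the relations between swaps by
  which the equations for \<open>mid\<close> are decided.\<close>

lemma swaps_arr_commute:
  assumes "set xs \<subseteq> Obj C" "Z \<in> Obj C" "Suc i < j" "Suc j < length xs"
  shows "swaps_arr C (ms @ i # j # ns) xs Z = swaps_arr C (ms @ j # i # ns) xs Z"
  using assms swap_arr_far_commute[of "swaps ms xs" Z i j]
  by simp

lemma swaps_arr_cancel:
  assumes "set xs \<subseteq> Obj C" "Z \<in> Obj C"
  shows "swaps_arr C (ms @ i # i # ns) xs Z = swaps_arr C (ms @ ns) xs Z"
proof -
  have "swap i (swap i ys) = ys" for ys :: "'o list"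
    by (induction i ys rule: swap.induct) auto
  then show ?thesis using assms swap_arr_involution[of "swaps ms xs" Z i] by simp
qed

lemma nf_mid_leaves:
  assumes "a \<in> Obj C" "b \<in> Obj C" "c \<in> Obj C" "d \<in> Obj C"
  shows "normal_form (TN (TN (TL a) (TL b)) (TN (TL c) (TL d))) (TN (TN (TL a) (TL c)) (TN (TL b) (TL d)))
    (mid C a b c d) [1]"
  using nf_mid[OF nf_sym, of b c "TL a" "TL d"] assms by simp

text \<open>First \<open>y\<close> moves left past \<open>x'\<close> and \<open>x\<close> (positions
  1 and 0), then \<open>y'\<close> does the same one place further to the right (positions 2 and
  1).\<close>

lemma nf_sym4:
  assumes "x \<in> Obj C" "x' \<in> Obj C" "y \<in> Obj C" "y' \<in> Obj C"
  shows "normal_form (TN (TN (TL x) (TL x')) (TN (TL y) (TL y'))) (TN (TN (TL y) (TL y')) (TN (TL x) (TL x')))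
    (Sym C (x \<otimes> x') (y \<otimes> y')) [1, 0, 2, 1]"
  using nf_sym_right[where s = "TN (TL x) (TL x')" and t = "TL y" and u = "TL y'",
      OF nf_sym_left[where s = "TL x" and t = "TL x'" and u = "TL y", OF nf_sym nf_sym]
         nf_sym_left[where s = "TL x" and t = "TL x'" and u = "TL y'", OF nf_sym nf_sym]] assms
  by (simp add: nf_sym numeral_2_eq_2)

context
  fixes x x' y y' z z'
  assumes obj [simp]: "x \<in> Obj C" "x' \<in> Obj C" "y \<in> Obj C" "y' \<in> Obj C" "z \<in> Obj C" "z' \<in> Obj C"
begin

text \<open>On the word \<open>x x' y y' z z'\<close>, both sides let \<open>x'\<close> pass
  \<open>y\<close> and \<open>y'\<close> pass \<open>z\<close>, at the disjoint positions 1 and 3,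
  and then let \<open>x'\<close> pass \<open>z\<close> at position 2. Only the order of the two
  disjoint swaps differs.\<close>

lemma mid_ass:
  "(Ass C x y z \<star> Ass C x' y' z') \<cdot> (mid C x x' (y \<otimes> z) (y' \<otimes> z') \<cdot> (Ide C (x \<otimes> x') \<star> mid C y y' z z'))
    = mid C (x \<otimes> y) (x' \<otimes> y') z z' \<cdot> ((mid C x x' y y' \<star> Ide C (z \<otimes> z')) \<cdot> Ass C (x \<otimes> x') (y \<otimes> y') (z \<otimes> z'))"
proof (rule nf_eq)
  let ?s = "TN (TN (TL x) (TL x')) (TN (TN (TL y) (TL y')) (TN (TL z) (TL z')))"
  let ?t = "TN (TN (TN (TL x) (TL y)) (TL z)) (TN (TN (TL x') (TL y')) (TL z'))"
  have m1: "normal_form (TN (TN (TL x) (TL x')) (TN (TN (TL y) (TL z)) (TN (TL y') (TL z'))))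
      (TN (TN (TL x) (TN (TL y) (TL z))) (TN (TL x') (TN (TL y') (TL z'))))
      (mid C x x' (y \<otimes> z) (y' \<otimes> z')) [1, 2]"
    using nf_mid[OF nf_sym_right[where s = "TL x'" and t = "TL y" and u = "TL z", OF nf_sym nf_sym],
        where s = "TL x" and v = "TN (TL y') (TL z')"]
    by (simp add: nf_sym numeral_2_eq_2)
  have m2: "normal_form (TN (TN (TN (TL x) (TL y)) (TN (TL x') (TL y'))) (TN (TL z) (TL z'))) ?t
      (mid C (x \<otimes> y) (x' \<otimes> y') z z') [3, 2]"
    using nf_mid[OF nf_sym_left[where s = "TL x'" and t = "TL y'" and u = "TL z", OF nf_sym nf_sym],
        where s = "TN (TL x) (TL y)" and v = "TL z'"]
    by (simp add: nf_sym numeral_2_eq_2 numeral_3_eq_3)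
  show "normal_form ?s ?t ((Ass C x y z \<star> Ass C x' y' z')
      \<cdot> (mid C x x' (y \<otimes> z) (y' \<otimes> z') \<cdot> (Ide C (x \<otimes> x') \<star> mid C y y' z z'))) [3, 1, 2]"
    using nf_comp[OF nf_comp[OF nf_left[OF nf_mid_leaves, of y y' z z' "TN (TL x) (TL x')"] m1]
        nf_tens[OF nf_ass nf_ass]]
    by (simp add: numeral_3_eq_3)
  show "normal_form ?s ?t (mid C (x \<otimes> y) (x' \<otimes> y') z z'
      \<cdot> ((mid C x x' y y' \<star> Ide C (z \<otimes> z')) \<cdot> Ass C (x \<otimes> x') (y \<otimes> y') (z \<otimes> z'))) [1, 3, 2]"
    using nf_comp[OF nf_comp[OF nf_ass nf_right[OF nf_mid_leaves, of x x' y y' "TN (TL z) (TL z')"]] m2]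
    by simp
  show "swaps_arr C [3, 1, 2] (leaves ?s) Z = swaps_arr C [1, 3, 2] (leaves ?s) Z" if "Z \<in> Obj C" for Z
    using swaps_arr_commute[of "leaves ?s" Z 1 3 "[]" "[2]"] that by (simp del: swaps_arr.simps)
qed

end

context
  fixes x x'
  assumes obj [simp]: "x \<in> Obj C" "x' \<in> Obj C"
begin

text \<open>The interchange only moves \<open>x'\<close> past a unit, so the lists of both sides are
  empty.\<close>

lemma mid_ru: "(Ru C x \<star> Ru C x') \<cdot> (mid C x x' (Unit C) (Unit C) \<cdot> (Ide C (x \<otimes> x') \<star> inv_arr C (Ru C (Unit C))))
    = Ru C (x \<otimes> x')"
proof (rule nf_eq)
  let ?s = "TN (TN (TL x) (TL x')) TU" and ?t = "TN (TL x) (TL x')"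
  show "normal_form ?s ?t ((Ru C x \<star> Ru C x')
      \<cdot> (mid C x x' (Unit C) (Unit C) \<cdot> (Ide C (x \<otimes> x') \<star> inv_arr C (Ru C (Unit C))))) []"
    using nf_comp[OF nf_comp[OF nf_left[OF nf_inv[OF nf_ru[of TU]], of "TN (TL x) (TL x')"]
          nf_mid[OF nf_sym_unit(1), of "TL x'" "TL x" TU]] nf_tens[OF nf_ru nf_ru]]
    by simp
  show "normal_form ?s ?t (Ru C (x \<otimes> x')) []" using nf_ru[of ?t] by simp
qed simp

lemma mid_lu: "(Lu C x \<star> Lu C x') \<cdot> (mid C (Unit C) (Unit C) x x' \<cdot> (inv_arr C (Ru C (Unit C)) \<star> Ide C (x \<otimes> x')))
    = Lu C (x \<otimes> x')"
proof (rule nf_eq)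
  let ?s = "TN TU (TN (TL x) (TL x'))" and ?t = "TN (TL x) (TL x')"
  show "normal_form ?s ?t ((Lu C x \<star> Lu C x')
      \<cdot> (mid C (Unit C) (Unit C) x x' \<cdot> (inv_arr C (Ru C (Unit C)) \<star> Ide C (x \<otimes> x')))) []"
    using nf_comp[OF nf_comp[OF nf_right[OF nf_inv[OF nf_ru[of TU]], of "TN (TL x) (TL x')"]
          nf_mid[OF nf_sym_unit(2), of "TL x" TU "TL x'"]] nf_tens[OF nf_lu nf_lu]]
    by simp
  show "normal_form ?s ?t (Lu C (x \<otimes> x')) []" using nf_lu[of ?t] by simp
qed simp

end

context
  fixes x x' y y'
  assumes obj [simp]: "x \<in> Obj C" "x' \<in> Obj C" "y \<in> Obj C" "y' \<in> Obj C"
begin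

text \<open>On the right the last swap of the symmetry and the swap of \<open>mid\<close> are both
  at position 1 and cancel.\<close>

lemma mid_sym: "(Sym C x y \<star> Sym C x' y') \<cdot> mid C x x' y y' = mid C y y' x x' \<cdot> Sym C (x \<otimes> x') (y \<otimes> y')"
proof (rule nf_eq)
  let ?s = "TN (TN (TL x) (TL x')) (TN (TL y) (TL y'))" and ?t = "TN (TN (TL y) (TL x)) (TN (TL y') (TL x'))"
  show "normal_form ?s ?t ((Sym C x y \<star> Sym C x' y') \<cdot> mid C x x' y y') [1, 0, 2]"
    using nf_comp[OF nf_mid_leaves nf_tens[OF nf_sym nf_sym], of x x' y y'] by (simp add: numeral_2_eq_2)
  show "normal_form ?s ?t (mid C y y' x x' \<cdot> Sym C (x \<otimes> x') (y \<otimes> y')) [1, 0, 2, 1, 1]"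
    using nf_comp[OF nf_sym4 nf_mid_leaves, of x x' y y'] by simp
  show "swaps_arr C [1, 0, 2] (leaves ?s) Z = swaps_arr C [1, 0, 2, 1, 1] (leaves ?s) Z" if "Z \<in> Obj C" for Z
    using swaps_arr_cancel[of "leaves ?s" Z "[1, 0, 2]" 1 "[]"] that by (simp del: swaps_arr.simps)
qed

lemma mid_mid [simp]: "mid C x y x' y' \<cdot> mid C x x' y y' = Ide C ((x \<otimes> x') \<otimes> (y \<otimes> y'))"
proof (rule nf_eq)
  let ?s = "TN (TN (TL x) (TL x')) (TN (TL y) (TL y'))"
  show "normal_form ?s ?s (mid C x y x' y' \<cdot> mid C x x' y y') [1, 1]"
    using nf_comp[OF nf_mid_leaves nf_mid_leaves, of x x' y y'] by simp
  show "normal_form ?s ?s (Ide C ((x \<otimes> x') \<otimes> (y \<otimes> y'))) []"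
    using nf_ide[of ?s] by simp
  show "swaps_arr C [1, 1] (leaves ?s) Z = swaps_arr C [] (leaves ?s) Z" if "Z \<in> Obj C" for Z
    using swaps_arr_cancel[of "leaves ?s" Z "[]" 1 "[]"] that by (simp del: swaps_arr.simps)
qed

lemma mid_mid_r [simp]:
  "\<lbrakk>k \<in> Arr C; Cod C k = (x \<otimes> x') \<otimes> (y \<otimes> y')\<rbrakk>
    \<Longrightarrow> mid C x y x' y' \<cdot> (mid C x x' y y' \<cdot> k) = k"
  by (simp flip: comp_assoc')

end

text \<open>As \<open>mid\<close> is an involution, each compatibility of the tensor functor with the structure
  yields the corresponding monoidality of the structure.\<close>

lemma ass_mid:
  assumes [simp]: "x \<in> Obj C" "x' \<in> Obj C" "y \<in> Obj C" "y' \<in> Obj C" "z \<in> Obj C" "z' \<in> Obj C"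
  shows "Ass C (x \<otimes> x') (y \<otimes> y') (z \<otimes> z') \<cdot> ((Ide C (x \<otimes> x') \<star> mid C y z y' z') \<cdot> mid C x (y \<otimes> z) x' (y' \<otimes> z'))
    = (mid C x y x' y' \<star> Ide C (z \<otimes> z')) \<cdot> (mid C (x \<otimes> y) z (x' \<otimes> y') z' \<cdot> (Ass C x y z \<star> Ass C x' y' z'))"
    (is "?a \<cdot> ?m = ?n \<cdot> (?n' \<cdot> ?b)")
proof -
  have "?n \<cdot> (?n' \<cdot> ((?b \<cdot> (mid C x x' (y \<otimes> z) (y' \<otimes> z') \<cdot> (Ide C (x \<otimes> x') \<star> mid C y y' z z'))) \<cdot> ?m))
      = ?a \<cdot> ?m"
    by (simp add: mid_ass merge_r)
  then show ?thesis by (simp add: merge_r)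
qed

lemma
  assumes [simp]: "x \<in> Obj C" "y \<in> Obj C"
  shows ru_mid: "Ru C (x \<otimes> y) \<cdot> ((Ide C (x \<otimes> y) \<star> Ru C (Unit C)) \<cdot> mid C x (Unit C) y (Unit C)) = Ru C x \<star> Ru C y"
    and lu_mid: "Lu C (x \<otimes> y) \<cdot> ((Ru C (Unit C) \<star> Ide C (x \<otimes> y)) \<cdot> mid C (Unit C) x (Unit C) y) = Lu C x \<star> Lu C y"
  by (simp_all add: merge_r flip: mid_ru mid_lu)

lemma sym_mid:
  assumes [simp]: "x \<in> Obj C" "x' \<in> Obj C" "y \<in> Obj C" "y' \<in> Obj C"
  shows "Sym C (x \<otimes> x') (y \<otimes> y') \<cdot> mid C x y x' y' = mid C y x y' x' \<cdot> (Sym C x y \<star> Sym C x' y')"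
proof -
  have "mid C y x y' x' \<cdot> (((Sym C x y \<star> Sym C x' y') \<cdot> mid C x x' y y') \<cdot> mid C x y x' y')
      = Sym C (x \<otimes> x') (y \<otimes> y') \<cdot> mid C x y x' y'"
    by (simp add: mid_sym)
  then show ?thesis by simp
qed

lemma ass_unit: "Ass C (Unit C) (Unit C) (Unit C) \<cdot> (Ide C (Unit C) \<star> inv_arr C (Ru C (Unit C)))
    = inv_arr C (Ru C (Unit C)) \<star> Ide C (Unit C)"
proof (rule nf_eq)
  let ?s = "TN TU TU" and ?t = "TN (TN TU TU) TU"
  show "normal_form ?s ?t (Ass C (Unit C) (Unit C) (Unit C) \<cdot> (Ide C (Unit C) \<star> inv_arr C (Ru C (Unit C)))) []"
    using nf_comp[OF nf_left[OF nf_inv[OF nf_ru[of TU]], of TU] nf_ass] by simp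
  show "normal_form ?s ?t (inv_arr C (Ru C (Unit C)) \<star> Ide C (Unit C)) []"
    using nf_right[OF nf_inv[OF nf_ru[of TU]], of TU] by simp
qed simp

lemma sym_unit_unit: "Sym C (Unit C) (Unit C) = Ide C (Unit C \<otimes> Unit C)"
  using nf_eq[OF nf_sym_unit(1)[of TU] nf_ide[of "TN TU TU"]] by simp

lemma mid_nat':
  "\<lbrakk>f \<in> Arr C; g \<in> Arr C; h \<in> Arr C; k \<in> Arr C; Cod C f = a; Cod C g = b; Cod C h = c; Cod C k = d\<rbrakk>
    \<Longrightarrow> mid C a b c d \<cdot> ((f \<star> g) \<star> (h \<star> k))
      = ((f \<star> h) \<star> (g \<star> k)) \<cdot> mid C (Dom C f) (Dom C g) (Dom C h) (Dom C k)"
  using mid_nat by auto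

text \<open>Stated with the identity of \<open>a \<otimes> b\<close>, the form to which the
  simplifier brings \<open>Ide C a \<star> Ide C b\<close>.\<close>

lemma mid_nat_left_r:
  "\<lbrakk>a \<in> Obj C; b \<in> Obj C; h \<in> Arr C; k \<in> Arr C; Cod C h = c; Cod C k = d; l \<in> Arr C;
    Cod C l = (a \<otimes> b) \<otimes> (Dom C h \<otimes> Dom C k)\<rbrakk>
    \<Longrightarrow> mid C a b c d \<cdot> ((Ide C (a \<otimes> b) \<star> (h \<star> k)) \<cdot> l)
      = ((Ide C a \<star> h) \<star> (Ide C b \<star> k)) \<cdot> (mid C a b (Dom C h) (Dom C k) \<cdot> l)"
  using mid_nat_r[of "Ide C a" "Ide C b" h k l] by auto

lemma mid_nat_right_r:
  "\<lbrakk>c \<in> Obj C; d \<in> Obj C; f \<in> Arr C; g \<in> Arr C; Cod C f = a; Cod C g = b; l \<in> Arr C;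
    Cod C l = (Dom C f \<otimes> Dom C g) \<otimes> (c \<otimes> d)\<rbrakk>
    \<Longrightarrow> mid C a b c d \<cdot> (((f \<star> g) \<star> Ide C (c \<otimes> d)) \<cdot> l)
      = ((f \<star> Ide C c) \<star> (g \<star> Ide C d)) \<cdot> (mid C (Dom C f) (Dom C g) c d \<cdot> l)"
  using mid_nat_r[of f g "Ide C c" "Ide C d" l] by auto

lemma sym_nat_r:
  "\<lbrakk>f \<in> Arr C; g \<in> Arr C; Cod C f = a; Cod C g = b; k \<in> Arr C; Cod C k = Dom C f \<otimes> Dom C g\<rbrakk>
    \<Longrightarrow> Sym C a b \<cdot> ((f \<star> g) \<cdot> k) = (g \<star> f) \<cdot> (Sym C (Dom C f) (Dom C g) \<cdot> k)"
  by (auto simp: sym_nat' simp flip: comp_assoc')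

lemma ru_nat_r:
  "\<lbrakk>f \<in> Arr C; Cod C f = a; k \<in> Arr C; Cod C k = Dom C f \<otimes> Unit C\<rbrakk>
    \<Longrightarrow> Ru C a \<cdot> ((f \<star> Ide C (Unit C)) \<cdot> k) = f \<cdot> (Ru C (Dom C f) \<cdot> k)"
  by (auto simp: ru_nat' simp flip: comp_assoc')

lemma lu_nat_r:
  "\<lbrakk>f \<in> Arr C; Cod C f = a; k \<in> Arr C; Cod C k = Unit C \<otimes> Dom C f\<rbrakk>
    \<Longrightarrow> Lu C a \<cdot> ((Ide C (Unit C) \<star> f) \<cdot> k) = f \<cdot> (Lu C (Dom C f) \<cdot> k)"
  by (auto simp: lu_nat' simp flip: comp_assoc')

lemma hexagon':
  "\<lbrakk>a \<in> Obj C; b \<in> Obj C; c \<in> Obj C\<rbrakk>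
    \<Longrightarrow> Ass C c a b \<cdot> (Sym C (a \<otimes> b) c \<cdot> Ass C a b c)
      = (Sym C a c \<star> Ide C b) \<cdot> (Ass C a c b \<cdot> (Ide C a \<star> Sym C b c))"
  using hexagon[of a b c] by simp

lemma split_left:
  "\<lbrakk>g \<in> Arr C; f \<in> Arr C; Dom C g = Cod C f; a \<in> Obj C\<rbrakk>
    \<Longrightarrow> Ide C a \<star> (g \<cdot> f) = (Ide C a \<star> g) \<cdot> (Ide C a \<star> f)"
  by (simp add: merge)

lemma split_right:
  "\<lbrakk>g \<in> Arr C; f \<in> Arr C; Dom C g = Cod C f; a \<in> Obj C\<rbrakk>
    \<Longrightarrow> (g \<cdot> f) \<star> Ide C a = (g \<star> Ide C a) \<cdot> (f \<star> Ide C a)"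
  by (simp add: merge)

end

section \<open>Functors and transformations in untyped style\<close>

lemma restrict2_apply [simp]: "\<lbrakk>x \<in> S; y \<in> S\<rbrakk> \<Longrightarrow> restrict2 f S x y = f x y"
  by (simp add: restrict2_def)

lemma restrict2_idem [simp]: "restrict2 (restrict2 f S) S = restrict2 f S"
  by (auto simp: restrict2_def fun_eq_iff)

lemma restrict2_cong:
  "(\<And>x y. \<lbrakk>x \<in> S; y \<in> S\<rbrakk> \<Longrightarrow> f x y = g x y) \<Longrightarrow> restrict2 f S = restrict2 g S"
  by (auto simp: restrict2_def fun_eq_iff)

context sm_functor
begin

declare fo_obj [simp] fa_ide [simp]

lemma fa_arr [simp]: "f \<in> Arr A \<Longrightarrow> FA F f \<in> Arr B"
  and dom_fa [simp]: "f \<in> Arr A \<Longrightarrow> Dom B (FA F f) = FO F (Dom A f)"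
  and cod_fa [simp]: "f \<in> Arr A \<Longrightarrow> Cod B (FA F f) = FO F (Cod A f)"
  using fa_hom[of f "Dom A f" "Cod A f"] by (auto simp: Hom_iff)

lemma fa_comp' [simp]:
  "\<lbrakk>g \<in> Arr A; f \<in> Arr A; Dom A g = Cod A f\<rbrakk> \<Longrightarrow> FA F (g \<cdot>\<^bsub>A\<^esub> f) = FA F g \<cdot>\<^bsub>B\<^esub> FA F f"
  using fa_comp[of f "Dom A f" "Cod A f" g "Cod A g"] by (auto simp: Hom_iff)

lemma f0_arr [simp]: "F0 F \<in> Arr B" "Dom B (F0 F) = Unit B" "Cod B (F0 F) = FO F (Unit A)"
  using f0_hom by (auto simp: Hom_iff)

lemma f2_arr [simp]:
  assumes "x \<in> Obj A" "y \<in> Obj A"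
  shows "F2 F x y \<in> Arr B" "Dom B (F2 F x y) = FO F x \<otimes>\<^bsub>B\<^esub> FO F y" "Cod B (F2 F x y) = FO F (x \<otimes>\<^bsub>A\<^esub> y)"
  using f2_hom[OF assms] by (auto simp: Hom_iff)

lemma f2_nat':
  "\<lbrakk>f \<in> Arr A; g \<in> Arr A; Cod A f = x; Cod A g = y\<rbrakk>
    \<Longrightarrow> F2 F x y \<cdot>\<^bsub>B\<^esub> (FA F f \<star>\<^bsub>B\<^esub> FA F g) = FA F (f \<star>\<^bsub>A\<^esub> g) \<cdot>\<^bsub>B\<^esub> F2 F (Dom A f) (Dom A g)"
  by (rule f2_nat) (auto simp: Hom_iff)

lemma f_ass':
  "\<lbrakk>x \<in> Obj A; y \<in> Obj A; z \<in> Obj A\<rbrakk>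
    \<Longrightarrow> FA F (Ass A x y z) \<cdot>\<^bsub>B\<^esub> (F2 F x (y \<otimes>\<^bsub>A\<^esub> z) \<cdot>\<^bsub>B\<^esub> (Ide B (FO F x) \<star>\<^bsub>B\<^esub> F2 F y z))
      = F2 F (x \<otimes>\<^bsub>A\<^esub> y) z \<cdot>\<^bsub>B\<^esub> ((F2 F x y \<star>\<^bsub>B\<^esub> Ide B (FO F z)) \<cdot>\<^bsub>B\<^esub> Ass B (FO F x) (FO F y) (FO F z))"
  using f_ass[of x y z] by simp

lemma f_ru':
  "x \<in> Obj A \<Longrightarrow> FA F (Ru A x) \<cdot>\<^bsub>B\<^esub> (F2 F x (Unit A) \<cdot>\<^bsub>B\<^esub> (Ide B (FO F x) \<star>\<^bsub>B\<^esub> F0 F)) = Ru B (FO F x)"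
  using f_ru[of x] by simp

lemma f_lu':
  "x \<in> Obj A \<Longrightarrow> FA F (Lu A x) \<cdot>\<^bsub>B\<^esub> (F2 F (Unit A) x \<cdot>\<^bsub>B\<^esub> (F0 F \<star>\<^bsub>B\<^esub> Ide B (FO F x))) = Lu B (FO F x)"
  using f_lu[of x] by simp

lemma fa_iso [simp]: "iso_arr A f \<Longrightarrow> iso_arr B (FA F f)"
  and fa_inv [simp]: "iso_arr A f \<Longrightarrow> FA F (inv_arr A f) = inv_arr B (FA F f)"
proof -
  assume [simp]: "iso_arr A f"
  have "inverse_arrows B (FA F f) (FA F (inv_arr A f))"
    by (rule B.inverse_arrowsI) (simp_all add: A.iso_arr_arr flip: fa_comp')
  then show "iso_arr B (FA F f)" "FA F (inv_arr A f) = inv_arr B (FA F f)"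
    by (auto simp: iso_arr_def B.inv_arr_eq)
qed

end

lemma sm_functor_smc: "sm_functor A B F \<Longrightarrow> smc A" "sm_functor A B F \<Longrightarrow> smc B"
  by (simp_all add: sm_functor_def)

lemma sm_transformation_smc: "sm_transformation A B \<sigma> \<Longrightarrow> smc A" "sm_transformation A B \<sigma> \<Longrightarrow> smc B"
  by (simp_all add: sm_transformation_def sm_functor_def)

text \<open>The order of the premises fixes the case numbers in later proofs by
  \<open>goal_cases\<close>: 10 and 11 are preservation of identities and composites, 18 is
  naturality of \<open>F2\<close>, and 19 to 22 are associativity, the right and left unit laws and
  symmetry.\<close>

lemma sm_functorI:
  assumes "smc A" "smc B" "FO F \<in> extensional (Obj A)" "FA F \<in> extensional (Arr A)"
    "F2 F = restrict2 (F2 F) (Obj A)"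
    and "\<And>x. x \<in> Obj A \<Longrightarrow> FO F x \<in> Obj B"
    and "\<And>f. f \<in> Arr A \<Longrightarrow> FA F f \<in> Arr B"
    and "\<And>f. f \<in> Arr A \<Longrightarrow> Dom B (FA F f) = FO F (Dom A f)"
    and "\<And>f. f \<in> Arr A \<Longrightarrow> Cod B (FA F f) = FO F (Cod A f)"
    and "\<And>x. x \<in> Obj A \<Longrightarrow> FA F (Ide A x) = Ide B (FO F x)"
    and "\<And>f g. \<lbrakk>f \<in> Arr A; g \<in> Arr A; Dom A g = Cod A f\<rbrakk> \<Longrightarrow> FA F (g \<cdot>\<^bsub>A\<^esub> f) = FA F g \<cdot>\<^bsub>B\<^esub> FA F f"
    and "F0 F \<in> Arr B" "Dom B (F0 F) = Unit B" "Cod B (F0 F) = FO F (Unit A)"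
    and "\<And>x y. \<lbrakk>x \<in> Obj A; y \<in> Obj A\<rbrakk> \<Longrightarrow> F2 F x y \<in> Arr B"
    and "\<And>x y. \<lbrakk>x \<in> Obj A; y \<in> Obj A\<rbrakk> \<Longrightarrow> Dom B (F2 F x y) = FO F x \<otimes>\<^bsub>B\<^esub> FO F y"
    and "\<And>x y. \<lbrakk>x \<in> Obj A; y \<in> Obj A\<rbrakk> \<Longrightarrow> Cod B (F2 F x y) = FO F (x \<otimes>\<^bsub>A\<^esub> y)"
    and "\<And>f g. \<lbrakk>f \<in> Arr A; g \<in> Arr A\<rbrakk> \<Longrightarrow> F2 F (Cod A f) (Cod A g) \<cdot>\<^bsub>B\<^esub> (FA F f \<star>\<^bsub>B\<^esub> FA F g)
      = FA F (f \<star>\<^bsub>A\<^esub> g) \<cdot>\<^bsub>B\<^esub> F2 F (Dom A f) (Dom A g)"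
    and "\<And>x y z. \<lbrakk>x \<in> Obj A; y \<in> Obj A; z \<in> Obj A\<rbrakk>
      \<Longrightarrow> FA F (Ass A x y z) \<cdot>\<^bsub>B\<^esub> (F2 F x (y \<otimes>\<^bsub>A\<^esub> z) \<cdot>\<^bsub>B\<^esub> (Ide B (FO F x) \<star>\<^bsub>B\<^esub> F2 F y z))
        = F2 F (x \<otimes>\<^bsub>A\<^esub> y) z \<cdot>\<^bsub>B\<^esub> ((F2 F x y \<star>\<^bsub>B\<^esub> Ide B (FO F z)) \<cdot>\<^bsub>B\<^esub> Ass B (FO F x) (FO F y) (FO F z))"
    and "\<And>x. x \<in> Obj A
      \<Longrightarrow> FA F (Ru A x) \<cdot>\<^bsub>B\<^esub> (F2 F x (Unit A) \<cdot>\<^bsub>B\<^esub> (Ide B (FO F x) \<star>\<^bsub>B\<^esub> F0 F)) = Ru B (FO F x)"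
    and "\<And>x. x \<in> Obj A
      \<Longrightarrow> FA F (Lu A x) \<cdot>\<^bsub>B\<^esub> (F2 F (Unit A) x \<cdot>\<^bsub>B\<^esub> (F0 F \<star>\<^bsub>B\<^esub> Ide B (FO F x))) = Lu B (FO F x)"
    and "\<And>x y. \<lbrakk>x \<in> Obj A; y \<in> Obj A\<rbrakk>
      \<Longrightarrow> FA F (Sym A x y) \<cdot>\<^bsub>B\<^esub> F2 F x y = F2 F y x \<cdot>\<^bsub>B\<^esub> Sym B (FO F x) (FO F y)"
  shows "sm_functor A B F"
proof -
  interpret A: smc A by fact
  interpret B: smc B by fact
  show ?thesis
    by unfold_locales (use assms(3-) in \<open>auto simp: Hom_iff\<close>)
qed

lemma smf_eqI:
  assumes "sm_functor A B F" "sm_functor A B G"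
    "\<And>x. x \<in> Obj A \<Longrightarrow> FO F x = FO G x" "\<And>f. f \<in> Arr A \<Longrightarrow> FA F f = FA G f" "F0 F = F0 G"
    "\<And>x y. \<lbrakk>x \<in> Obj A; y \<in> Obj A\<rbrakk> \<Longrightarrow> F2 F x y = F2 G x y"
  shows "F = G"
proof (rule smfun.equality)
  interpret F: sm_functor A B F by fact
  interpret G: sm_functor A B G by fact
  show "FO F = FO G" using assms by (intro extensionalityI[OF F.fo_ext G.fo_ext]) auto
  show "FA F = FA G" using assms by (intro extensionalityI[OF F.fa_ext G.fa_ext]) auto
  have "restrict2 (F2 F) (Obj A) = restrict2 (F2 G) (Obj A)" using assms by (intro restrict2_cong) auto
  then show "F2 F = F2 G" using F.f2_ext G.f2_ext by simp
qed (use assms in auto)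

context sm_transformation
begin

lemma tc_arr [simp]:
  assumes "x \<in> Obj A"
  shows "TC \<sigma> x \<in> Arr B" "Dom B (TC \<sigma> x) = FO (TDom \<sigma>) x" "Cod B (TC \<sigma> x) = FO (TCod \<sigma>) x"
  using tc_hom[OF assms] by (auto simp: Hom_iff)

lemma tc_nat':
  "\<lbrakk>f \<in> Arr A; Cod A f = y\<rbrakk>
    \<Longrightarrow> TC \<sigma> y \<cdot>\<^bsub>B\<^esub> FA (TDom \<sigma>) f = FA (TCod \<sigma>) f \<cdot>\<^bsub>B\<^esub> TC \<sigma> (Dom A f)"
  by (rule tc_nat) (auto simp: Hom_iff)

end

text \<open>As case numbers, 7 is naturality, 8 the condition at the unit and 9 the condition at a
  tensor product.\<close>

lemma sm_transformationI:
  assumes "sm_functor A B (TDom \<sigma>)" "sm_functor A B (TCod \<sigma>)" "TC \<sigma> \<in> extensional (Obj A)"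
    and "\<And>x. x \<in> Obj A \<Longrightarrow> TC \<sigma> x \<in> Arr B"
    and "\<And>x. x \<in> Obj A \<Longrightarrow> Dom B (TC \<sigma> x) = FO (TDom \<sigma>) x"
    and "\<And>x. x \<in> Obj A \<Longrightarrow> Cod B (TC \<sigma> x) = FO (TCod \<sigma>) x"
    and "\<And>f. f \<in> Arr A
        \<Longrightarrow> TC \<sigma> (Cod A f) \<cdot>\<^bsub>B\<^esub> FA (TDom \<sigma>) f = FA (TCod \<sigma>) f \<cdot>\<^bsub>B\<^esub> TC \<sigma> (Dom A f)"
    and "TC \<sigma> (Unit A) \<cdot>\<^bsub>B\<^esub> F0 (TDom \<sigma>) = F0 (TCod \<sigma>)"
    and "\<And>x y. \<lbrakk>x \<in> Obj A; y \<in> Obj A\<rbrakk>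
        \<Longrightarrow> TC \<sigma> (x \<otimes>\<^bsub>A\<^esub> y) \<cdot>\<^bsub>B\<^esub> F2 (TDom \<sigma>) x y
          = F2 (TCod \<sigma>) x y \<cdot>\<^bsub>B\<^esub> (TC \<sigma> x \<star>\<^bsub>B\<^esub> TC \<sigma> y)"
  shows "sm_transformation A B \<sigma>"
proof -
  interpret S: sm_functor A B "TDom \<sigma>" by fact
  interpret T: sm_functor A B "TCod \<sigma>" by fact
  show ?thesis
    by unfold_locales (use assms(3-) in \<open>auto simp: Hom_iff\<close>)
qed

lemma smt_eqI:
  fixes \<sigma> \<tau> :: "('o, 'a, 'p, 'b) smtrans"
  assumes "TDom \<sigma> = TDom \<tau>" "TCod \<sigma> = TCod \<tau>" "TC \<sigma> \<in> extensional S" "TC \<tau> \<in> extensional S"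
    "\<And>x. x \<in> S \<Longrightarrow> TC \<sigma> x = TC \<tau> x"
  shows "\<sigma> = \<tau>"
  by (rule smtrans.equality) (use assms in \<open>auto intro: extensionalityI[of "TC \<sigma>" S]\<close>)

section \<open>The internal hom\<close>

lemma const_unit_functor:
  assumes "smc A" "smc B" shows "sm_functor A B (const_unit A B)"
proof -
  interpret A: smc A by fact
  interpret B: smc B by fact
  \<comment> \<open>The associativity axiom of the constant functor. Its structure map is
    \<open>Ru\<close> at the unit, which is also \<open>Lu\<close> there, so the triangle
    applies.\<close>
  have t: "(Ru B (Unit B) \<star>\<^bsub>B\<^esub> Ide B (Unit B)) \<cdot>\<^bsub>B\<^esub> Ass B (Unit B) (Unit B) (Unit B) = Ide B (Unit B) \<star>\<^bsub>B\<^esub> Ru B (Unit B)"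
    using B.triangle[of "Unit B" "Unit B"] B.ru_lu_unit by simp
  show ?thesis
    by (rule sm_functorI)
      (simp_all add: const_unit_def assms t B.sym_unit_unit B.ru_lu_unit[symmetric])
qed

text \<open>In each coherence axiom, naturality first moves \<open>mid\<close> next to the source,
  then the axiom for \<open>F\<close> and \<open>G\<close> applies in each of the two factors, and
  what remains is \<open>mid_ass\<close>, \<open>mid_ru\<close>, \<open>mid_lu\<close> or
  \<open>mid_sym\<close>.\<close>

lemma fun_tens_functor:
  assumes "sm_functor A B F" "sm_functor A B G"
  shows "sm_functor A B (fun_tens A B F G)"
proof -
  interpret A: smc A by (rule sm_functor_smc[OF assms(1)])
  interpret B: smc B by (rule sm_functor_smc[OF assms(1)])
  interpret F: sm_functor A B F by fact
  interpret G: sm_functor A B G by fact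
  let ?FG = "fun_tens A B F G"
  show ?thesis
  proof (rule sm_functorI, goal_cases)
    case (18 f g)
    then show ?case
      by (simp add: fun_tens_def B.merge_r B.mid_nat' F.f2_nat' G.f2_nat')
  next
    case (19 x y z)
    let ?a = "FO F x" and ?a' = "FO G x" and ?b = "FO F y" and ?b' = "FO G y" and ?c = "FO F z" and ?c' = "FO G z"
    let ?m = "mid B ?a ?a' (?b \<otimes>\<^bsub>B\<^esub> ?c) (?b' \<otimes>\<^bsub>B\<^esub> ?c') \<cdot>\<^bsub>B\<^esub> (Ide B (?a \<otimes>\<^bsub>B\<^esub> ?a') \<star>\<^bsub>B\<^esub> mid B ?b ?b' ?c ?c')"
    have "FA ?FG (Ass A x y z) \<cdot>\<^bsub>B\<^esub> (F2 ?FG x (y \<otimes>\<^bsub>A\<^esub> z)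
        \<cdot>\<^bsub>B\<^esub> (Ide B (FO ?FG x) \<star>\<^bsub>B\<^esub> F2 ?FG y z))
      = (FA F (Ass A x y z) \<star>\<^bsub>B\<^esub> FA G (Ass A x y z)) \<cdot>\<^bsub>B\<^esub> ((F2 F x (y \<otimes>\<^bsub>A\<^esub> z) \<star>\<^bsub>B\<^esub> F2 G x (y \<otimes>\<^bsub>A\<^esub> z))
        \<cdot>\<^bsub>B\<^esub> (((Ide B ?a \<star>\<^bsub>B\<^esub> F2 F y z) \<star>\<^bsub>B\<^esub> (Ide B ?a' \<star>\<^bsub>B\<^esub> F2 G y z)) \<cdot>\<^bsub>B\<^esub> ?m))"
      using 19 by (simp add: fun_tens_def B.split_left B.mid_nat_left_r)
    also have "\<dots> = (F2 F (x \<otimes>\<^bsub>A\<^esub> y) z \<star>\<^bsub>B\<^esub> F2 G (x \<otimes>\<^bsub>A\<^esub> y) z) \<cdot>\<^bsub>B\<^esub>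
        (((F2 F x y \<star>\<^bsub>B\<^esub> Ide B ?c) \<star>\<^bsub>B\<^esub> (F2 G x y \<star>\<^bsub>B\<^esub> Ide B ?c')) \<cdot>\<^bsub>B\<^esub> ((Ass B ?a ?b ?c \<star>\<^bsub>B\<^esub> Ass B ?a' ?b' ?c') \<cdot>\<^bsub>B\<^esub> ?m))"
      using 19 by (simp add: B.merge_r F.f_ass' G.f_ass')
    also have "\<dots> = F2 ?FG (x \<otimes>\<^bsub>A\<^esub> y) z
        \<cdot>\<^bsub>B\<^esub> ((F2 ?FG x y \<star>\<^bsub>B\<^esub> Ide B (FO ?FG z))
        \<cdot>\<^bsub>B\<^esub> Ass B (FO ?FG x) (FO ?FG y) (FO ?FG z))"
      using 19 by (simp add: fun_tens_def B.split_right B.mid_nat_right_r B.mid_ass)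
    finally show ?case .
  next
    case (20 x)
    let ?a = "FO F x" and ?a' = "FO G x" and ?I = "Unit B"
    let ?m = "mid B ?a ?a' ?I ?I \<cdot>\<^bsub>B\<^esub> (Ide B (?a \<otimes>\<^bsub>B\<^esub> ?a') \<star>\<^bsub>B\<^esub> inv_arr B (Ru B ?I))"
    have "FA ?FG (Ru A x) \<cdot>\<^bsub>B\<^esub> (F2 ?FG x (Unit A)
        \<cdot>\<^bsub>B\<^esub> (Ide B (FO ?FG x) \<star>\<^bsub>B\<^esub> F0 ?FG))
      = (FA F (Ru A x) \<star>\<^bsub>B\<^esub> FA G (Ru A x)) \<cdot>\<^bsub>B\<^esub> ((F2 F x (Unit A) \<star>\<^bsub>B\<^esub> F2 G x (Unit A))
        \<cdot>\<^bsub>B\<^esub> (((Ide B ?a \<star>\<^bsub>B\<^esub> F0 F) \<star>\<^bsub>B\<^esub> (Ide B ?a' \<star>\<^bsub>B\<^esub> F0 G)) \<cdot>\<^bsub>B\<^esub> ?m))"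
      using 20 by (simp add: fun_tens_def B.split_left B.mid_nat_left_r)
    also have "\<dots> = (Ru B ?a \<star>\<^bsub>B\<^esub> Ru B ?a') \<cdot>\<^bsub>B\<^esub> ?m"
      using 20 by (simp add: B.merge_r F.f_ru' G.f_ru')
    finally show ?case using 20 by (simp add: B.mid_ru fun_tens_def)
  next
    case (21 x)
    let ?a = "FO F x" and ?a' = "FO G x" and ?I = "Unit B"
    let ?m = "mid B ?I ?I ?a ?a' \<cdot>\<^bsub>B\<^esub> (inv_arr B (Ru B ?I) \<star>\<^bsub>B\<^esub> Ide B (?a \<otimes>\<^bsub>B\<^esub> ?a'))"
    have "FA ?FG (Lu A x) \<cdot>\<^bsub>B\<^esub> (F2 ?FG (Unit A) x
        \<cdot>\<^bsub>B\<^esub> (F0 ?FG \<star>\<^bsub>B\<^esub> Ide B (FO ?FG x)))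
      = (FA F (Lu A x) \<star>\<^bsub>B\<^esub> FA G (Lu A x)) \<cdot>\<^bsub>B\<^esub> ((F2 F (Unit A) x \<star>\<^bsub>B\<^esub> F2 G (Unit A) x)
        \<cdot>\<^bsub>B\<^esub> (((F0 F \<star>\<^bsub>B\<^esub> Ide B ?a) \<star>\<^bsub>B\<^esub> (F0 G \<star>\<^bsub>B\<^esub> Ide B ?a')) \<cdot>\<^bsub>B\<^esub> ?m))"
      using 21 by (simp add: fun_tens_def B.split_right B.mid_nat_right_r)
    also have "\<dots> = (Lu B ?a \<star>\<^bsub>B\<^esub> Lu B ?a') \<cdot>\<^bsub>B\<^esub> ?m"
      using 21 by (simp add: B.merge_r F.f_lu' G.f_lu')
    finally show ?case using 21 by (simp add: B.mid_lu fun_tens_def)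
  next
    case (22 x y)
    then show ?case
      by (simp add: fun_tens_def B.merge_r B.mid_sym[symmetric] F.f_sym G.f_sym)
  qed (simp_all add: fun_tens_def A.smc_axioms B.smc_axioms B.merge)
qed

section \<open>Arrows of the internal hom\<close>

lemma ihom_simps [simp]:
  "F \<in> Obj (ihom A B) \<longleftrightarrow> sm_functor A B F"
  "\<sigma> \<in> Arr (ihom A B) \<longleftrightarrow> sm_transformation A B \<sigma>"
  "Dom (ihom A B) = TDom" "Cod (ihom A B) = TCod"
  "Unit (ihom A B) = const_unit A B"
  "TensO (ihom A B) = fun_tens A B"
  by (simp_all add: ihom_def)

lemma fun_tens_simps [simp]:
  "x \<in> Obj A \<Longrightarrow> FO (fun_tens A B F G) x = FO F x \<otimes>\<^bsub>B\<^esub> FO G x"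
  "f \<in> Arr A \<Longrightarrow> FA (fun_tens A B F G) f = FA F f \<star>\<^bsub>B\<^esub> FA G f"
  "F0 (fun_tens A B F G) = (F0 F \<star>\<^bsub>B\<^esub> F0 G) \<cdot>\<^bsub>B\<^esub> inv_arr B (Ru B (Unit B))"
  "\<lbrakk>x \<in> Obj A; y \<in> Obj A\<rbrakk> \<Longrightarrow> F2 (fun_tens A B F G) x y
    = (F2 F x y \<star>\<^bsub>B\<^esub> F2 G x y) \<cdot>\<^bsub>B\<^esub> mid B (FO F x) (FO G x) (FO F y) (FO G y)"
  by (simp_all add: fun_tens_def)

lemma const_unit_simps [simp]:
  "x \<in> Obj A \<Longrightarrow> FO (const_unit A B) x = Unit B"
  "f \<in> Arr A \<Longrightarrow> FA (const_unit A B) f = Ide B (Unit B)"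
  "F0 (const_unit A B) = Ide B (Unit B)"
  "\<lbrakk>x \<in> Obj A; y \<in> Obj A\<rbrakk> \<Longrightarrow> F2 (const_unit A B) x y = Ru B (Unit B)"
  by (simp_all add: const_unit_def)

lemma ihom_sel [simp]:
  "TDom (Ide (ihom A B) F) = F" "TCod (Ide (ihom A B) F) = F"
  "TDom (\<tau> \<cdot>\<^bsub>ihom A B\<^esub> \<sigma>) = TDom \<sigma>" "TCod (\<tau> \<cdot>\<^bsub>ihom A B\<^esub> \<sigma>) = TCod \<tau>"
  "TDom (\<sigma> \<star>\<^bsub>ihom A B\<^esub> \<tau>) = fun_tens A B (TDom \<sigma>) (TDom \<tau>)"
  "TCod (\<sigma> \<star>\<^bsub>ihom A B\<^esub> \<tau>) = fun_tens A B (TCod \<sigma>) (TCod \<tau>)"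
  "TDom (Ass (ihom A B) F G H) = fun_tens A B F (fun_tens A B G H)"
  "TCod (Ass (ihom A B) F G H) = fun_tens A B (fun_tens A B F G) H"
  "TDom (Ru (ihom A B) F) = fun_tens A B F (const_unit A B)" "TCod (Ru (ihom A B) F) = F"
  "TDom (Lu (ihom A B) F) = fun_tens A B (const_unit A B) F" "TCod (Lu (ihom A B) F) = F"
  "TDom (Sym (ihom A B) F G) = fun_tens A B F G" "TCod (Sym (ihom A B) F G) = fun_tens A B G F"
  by (simp_all add: ihom_def)

lemma ihom_ext [simp]:
  "TC (Ide (ihom A B) F) \<in> extensional (Obj A)"
  "TC (\<tau> \<cdot>\<^bsub>ihom A B\<^esub> \<sigma>) \<in> extensional (Obj A)"
  "TC (\<sigma> \<star>\<^bsub>ihom A B\<^esub> \<tau>) \<in> extensional (Obj A)"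
  "TC (Ass (ihom A B) F G H) \<in> extensional (Obj A)"
  "TC (Ru (ihom A B) F) \<in> extensional (Obj A)"
  "TC (Lu (ihom A B) F) \<in> extensional (Obj A)"
  "TC (Sym (ihom A B) F G) \<in> extensional (Obj A)"
  by (simp_all add: ihom_def)

lemma ihom_comp [simp]:
  assumes "x \<in> Obj A"
  shows "TC (Ide (ihom A B) F) x = Ide B (FO F x)"
    "TC (\<tau> \<cdot>\<^bsub>ihom A B\<^esub> \<sigma>) x = TC \<tau> x \<cdot>\<^bsub>B\<^esub> TC \<sigma> x"
    "TC (\<sigma> \<star>\<^bsub>ihom A B\<^esub> \<tau>) x = TC \<sigma> x \<star>\<^bsub>B\<^esub> TC \<tau> x"
    "TC (Ass (ihom A B) F G H) x = Ass B (FO F x) (FO G x) (FO H x)"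
    "TC (Ru (ihom A B) F) x = Ru B (FO F x)"
    "TC (Lu (ihom A B) F) x = Lu B (FO F x)"
    "TC (Sym (ihom A B) F G) x = Sym B (FO F x) (FO G x)"
  using assms by (simp_all add: ihom_def)

lemma (in sm_functor) ide_transformation: "sm_transformation A B (Ide (ihom A B) F)"
  by (rule sm_transformationI) (simp_all add: sm_functor_axioms)

lemma comp_transformation:
  assumes "sm_transformation A B \<sigma>" "sm_transformation A B \<tau>" and d: "TDom \<tau> = TCod \<sigma>"
  shows "sm_transformation A B (\<tau> \<cdot>\<^bsub>ihom A B\<^esub> \<sigma>)"
proof -
  interpret A: smc A by (rule sm_transformation_smc[OF assms(1)])
  interpret B: smc B by (rule sm_transformation_smc[OF assms(1)])
  interpret s: sm_transformation A B \<sigma> by fact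
  interpret t: sm_transformation A B \<tau> by fact
  have nat: "TC \<tau> (Cod A f) \<cdot>\<^bsub>B\<^esub> (TC \<sigma> (Cod A f) \<cdot>\<^bsub>B\<^esub> FA (TDom \<sigma>) f) = FA (TCod \<tau>) f \<cdot>\<^bsub>B\<^esub> (TC \<tau> (Dom A f) \<cdot>\<^bsub>B\<^esub> TC \<sigma> (Dom A f))"
    if "f \<in> Arr A" for f
  proof -
    have "TC \<tau> (Cod A f) \<cdot>\<^bsub>B\<^esub> (TC \<sigma> (Cod A f) \<cdot>\<^bsub>B\<^esub> FA (TDom \<sigma>) f) = (TC \<tau> (Cod A f) \<cdot>\<^bsub>B\<^esub> FA (TDom \<tau>) f) \<cdot>\<^bsub>B\<^esub> TC \<sigma> (Dom A f)"
      using that by (simp add: s.tc_nat' d)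
    then show ?thesis using that by (simp add: t.tc_nat') (simp add: d)
  qed
  have unit: "TC \<tau> (Unit A) \<cdot>\<^bsub>B\<^esub> (TC \<sigma> (Unit A) \<cdot>\<^bsub>B\<^esub> F0 (TDom \<sigma>)) = F0 (TCod \<tau>)"
    using t.tc_unit by (simp add: s.tc_unit d)
  have tens: "TC \<tau> (x \<otimes>\<^bsub>A\<^esub> y) \<cdot>\<^bsub>B\<^esub> (TC \<sigma> (x \<otimes>\<^bsub>A\<^esub> y) \<cdot>\<^bsub>B\<^esub> F2 (TDom \<sigma>) x y)
      = F2 (TCod \<tau>) x y \<cdot>\<^bsub>B\<^esub> ((TC \<tau> x \<cdot>\<^bsub>B\<^esub> TC \<sigma> x) \<star>\<^bsub>B\<^esub> (TC \<tau> y \<cdot>\<^bsub>B\<^esub> TC \<sigma> y))"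
    if "x \<in> Obj A" "y \<in> Obj A" for x y
  proof -
    have "TC \<tau> (x \<otimes>\<^bsub>A\<^esub> y) \<cdot>\<^bsub>B\<^esub> (TC \<sigma> (x \<otimes>\<^bsub>A\<^esub> y) \<cdot>\<^bsub>B\<^esub> F2 (TDom \<sigma>) x y)
      = (TC \<tau> (x \<otimes>\<^bsub>A\<^esub> y) \<cdot>\<^bsub>B\<^esub> F2 (TDom \<tau>) x y) \<cdot>\<^bsub>B\<^esub> (TC \<sigma> x \<star>\<^bsub>B\<^esub> TC \<sigma> y)"
      using that by (simp add: s.tc_tens d)
    then show ?thesis using that by (simp add: t.tc_tens) (simp add: d B.merge)
  qed
  show ?thesis
    by (rule sm_transformationI)
      (simp_all add: d s.S.sm_functor_axioms t.T.sm_functor_axioms nat unit tens)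
qed

lemma tens_transformation:
  assumes "sm_transformation A B \<sigma>" "sm_transformation A B \<tau>"
  shows "sm_transformation A B (\<sigma> \<star>\<^bsub>ihom A B\<^esub> \<tau>)"
proof -
  interpret A: smc A by (rule sm_transformation_smc[OF assms(1)])
  interpret B: smc B by (rule sm_transformation_smc[OF assms(1)])
  interpret s: sm_transformation A B \<sigma> by fact
  interpret t: sm_transformation A B \<tau> by fact
  show ?thesis
    by (rule sm_transformationI)
      (simp_all add: fun_tens_functor s.S.sm_functor_axioms t.T.sm_functor_axioms
        s.T.sm_functor_axioms t.S.sm_functor_axioms B.merge B.merge_r s.tc_nat' t.tc_nat'
        s.tc_unit t.tc_unit s.tc_tens t.tc_tens B.mid_nat')
qed

context
  fixes A :: "('o, 'a) smcat" and B :: "('p, 'b) smcat" and F G H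
  assumes F: "sm_functor A B F" and G: "sm_functor A B G" and H: "sm_functor A B H"
begin

interpretation A: smc A by (rule sm_functor_smc[OF F])
interpretation B: smc B by (rule sm_functor_smc[OF F])
interpretation F: sm_functor A B F by (rule F)
interpretation G: sm_functor A B G by (rule G)
interpretation H: sm_functor A B H by (rule H)

text \<open>Compatibility with the tensor product asks that \<open>mid\<close> commute with
  associators, which is \<open>ass_mid\<close>; the condition at the unit comes down to
  \<open>ass_unit\<close>.\<close>

lemma ass_transformation: "sm_transformation A B (Ass (ihom A B) F G H)"
proof (rule sm_transformationI, goal_cases)
  case 8
  let ?I = "Unit B" and ?r = "inv_arr B (Ru B (Unit B))"
  have "F0 F \<star>\<^bsub>B\<^esub> ((F0 G \<star>\<^bsub>B\<^esub> F0 H) \<cdot>\<^bsub>B\<^esub> ?r) = (F0 F \<star>\<^bsub>B\<^esub> (F0 G \<star>\<^bsub>B\<^esub> F0 H)) \<cdot>\<^bsub>B\<^esub> (Ide B ?I \<star>\<^bsub>B\<^esub> ?r)"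
    by (simp add: B.merge)
  then have "TC (Ass (ihom A B) F G H) (Unit A) \<cdot>\<^bsub>B\<^esub> F0 (TDom (Ass (ihom A B) F G H))
      = ((F0 F \<star>\<^bsub>B\<^esub> F0 G) \<star>\<^bsub>B\<^esub> F0 H) \<cdot>\<^bsub>B\<^esub> ((Ass B ?I ?I ?I \<cdot>\<^bsub>B\<^esub> (Ide B ?I \<star>\<^bsub>B\<^esub> ?r)) \<cdot>\<^bsub>B\<^esub> ?r)"
    by (simp add: B.ass_nat_r)
  then show ?case by (simp add: B.ass_unit B.merge_r)
next
  case (9 x y)
  let ?m = "mid B (FO G x) (FO H x) (FO G y) (FO H y)"
    and ?n = "mid B (FO F x) (FO G x \<otimes>\<^bsub>B\<^esub> FO H x) (FO F y) (FO G y \<otimes>\<^bsub>B\<^esub> FO H y)"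
  let ?a = "FO F x \<otimes>\<^bsub>B\<^esub> FO F y" and ?b = "FO G x \<otimes>\<^bsub>B\<^esub> FO G y" and ?c = "FO H x \<otimes>\<^bsub>B\<^esub> FO H y"
  have "F2 F x y \<star>\<^bsub>B\<^esub> ((F2 G x y \<star>\<^bsub>B\<^esub> F2 H x y) \<cdot>\<^bsub>B\<^esub> ?m)
      = (F2 F x y \<star>\<^bsub>B\<^esub> (F2 G x y \<star>\<^bsub>B\<^esub> F2 H x y)) \<cdot>\<^bsub>B\<^esub> (Ide B ?a \<star>\<^bsub>B\<^esub> ?m)"
    using 9 by (simp add: B.merge)
  then have "TC (Ass (ihom A B) F G H) (x \<otimes>\<^bsub>A\<^esub> y) \<cdot>\<^bsub>B\<^esub> F2 (TDom (Ass (ihom A B) F G H)) x y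
      = ((F2 F x y \<star>\<^bsub>B\<^esub> F2 G x y) \<star>\<^bsub>B\<^esub> F2 H x y) \<cdot>\<^bsub>B\<^esub> (Ass B ?a ?b ?c \<cdot>\<^bsub>B\<^esub> ((Ide B ?a \<star>\<^bsub>B\<^esub> ?m) \<cdot>\<^bsub>B\<^esub> ?n))"
    using 9 by (simp add: B.ass_nat_r)
  then show ?case using 9 by (simp add: B.ass_mid B.merge_r)
qed (simp_all add: fun_tens_functor F G H B.ass_nat')

end

context
  fixes A :: "('o, 'a) smcat" and B :: "('p, 'b) smcat" and F
  assumes F: "sm_functor A B F"
begin

interpretation A: smc A by (rule sm_functor_smc[OF F])
interpretation B: smc B by (rule sm_functor_smc[OF F])
interpretation F: sm_functor A B F by (rule F)

lemma ru_transformation: "sm_transformation A B (Ru (ihom A B) F)"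
proof (rule sm_transformationI, goal_cases)
  case (9 x y)
  have "F2 F x y \<star>\<^bsub>B\<^esub> Ru B (Unit B)
      = (F2 F x y \<star>\<^bsub>B\<^esub> Ide B (Unit B)) \<cdot>\<^bsub>B\<^esub> (Ide B (FO F x \<otimes>\<^bsub>B\<^esub> FO F y) \<star>\<^bsub>B\<^esub> Ru B (Unit B))"
    using 9 by (simp add: B.merge)
  then show ?case using 9 by (simp add: B.ru_nat_r B.ru_mid)
qed (simp_all add: fun_tens_functor F const_unit_functor A.smc_axioms B.smc_axioms B.ru_nat' B.ru_nat_r)

lemma lu_transformation: "sm_transformation A B (Lu (ihom A B) F)"
proof (rule sm_transformationI, goal_cases)
  case (9 x y)
  have "Ru B (Unit B) \<star>\<^bsub>B\<^esub> F2 F x y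
      = (Ide B (Unit B) \<star>\<^bsub>B\<^esub> F2 F x y) \<cdot>\<^bsub>B\<^esub> (Ru B (Unit B) \<star>\<^bsub>B\<^esub> Ide B (FO F x \<otimes>\<^bsub>B\<^esub> FO F y))"
    using 9 by (simp add: B.merge)
  then show ?case using 9 by (simp add: B.lu_nat_r B.lu_mid)
qed (simp_all add: fun_tens_functor F const_unit_functor A.smc_axioms B.smc_axioms B.lu_nat' B.lu_nat_r
    B.ru_lu_unit)

end

lemma sym_transformation:
  assumes F: "sm_functor A B F" and G: "sm_functor A B G"
  shows "sm_transformation A B (Sym (ihom A B) F G)"
proof -
  interpret A: smc A by (rule sm_functor_smc[OF F])
  interpret B: smc B by (rule sm_functor_smc[OF F])
  interpret F: sm_functor A B F by (rule F)
  interpret G: sm_functor A B G by (rule G)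
  show ?thesis
  proof (rule sm_transformationI, goal_cases)
    case (9 x y)
    then show ?case by (simp add: B.sym_nat_r B.sym_mid)
  qed (simp_all add: fun_tens_functor F G B.sym_nat' B.sym_nat_r B.sym_unit_unit)
qed

text \<open>Naturality and compatibility with the tensor product are commutative squares, which
  \<open>inv_square\<close> turns around. This gives both the invertibility of the structure arrows
  of \<open>ihom A B\<close> and a formula for their inverses.\<close>

lemma inverse_transformation:
  assumes "sm_transformation A B \<sigma>" and iso: "\<And>x. x \<in> Obj A \<Longrightarrow> iso_arr B (TC \<sigma> x)"
  shows "inverse_arrows (ihom A B) \<sigma>
    \<lparr> TDom = TCod \<sigma>, TCod = TDom \<sigma>, TC = (\<lambda>x \<in> Obj A. inv_arr B (TC \<sigma> x)) \<rparr>" (is "inverse_arrows _ _ ?\<tau>")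
proof -
  interpret A: smc A by (rule sm_transformation_smc[OF assms(1)])
  interpret B: smc B by (rule sm_transformation_smc[OF assms(1)])
  interpret s: sm_transformation A B \<sigma> by fact
  note [simp] = iso
  have "sm_transformation A B ?\<tau>"
  proof (rule sm_transformationI, goal_cases)
    case (7 f)
    then show ?case using s.tc_nat'[of f] by (simp add: B.inv_square)
  next
    case 8
    show ?case using s.tc_unit by (simp flip: s.tc_unit)
  next
    case (9 x y)
    have "inv_arr B (TC \<sigma> (x \<otimes>\<^bsub>A\<^esub> y)) \<cdot>\<^bsub>B\<^esub> F2 (TCod \<sigma>) x y = F2 (TDom \<sigma>) x y \<cdot>\<^bsub>B\<^esub> inv_arr B (TC \<sigma> x \<star>\<^bsub>B\<^esub> TC \<sigma> y)"
      using 9 by (intro B.inv_square) (simp_all add: s.tc_tens)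
    then show ?case using 9 by simp
  qed (simp_all add: s.T.sm_functor_axioms s.S.sm_functor_axioms)
  then show ?thesis
    using assms(1)
    by (auto simp: inverse_arrows_def Hom_iff intro!: smt_eqI[where S = "Obj A"])
qed

lemma sm_transformation_functor:
  "sm_transformation A B \<sigma> \<Longrightarrow> sm_functor A B (TDom \<sigma>)"
  "sm_transformation A B \<sigma> \<Longrightarrow> sm_functor A B (TCod \<sigma>)"
  by (simp_all add: sm_transformation_def)

lemma iso_ihom:
  assumes "sm_transformation A B \<sigma>" and "\<And>x. x \<in> Obj A \<Longrightarrow> iso_arr B (TC \<sigma> x)"
  shows "iso_arr (ihom A B) \<sigma>"
  using inverse_transformation[OF assms] by (auto simp: iso_arr_def)

lemmas ihom_rules = sm_transformation_functor sm_transformation.tc_arr sm_transformation.tc_ext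
  sm_functor.fo_obj sm_functor.ide_transformation fun_tens_functor comp_transformation
  tens_transformation ass_transformation ru_transformation lu_transformation sym_transformation

text \<open>Equations between transformations are checked at components, where they are axioms of
  \<open>B\<close>. Cases 17 to 19 are the invertibility of associators and unitors.\<close>

lemma smc_ihom:
  assumes "smc A" "smc B" shows "smc (ihom A B)"
proof -
  interpret A: smc A by fact
  interpret B: smc B by fact
  note [simp] = ihom_rules[where A = A and B = B] const_unit_functor[OF assms]
  show ?thesis
  proof (unfold_locales, unfold Hom_iff ihom_simps, goal_cases)
    case 17 then show ?case by (auto intro!: iso_ihom)
  next
    case 18 then show ?case by (auto intro!: iso_ihom)
  next
    case 19 then show ?case by (auto intro!: iso_ihom)
  qed (auto intro!: smt_eqI[where S = "Obj A"] simp: B.merge B.ass_nat' B.ru_nat' B.lu_nat' B.sym_nat'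
      B.pentagon' B.triangle B.ru_lu_unit B.sym_unit B.hexagon')
qed

text \<open>\<open>inv_arr\<close> is a definite description, and both \<open>mid\<close> and the
  unit map of a tensor of functors contain it; this formula makes them computable when the target is
  itself an internal hom.\<close>

lemma inv_arr_ihom:
  assumes "sm_transformation A B \<sigma>" and "\<And>x. x \<in> Obj A \<Longrightarrow> iso_arr B (TC \<sigma> x)"
  shows "inv_arr (ihom A B) \<sigma>
    = \<lparr> TDom = TCod \<sigma>, TCod = TDom \<sigma>, TC = (\<lambda>x \<in> Obj A. inv_arr B (TC \<sigma> x)) \<rparr>"
proof -
  interpret smc "ihom A B"
    using smc_ihom sm_transformation_smc[OF assms(1)] by blast
  show ?thesis using inverse_transformation[OF assms] by (rule inv_arr_eq)
qed

section \<open>Composition of functors\<close>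

lemma smf_comp_simps [simp]:
  "x \<in> Obj A \<Longrightarrow> FO (smf_comp A C G F) x = FO G (FO F x)"
  "f \<in> Arr A \<Longrightarrow> FA (smf_comp A C G F) f = FA G (FA F f)"
  "F0 (smf_comp A C G F) = FA G (F0 F) \<cdot>\<^bsub>C\<^esub> F0 G"
  "\<lbrakk>x \<in> Obj A; y \<in> Obj A\<rbrakk> \<Longrightarrow> F2 (smf_comp A C G F) x y = FA G (F2 F x y) \<cdot>\<^bsub>C\<^esub> F2 G (FO F x) (FO F y)"
  by (simp_all add: smf_comp_def)

lemma smf_comp_ext [simp]:
  "FO (smf_comp A C G F) \<in> extensional (Obj A)" "FA (smf_comp A C G F) \<in> extensional (Arr A)"
  "restrict2 (F2 (smf_comp A C G F)) (Obj A) = F2 (smf_comp A C G F)"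
  by (simp_all add: smf_comp_def)

context sm_functor
begin

lemma f2_nat_r:
  "\<lbrakk>f \<in> Arr A; g \<in> Arr A; Cod A f = x; Cod A g = y; k \<in> Arr B;
    Cod B k = FO F (Dom A f) \<otimes>\<^bsub>B\<^esub> FO F (Dom A g)\<rbrakk>
    \<Longrightarrow> F2 F x y \<cdot>\<^bsub>B\<^esub> ((FA F f \<star>\<^bsub>B\<^esub> FA F g) \<cdot>\<^bsub>B\<^esub> k)
      = FA F (f \<star>\<^bsub>A\<^esub> g) \<cdot>\<^bsub>B\<^esub> (F2 F (Dom A f) (Dom A g) \<cdot>\<^bsub>B\<^esub> k)"
  by (auto simp: f2_nat' simp flip: B.comp_assoc')

lemma f2_nat_left_r:
  "\<lbrakk>a \<in> Obj A; g \<in> Arr A; Cod A g = y; k \<in> Arr B; Cod B k = FO F a \<otimes>\<^bsub>B\<^esub> FO F (Dom A g)\<rbrakk>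
    \<Longrightarrow> F2 F a y \<cdot>\<^bsub>B\<^esub> ((Ide B (FO F a) \<star>\<^bsub>B\<^esub> FA F g) \<cdot>\<^bsub>B\<^esub> k)
      = FA F (Ide A a \<star>\<^bsub>A\<^esub> g) \<cdot>\<^bsub>B\<^esub> (F2 F a (Dom A g) \<cdot>\<^bsub>B\<^esub> k)"
  using f2_nat_r[of "Ide A a" g a y k] by simp

lemma f2_nat_right_r:
  "\<lbrakk>a \<in> Obj A; g \<in> Arr A; Cod A g = y; k \<in> Arr B; Cod B k = FO F (Dom A g) \<otimes>\<^bsub>B\<^esub> FO F a\<rbrakk>
    \<Longrightarrow> F2 F y a \<cdot>\<^bsub>B\<^esub> ((FA F g \<star>\<^bsub>B\<^esub> Ide B (FO F a)) \<cdot>\<^bsub>B\<^esub> k)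
      = FA F (g \<star>\<^bsub>A\<^esub> Ide A a) \<cdot>\<^bsub>B\<^esub> (F2 F (Dom A g) a \<cdot>\<^bsub>B\<^esub> k)"
  using f2_nat_r[of g "Ide A a" y a k] by simp

end

text \<open>Naturality of \<open>F2 G\<close> separates each axiom into the image under
  \<open>G\<close> of the axiom for \<open>F\<close>, followed by the axiom for \<open>G\<close> at
  the images of the objects.\<close>

lemma smf_comp_functor:
  assumes "sm_functor A B F" "sm_functor B C G"
  shows "sm_functor A C (smf_comp A C G F)"
proof -
  interpret A: smc A by (rule sm_functor_smc[OF assms(1)])
  interpret B: smc B by (rule sm_functor_smc[OF assms(1)])
  interpret C: smc C by (rule sm_functor_smc[OF assms(2)])
  interpret F: sm_functor A B F by fact
  interpret G: sm_functor B C G by fact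
  let ?GF = "smf_comp A C G F"
  show ?thesis
  proof (rule sm_functorI, goal_cases)
    case (18 f g)
    have "FA G (F2 F (Cod A f) (Cod A g)) \<cdot>\<^bsub>C\<^esub> FA G (FA F f \<star>\<^bsub>B\<^esub> FA F g)
      = FA G (FA F (f \<star>\<^bsub>A\<^esub> g)) \<cdot>\<^bsub>C\<^esub> FA G (F2 F (Dom A f) (Dom A g))"
      using 18 by (simp add: F.f2_nat' flip: G.fa_comp')
    then have "(FA G (F2 F (Cod A f) (Cod A g)) \<cdot>\<^bsub>C\<^esub> FA G (FA F f \<star>\<^bsub>B\<^esub> FA F g)) \<cdot>\<^bsub>C\<^esub> F2 G (FO F (Dom A f)) (FO F (Dom A g))
      = (FA G (FA F (f \<star>\<^bsub>A\<^esub> g)) \<cdot>\<^bsub>C\<^esub> FA G (F2 F (Dom A f) (Dom A g))) \<cdot>\<^bsub>C\<^esub> F2 G (FO F (Dom A f)) (FO F (Dom A g))"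
      by simp
    then show ?case using 18 by (simp add: G.f2_nat')
  next
    case (19 x y z)
    let ?x = "FO F x" and ?y = "FO F y" and ?z = "FO F z"
    let ?m = "F2 G ?x (?y \<otimes>\<^bsub>B\<^esub> ?z) \<cdot>\<^bsub>C\<^esub> (Ide C (FO G ?x) \<star>\<^bsub>C\<^esub> F2 G ?y ?z)"
    have "FA ?GF (Ass A x y z) \<cdot>\<^bsub>C\<^esub> (F2 ?GF x (y \<otimes>\<^bsub>A\<^esub> z)
        \<cdot>\<^bsub>C\<^esub> (Ide C (FO ?GF x) \<star>\<^bsub>C\<^esub> F2 ?GF y z))
      = FA G (FA F (Ass A x y z) \<cdot>\<^bsub>B\<^esub> (F2 F x (y \<otimes>\<^bsub>A\<^esub> z) \<cdot>\<^bsub>B\<^esub> (Ide B ?x \<star>\<^bsub>B\<^esub> F2 F y z))) \<cdot>\<^bsub>C\<^esub> ?m"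
      using 19 by (simp add: C.split_left G.f2_nat_left_r)
    also have "\<dots> = FA G (F2 F (x \<otimes>\<^bsub>A\<^esub> y) z) \<cdot>\<^bsub>C\<^esub> (FA G (F2 F x y \<star>\<^bsub>B\<^esub> Ide B ?z)
        \<cdot>\<^bsub>C\<^esub> (FA G (Ass B ?x ?y ?z) \<cdot>\<^bsub>C\<^esub> ?m))"
      using 19 by (simp only: F.f_ass') simp
    also have "\<dots> = F2 ?GF (x \<otimes>\<^bsub>A\<^esub> y) z \<cdot>\<^bsub>C\<^esub> ((F2 ?GF x y \<star>\<^bsub>C\<^esub> Ide C (FO ?GF z))
        \<cdot>\<^bsub>C\<^esub> Ass C (FO ?GF x) (FO ?GF y) (FO ?GF z))"
      using 19 by (simp add: C.split_right G.f2_nat_right_r G.f_ass')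
    finally show ?case .
  next
    case (20 x)
    have "FA ?GF (Ru A x) \<cdot>\<^bsub>C\<^esub> (F2 ?GF x (Unit A)
        \<cdot>\<^bsub>C\<^esub> (Ide C (FO ?GF x) \<star>\<^bsub>C\<^esub> F0 ?GF))
      = FA G (FA F (Ru A x) \<cdot>\<^bsub>B\<^esub> (F2 F x (Unit A) \<cdot>\<^bsub>B\<^esub> (Ide B (FO F x) \<star>\<^bsub>B\<^esub> F0 F)))
        \<cdot>\<^bsub>C\<^esub> (F2 G (FO F x) (Unit B) \<cdot>\<^bsub>C\<^esub> (Ide C (FO G (FO F x)) \<star>\<^bsub>C\<^esub> F0 G))"
      using 20 by (simp add: C.split_left G.f2_nat_left_r)
    also have "\<dots> = Ru C (FO ?GF x)"
      using 20 by (simp only: F.f_ru') (simp add: G.f_ru')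
    finally show ?case .
  next
    case (21 x)
    have "FA ?GF (Lu A x) \<cdot>\<^bsub>C\<^esub> (F2 ?GF (Unit A) x
        \<cdot>\<^bsub>C\<^esub> (F0 ?GF \<star>\<^bsub>C\<^esub> Ide C (FO ?GF x)))
      = FA G (FA F (Lu A x) \<cdot>\<^bsub>B\<^esub> (F2 F (Unit A) x \<cdot>\<^bsub>B\<^esub> (F0 F \<star>\<^bsub>B\<^esub> Ide B (FO F x))))
        \<cdot>\<^bsub>C\<^esub> (F2 G (Unit B) (FO F x) \<cdot>\<^bsub>C\<^esub> (F0 G \<star>\<^bsub>C\<^esub> Ide C (FO G (FO F x))))"
      using 21 by (simp add: C.split_right G.f2_nat_right_r)
    also have "\<dots> = Lu C (FO ?GF x)"
      using 21 by (simp only: F.f_lu') (simp add: G.f_lu')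
    finally show ?case .
  next
    case (22 x y)
    have "FA ?GF (Sym A x y) \<cdot>\<^bsub>C\<^esub> F2 ?GF x y
      = FA G (FA F (Sym A x y) \<cdot>\<^bsub>B\<^esub> F2 F x y) \<cdot>\<^bsub>C\<^esub> F2 G (FO F x) (FO F y)"
      using 22 by simp
    also have "\<dots> = FA G (F2 F y x) \<cdot>\<^bsub>C\<^esub> (FA G (Sym B (FO F x) (FO F y)) \<cdot>\<^bsub>C\<^esub> F2 G (FO F x) (FO F y))"
      using 22 by (simp only: F.f_sym) simp
    also have "\<dots> = F2 ?GF y x \<cdot>\<^bsub>C\<^esub> Sym C (FO ?GF x) (FO ?GF y)"
      using 22 by (simp add: G.f_sym)
    finally show ?case .
  qed (simp_all add: A.smc_axioms C.smc_axioms)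
qed

lemma smf_comp_assoc:
  assumes "sm_functor A B F" "sm_functor B C G" "sm_functor C D H"
  shows "smf_comp A D H (smf_comp A C G F) = smf_comp A D (smf_comp B D H G) F"
proof -
  interpret A: smc A by (rule sm_functor_smc[OF assms(1)])
  interpret B: smc B by (rule sm_functor_smc[OF assms(1)])
  interpret C: smc C by (rule sm_functor_smc[OF assms(2)])
  interpret D: smc D by (rule sm_functor_smc[OF assms(3)])
  interpret F: sm_functor A B F by fact
  interpret G: sm_functor B C G by fact
  interpret H: sm_functor C D H by fact
  show ?thesis
    by (rule smf_eqI[where A = A and B = D]) (simp_all add: smf_comp_functor[OF smf_comp_functor[OF assms(1,2)] assms(3)]
        smf_comp_functor[OF assms(1) smf_comp_functor[OF assms(2,3)]])
qed

text \<open>Preservation of \<open>mid\<close> is assembled from preservation of its factors: \<open>F\<close> carries the arrow \<open>f\<close>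
  between two bracketings to \<open>f'\<close> up to the composites of \<open>F\<^sup>2\<close> belonging to these bracketings.\<close>

context sm_functor
begin

primrec coh :: "'o tree \<Rightarrow> 'b" where
  "coh TU = F0 F"
| "coh (TL x) = Ide B (FO F x)"
| "coh (TN s t) = F2 F (ev A s) (ev A t) \<cdot>\<^bsub>B\<^esub> (coh s \<star>\<^bsub>B\<^esub> coh t)"

definition carries :: "'o tree \<Rightarrow> 'o tree \<Rightarrow> 'a \<Rightarrow> 'b \<Rightarrow> bool" where
  "carries s t f f' \<longleftrightarrow>
     A.leaves_obj s \<and> A.leaves_obj t \<and>
     f \<in> Arr A \<and> Dom A f = ev A s \<and> Cod A f = ev A t \<and>
     f' \<in> Arr B \<and> Dom B f' = ev B (map_tree (FO F) s) \<and> Cod B f' = ev B (map_tree (FO F) t) \<and>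
     FA F f \<cdot>\<^bsub>B\<^esub> coh s = coh t \<cdot>\<^bsub>B\<^esub> f'"

lemma leaves_map_tree: "leaves (map_tree g t) = map g (leaves t)"
  by (induction t) auto

lemma ev_map_tree_obj [simp]: "A.leaves_obj t \<Longrightarrow> ev B (map_tree (FO F) t) \<in> Obj B"
  by (rule B.ev_obj) (auto simp: leaves_map_tree)

lemma coh_typing [simp]:
  assumes "A.leaves_obj t"
  shows "coh t \<in> Arr B" "Dom B (coh t) = ev B (map_tree (FO F) t)" "Cod B (coh t) = FO F (ev A t)"
proof -
  have "coh t \<in> Arr B \<and> Dom B (coh t) = ev B (map_tree (FO F) t) \<and> Cod B (coh t) = FO F (ev A t)"
    using assms by (induction t) auto
  then show "coh t \<in> Arr B" "Dom B (coh t) = ev B (map_tree (FO F) t)" "Cod B (coh t) = FO F (ev A t)"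
    by auto
qed

lemma carries_comp:
  assumes f: "carries s t f f'" and g: "carries t u g g'"
  shows "carries s u (g \<cdot>\<^bsub>A\<^esub> f) (g' \<cdot>\<^bsub>B\<^esub> f')"
proof -
  have [simp]: "A.leaves_obj s" "A.leaves_obj t" "A.leaves_obj u" "f \<in> Arr A"
    "g \<in> Arr A" "Dom A f = ev A s" "Cod A f = ev A t" "Dom A g = ev A t" "Cod A g = ev A u"
    "f' \<in> Arr B" "g' \<in> Arr B" "Dom B f' = ev B (map_tree (FO F) s)" "Cod B f' = ev B (map_tree (FO F) t)"
    "Dom B g' = ev B (map_tree (FO F) t)" "Cod B g' = ev B (map_tree (FO F) u)"
    and e: "FA F f \<cdot>\<^bsub>B\<^esub> coh s = coh t \<cdot>\<^bsub>B\<^esub> f'" "FA F g \<cdot>\<^bsub>B\<^esub> coh t = coh u \<cdot>\<^bsub>B\<^esub> g'"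
    using assms by (simp_all add: carries_def)
  have "FA F g \<cdot>\<^bsub>B\<^esub> (coh t \<cdot>\<^bsub>B\<^esub> f') = (FA F g \<cdot>\<^bsub>B\<^esub> coh t) \<cdot>\<^bsub>B\<^esub> f'" by simp
  also have "\<dots> = coh u \<cdot>\<^bsub>B\<^esub> (g' \<cdot>\<^bsub>B\<^esub> f')" by (simp add: e)
  finally show ?thesis by (simp add: carries_def e)
qed

lemma carries_inv:
  assumes "carries s t f f'" "iso_arr A f" "iso_arr B f'"
  shows "carries t s (inv_arr A f) (inv_arr B f')"
  using assms by (auto simp: carries_def intro!: B.inv_square)

lemma carries_right:
  assumes f: "carries s t f f'" and [simp]: "A.leaves_obj u"
  shows "carries (TN s u) (TN t u) (f \<star>\<^bsub>A\<^esub> Ide A (ev A u)) (f' \<star>\<^bsub>B\<^esub> Ide B (ev B (map_tree (FO F) u)))"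
proof -
  have [simp]: "A.leaves_obj s" "A.leaves_obj t" "f \<in> Arr A" "Dom A f = ev A s"
    "Cod A f = ev A t" "f' \<in> Arr B" "Dom B f' = ev B (map_tree (FO F) s)" "Cod B f' = ev B (map_tree (FO F) t)"
    and e: "coh t \<cdot>\<^bsub>B\<^esub> f' = FA F f \<cdot>\<^bsub>B\<^esub> coh s"
    using f by (simp_all add: carries_def)
  have "F2 F (ev A t) (ev A u) \<cdot>\<^bsub>B\<^esub> ((FA F f \<cdot>\<^bsub>B\<^esub> coh s) \<star>\<^bsub>B\<^esub> coh u)
      = F2 F (ev A t) (ev A u) \<cdot>\<^bsub>B\<^esub> ((FA F f \<star>\<^bsub>B\<^esub> Ide B (FO F (ev A u))) \<cdot>\<^bsub>B\<^esub> (coh s \<star>\<^bsub>B\<^esub> coh u))"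
    by (simp add: B.merge)
  also have "\<dots> = FA F (f \<star>\<^bsub>A\<^esub> Ide A (ev A u)) \<cdot>\<^bsub>B\<^esub> coh (TN s u)"
    by (simp add: f2_nat_right_r)
  finally show ?thesis
    by (simp add: carries_def B.merge e)
qed

lemma carries_left:
  assumes f: "carries s t f f'" and [simp]: "A.leaves_obj u"
  shows "carries (TN u s) (TN u t) (Ide A (ev A u) \<star>\<^bsub>A\<^esub> f) (Ide B (ev B (map_tree (FO F) u)) \<star>\<^bsub>B\<^esub> f')"
proof -
  have [simp]: "A.leaves_obj s" "A.leaves_obj t" "f \<in> Arr A" "Dom A f = ev A s"
    "Cod A f = ev A t" "f' \<in> Arr B" "Dom B f' = ev B (map_tree (FO F) s)" "Cod B f' = ev B (map_tree (FO F) t)"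
    and e: "coh t \<cdot>\<^bsub>B\<^esub> f' = FA F f \<cdot>\<^bsub>B\<^esub> coh s"
    using f by (simp_all add: carries_def)
  have "F2 F (ev A u) (ev A t) \<cdot>\<^bsub>B\<^esub> (coh u \<star>\<^bsub>B\<^esub> (FA F f \<cdot>\<^bsub>B\<^esub> coh s))
      = F2 F (ev A u) (ev A t) \<cdot>\<^bsub>B\<^esub> ((Ide B (FO F (ev A u)) \<star>\<^bsub>B\<^esub> FA F f) \<cdot>\<^bsub>B\<^esub> (coh u \<star>\<^bsub>B\<^esub> coh s))"
    by (simp add: B.merge)
  also have "\<dots> = FA F (Ide A (ev A u) \<star>\<^bsub>A\<^esub> f) \<cdot>\<^bsub>B\<^esub> coh (TN u s)"
    by (simp add: f2_nat_left_r)
  finally show ?thesis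
    by (simp add: carries_def B.merge e)
qed

lemma carries_ass:
  assumes [simp]: "A.leaves_obj s" "A.leaves_obj t" "A.leaves_obj u"
  shows "carries (TN s (TN t u)) (TN (TN s t) u) (Ass A (ev A s) (ev A t) (ev A u))
    (Ass B (ev B (map_tree (FO F) s)) (ev B (map_tree (FO F) t)) (ev B (map_tree (FO F) u)))"
proof -
  let ?s = "ev A s" and ?t = "ev A t" and ?u = "ev A u"
  let ?c = "coh s \<star>\<^bsub>B\<^esub> (coh t \<star>\<^bsub>B\<^esub> coh u)"
  have l: "coh s \<star>\<^bsub>B\<^esub> (F2 F ?t ?u \<cdot>\<^bsub>B\<^esub> (coh t \<star>\<^bsub>B\<^esub> coh u)) = (Ide B (FO F ?s) \<star>\<^bsub>B\<^esub> F2 F ?t ?u) \<cdot>\<^bsub>B\<^esub> ?c"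
    and r: "(F2 F ?s ?t \<cdot>\<^bsub>B\<^esub> (coh s \<star>\<^bsub>B\<^esub> coh t)) \<star>\<^bsub>B\<^esub> coh u
      = (F2 F ?s ?t \<star>\<^bsub>B\<^esub> Ide B (FO F ?u)) \<cdot>\<^bsub>B\<^esub> ((coh s \<star>\<^bsub>B\<^esub> coh t) \<star>\<^bsub>B\<^esub> coh u)"
    by (simp_all add: B.merge)
  have "(FA F (Ass A ?s ?t ?u) \<cdot>\<^bsub>B\<^esub> (F2 F ?s (?t \<otimes>\<^bsub>A\<^esub> ?u) \<cdot>\<^bsub>B\<^esub> (Ide B (FO F ?s) \<star>\<^bsub>B\<^esub> F2 F ?t ?u))) \<cdot>\<^bsub>B\<^esub> ?c
    = (F2 F (?s \<otimes>\<^bsub>A\<^esub> ?t) ?u \<cdot>\<^bsub>B\<^esub> ((F2 F ?s ?t \<star>\<^bsub>B\<^esub> Ide B (FO F ?u)) \<cdot>\<^bsub>B\<^esub> Ass B (FO F ?s) (FO F ?t) (FO F ?u))) \<cdot>\<^bsub>B\<^esub> ?c"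
    by (simp only: f_ass'[OF A.ev_obj A.ev_obj A.ev_obj] assms)
  then show ?thesis by (simp add: carries_def l r B.ass_nat')
qed

lemma carries_sym:
  assumes [simp]: "A.leaves_obj s" "A.leaves_obj t"
  shows "carries (TN s t) (TN t s) (Sym A (ev A s) (ev A t))
    (Sym B (ev B (map_tree (FO F) s)) (ev B (map_tree (FO F) t)))"
proof -
  have "(FA F (Sym A (ev A s) (ev A t)) \<cdot>\<^bsub>B\<^esub> F2 F (ev A s) (ev A t)) \<cdot>\<^bsub>B\<^esub> (coh s \<star>\<^bsub>B\<^esub> coh t)
    = (F2 F (ev A t) (ev A s) \<cdot>\<^bsub>B\<^esub> Sym B (FO F (ev A s)) (FO F (ev A t))) \<cdot>\<^bsub>B\<^esub> (coh s \<star>\<^bsub>B\<^esub> coh t)"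
    by (simp only: f_sym[OF A.ev_obj A.ev_obj] assms)
  then show ?thesis by (simp add: carries_def B.sym_nat')
qed

text \<open>The condition on \<open>F2\<close> that makes the structure map
  \<open>F2 (postcomp A B C F) H K\<close> monoidal, since the \<open>F2\<close> of a tensor of
  functors contains \<open>mid\<close>.\<close>

lemma fa_mid:
  assumes "a \<in> Obj A" "b \<in> Obj A" "c \<in> Obj A" "d \<in> Obj A"
  shows "FA F (mid A a b c d) \<cdot>\<^bsub>B\<^esub> (F2 F (a \<otimes>\<^bsub>A\<^esub> b) (c \<otimes>\<^bsub>A\<^esub> d) \<cdot>\<^bsub>B\<^esub> (F2 F a b \<star>\<^bsub>B\<^esub> F2 F c d))
    = F2 F (a \<otimes>\<^bsub>A\<^esub> c) (b \<otimes>\<^bsub>A\<^esub> d) \<cdot>\<^bsub>B\<^esub> ((F2 F a c \<star>\<^bsub>B\<^esub> F2 F b d) \<cdot>\<^bsub>B\<^esub> mid B (FO F a) (FO F b) (FO F c) (FO F d))"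
proof -
  have "carries (TN (TN (TL a) (TL b)) (TN (TL c) (TL d))) (TN (TN (TL a) (TL c)) (TN (TL b) (TL d)))
      (mid A a b c d) (mid B (FO F a) (FO F b) (FO F c) (FO F d))"
    using carries_comp[OF carries_comp[OF carries_comp[OF carries_comp[OF carries_inv[OF carries_ass] carries_left[OF carries_ass]]
      carries_left[OF carries_right[OF carries_sym]]] carries_left[OF carries_inv[OF carries_ass]]] carries_ass,
      of "TL a" "TL b" "TL c" "TL d"] assms
    by (simp add: mid_def)
  then show ?thesis using assms by (simp add: carries_def)
qed

end

section \<open>Strict functors\<close>

definition strict_functor :: "('o, 'a) smcat \<Rightarrow> ('p, 'b) smcat \<Rightarrow> ('o, 'a, 'p, 'b) smfun \<Rightarrow> bool" where
  "strict_functor A B F \<longleftrightarrow> sm_functor A B F \<and> F0 F = Ide B (Unit B) \<and>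
     (\<forall>x \<in> Obj A. \<forall>y \<in> Obj A. F2 F x y = Ide B (FO F x \<otimes>\<^bsub>B\<^esub> FO F y))"

lemma strict_functorI:
  assumes "smc A" "smc B" "FO F \<in> extensional (Obj A)" "FA F \<in> extensional (Arr A)"
    "F0 F = Ide B (Unit B)" "F2 F = restrict2 (\<lambda>x y. Ide B (FO F x \<otimes>\<^bsub>B\<^esub> FO F y)) (Obj A)"
    "FO F (Unit A) = Unit B" "\<And>x y. \<lbrakk>x \<in> Obj A; y \<in> Obj A\<rbrakk> \<Longrightarrow> FO F (x \<otimes>\<^bsub>A\<^esub> y) = FO F x \<otimes>\<^bsub>B\<^esub> FO F y"
    and "\<And>x. x \<in> Obj A \<Longrightarrow> FO F x \<in> Obj B"
    and "\<And>f. f \<in> Arr A \<Longrightarrow> FA F f \<in> Arr B"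
    and "\<And>f. f \<in> Arr A \<Longrightarrow> Dom B (FA F f) = FO F (Dom A f)"
    and "\<And>f. f \<in> Arr A \<Longrightarrow> Cod B (FA F f) = FO F (Cod A f)"
    and "\<And>x. x \<in> Obj A \<Longrightarrow> FA F (Ide A x) = Ide B (FO F x)"
    and "\<And>f g. \<lbrakk>f \<in> Arr A; g \<in> Arr A; Dom A g = Cod A f\<rbrakk> \<Longrightarrow> FA F (g \<cdot>\<^bsub>A\<^esub> f) = FA F g \<cdot>\<^bsub>B\<^esub> FA F f"
    and "\<And>f g. \<lbrakk>f \<in> Arr A; g \<in> Arr A\<rbrakk> \<Longrightarrow> FA F (f \<star>\<^bsub>A\<^esub> g) = FA F f \<star>\<^bsub>B\<^esub> FA F g"
    and "\<And>x y z. \<lbrakk>x \<in> Obj A; y \<in> Obj A; z \<in> Obj A\<rbrakk> \<Longrightarrow> FA F (Ass A x y z) = Ass B (FO F x) (FO F y) (FO F z)"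
    and "\<And>x. x \<in> Obj A \<Longrightarrow> FA F (Ru A x) = Ru B (FO F x)"
    and "\<And>x. x \<in> Obj A \<Longrightarrow> FA F (Lu A x) = Lu B (FO F x)"
    and "\<And>x y. \<lbrakk>x \<in> Obj A; y \<in> Obj A\<rbrakk> \<Longrightarrow> FA F (Sym A x y) = Sym B (FO F x) (FO F y)"
  shows "strict_functor A B F"
proof -
  interpret A: smc A by fact
  interpret B: smc B by fact
  have "sm_functor A B F"
    by (rule sm_functorI) (simp_all add: assms)
  then show ?thesis by (simp add: strict_functor_def assms(5,6))
qed

lemma strict_sm_functor: "strict_functor A B F \<Longrightarrow> sm_functor A B F"
  by (simp add: strict_functor_def)

text \<open>An identity has equal domain and codomain, so the typing of \<open>F0\<close> and
  \<open>F2\<close> forces unit and tensor products of objects to be preserved on the nose; the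
  functor axioms then collapse to preservation of the structure arrows.\<close>

lemma strict_functor_simps:
  assumes "strict_functor A B F"
  shows "F0 F = Ide B (Unit B)"
    and "\<lbrakk>x \<in> Obj A; y \<in> Obj A\<rbrakk> \<Longrightarrow> F2 F x y = Ide B (FO F x \<otimes>\<^bsub>B\<^esub> FO F y)"
    and "FO F (Unit A) = Unit B"
    and "\<lbrakk>x \<in> Obj A; y \<in> Obj A\<rbrakk> \<Longrightarrow> FO F (x \<otimes>\<^bsub>A\<^esub> y) = FO F x \<otimes>\<^bsub>B\<^esub> FO F y"
    and "\<lbrakk>f \<in> Arr A; g \<in> Arr A\<rbrakk> \<Longrightarrow> FA F (f \<star>\<^bsub>A\<^esub> g) = FA F f \<star>\<^bsub>B\<^esub> FA F g"
    and "\<lbrakk>x \<in> Obj A; y \<in> Obj A; z \<in> Obj A\<rbrakk> \<Longrightarrow> FA F (Ass A x y z) = Ass B (FO F x) (FO F y) (FO F z)"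
    and "x \<in> Obj A \<Longrightarrow> FA F (Ru A x) = Ru B (FO F x)"
    and "x \<in> Obj A \<Longrightarrow> FA F (Lu A x) = Lu B (FO F x)"
    and "\<lbrakk>x \<in> Obj A; y \<in> Obj A\<rbrakk> \<Longrightarrow> FA F (Sym A x y) = Sym B (FO F x) (FO F y)"
proof -
  interpret F: sm_functor A B F using assms by (rule strict_sm_functor)
  show f0: "F0 F = Ide B (Unit B)" using assms by (simp add: strict_functor_def)
  show f2: "F2 F x y = Ide B (FO F x \<otimes>\<^bsub>B\<^esub> FO F y)" if "x \<in> Obj A" "y \<in> Obj A" for x y
    using assms that by (simp add: strict_functor_def)
  show u: "FO F (Unit A) = Unit B" using F.f0_arr f0 by simp
  show t: "FO F (x \<otimes>\<^bsub>A\<^esub> y) = FO F x \<otimes>\<^bsub>B\<^esub> FO F y" if "x \<in> Obj A" "y \<in> Obj A" for x y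
    using F.f2_arr[of x y] f2[of x y] that by simp
  show "FA F (f \<star>\<^bsub>A\<^esub> g) = FA F f \<star>\<^bsub>B\<^esub> FA F g" if "f \<in> Arr A" "g \<in> Arr A" for f g
    using F.f2_nat'[OF that HOL.refl HOL.refl] that by (simp add: f2 t)
  show "FA F (Ass A x y z) = Ass B (FO F x) (FO F y) (FO F z)" if "x \<in> Obj A" "y \<in> Obj A" "z \<in> Obj A" for x y z
    using F.f_ass'[of x y z] that by (simp add: f2 t)
  show "FA F (Ru A x) = Ru B (FO F x)" "FA F (Lu A x) = Lu B (FO F x)" if "x \<in> Obj A" for x
    using F.f_ru'[of x] F.f_lu'[of x] that by (simp_all add: f2 t f0 u)
  show "FA F (Sym A x y) = Sym B (FO F x) (FO F y)" if "x \<in> Obj A" "y \<in> Obj A" for x y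
    using F.f_sym[of x y] that by (simp add: f2 t)
qed

lemma strict_eqI:
  assumes "strict_functor A B F" "strict_functor A B G"
    "\<And>x. x \<in> Obj A \<Longrightarrow> FO F x = FO G x" "\<And>f. f \<in> Arr A \<Longrightarrow> FA F f = FA G f"
  shows "F = G"
  using assms by (intro smf_eqI[where A = A and B = B]) (auto simp: strict_functor_def)

lemma strict_comp:
  assumes "strict_functor A B F" "strict_functor B C G"
  shows "strict_functor A C (smf_comp A C G F)"
proof -
  interpret F: sm_functor A B F using assms(1) by (rule strict_sm_functor)
  interpret G: sm_functor B C G using assms(2) by (rule strict_sm_functor)
  show ?thesis
    unfolding strict_functor_def
    using smf_comp_functor[OF F.sm_functor_axioms G.sm_functor_axioms]
    by (simp add: strict_functor_simps[OF assms(1)] strict_functor_simps[OF assms(2)])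
qed

section \<open>Pre- and postcomposition\<close>

lemma whisker_fun_simps [simp]:
  "TDom (whisker_fun A C F \<theta>) = smf_comp A C F (TDom \<theta>)" "TCod (whisker_fun A C F \<theta>) = smf_comp A C F (TCod \<theta>)"
  "TC (whisker_fun A C F \<theta>) \<in> extensional (Obj A)"
  "a \<in> Obj A \<Longrightarrow> TC (whisker_fun A C F \<theta>) a = FA F (TC \<theta> a)"
  by (simp_all add: whisker_fun_def)

lemma whisker_trans_simps [simp]:
  "TDom (whisker_trans A C \<sigma> H) = smf_comp A C (TDom \<sigma>) H" "TCod (whisker_trans A C \<sigma> H) = smf_comp A C (TCod \<sigma>) H"
  "TC (whisker_trans A C \<sigma> H) \<in> extensional (Obj A)"
  "a \<in> Obj A \<Longrightarrow> TC (whisker_trans A C \<sigma> H) a = TC \<sigma> (FO H a)"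
  by (simp_all add: whisker_trans_def)

lemma whisker_fun_transformation:
  assumes "sm_transformation A B \<theta>" "sm_functor B C F"
  shows "sm_transformation A C (whisker_fun A C F \<theta>)"
proof -
  interpret A: smc A by (rule sm_transformation_smc[OF assms(1)])
  interpret B: smc B by (rule sm_functor_smc[OF assms(2)])
  interpret C: smc C by (rule sm_functor_smc[OF assms(2)])
  interpret t: sm_transformation A B \<theta> by fact
  interpret F: sm_functor B C F by fact
  show ?thesis
  proof (rule sm_transformationI, goal_cases)
    case (7 f)
    then show ?case by (simp add: t.tc_nat' flip: F.fa_comp')
  next
    case 8
    have "FA F (TC \<theta> (Unit A)) \<cdot>\<^bsub>C\<^esub> FA F (F0 (TDom \<theta>)) = FA F (F0 (TCod \<theta>))"
      by (simp add: t.tc_unit flip: F.fa_comp')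
    then show ?case by (simp flip: C.comp_assoc')
  next
    case (9 x y)
    have "FA F (TC \<theta> (x \<otimes>\<^bsub>A\<^esub> y)) \<cdot>\<^bsub>C\<^esub> FA F (F2 (TDom \<theta>) x y) = FA F (F2 (TCod \<theta>) x y) \<cdot>\<^bsub>C\<^esub> FA F (TC \<theta> x \<star>\<^bsub>B\<^esub> TC \<theta> y)"
      using 9 by (simp add: t.tc_tens flip: F.fa_comp')
    then have "(FA F (TC \<theta> (x \<otimes>\<^bsub>A\<^esub> y)) \<cdot>\<^bsub>C\<^esub> FA F (F2 (TDom \<theta>) x y)) \<cdot>\<^bsub>C\<^esub> F2 F (FO (TDom \<theta>) x) (FO (TDom \<theta>) y)
      = (FA F (F2 (TCod \<theta>) x y) \<cdot>\<^bsub>C\<^esub> FA F (TC \<theta> x \<star>\<^bsub>B\<^esub> TC \<theta> y)) \<cdot>\<^bsub>C\<^esub> F2 F (FO (TDom \<theta>) x) (FO (TDom \<theta>) y)" by simp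
    then show ?case using 9 by (simp add: F.f2_nat')
  qed (simp_all add: smf_comp_functor[OF _ assms(2)] t.S.sm_functor_axioms t.T.sm_functor_axioms)
qed

lemma whisker_trans_transformation:
  assumes "sm_transformation B C \<sigma>" "sm_functor A B H"
  shows "sm_transformation A C (whisker_trans A C \<sigma> H)"
proof -
  interpret A: smc A by (rule sm_functor_smc[OF assms(2)])
  interpret B: smc B by (rule sm_functor_smc[OF assms(2)])
  interpret C: smc C by (rule sm_transformation_smc[OF assms(1)])
  interpret s: sm_transformation B C \<sigma> by fact
  interpret H: sm_functor A B H by fact
  show ?thesis
  proof (rule sm_transformationI, goal_cases)
    case 8
    have "(TC \<sigma> (FO H (Unit A)) \<cdot>\<^bsub>C\<^esub> FA (TDom \<sigma>) (F0 H)) \<cdot>\<^bsub>C\<^esub> F0 (TDom \<sigma>) = FA (TCod \<sigma>) (F0 H) \<cdot>\<^bsub>C\<^esub> (TC \<sigma> (Unit B) \<cdot>\<^bsub>C\<^esub> F0 (TDom \<sigma>))"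
      by (subst s.tc_nat') simp_all
    then show ?case by (simp add: s.tc_unit)
  next
    case (9 x y)
    have "(TC \<sigma> (FO H (x \<otimes>\<^bsub>A\<^esub> y)) \<cdot>\<^bsub>C\<^esub> FA (TDom \<sigma>) (F2 H x y)) \<cdot>\<^bsub>C\<^esub> F2 (TDom \<sigma>) (FO H x) (FO H y)
      = FA (TCod \<sigma>) (F2 H x y) \<cdot>\<^bsub>C\<^esub> (TC \<sigma> (FO H x \<otimes>\<^bsub>B\<^esub> FO H y) \<cdot>\<^bsub>C\<^esub> F2 (TDom \<sigma>) (FO H x) (FO H y))"
      using 9 by (subst s.tc_nat') simp_all
    then show ?case using 9 by (simp add: s.tc_tens)
  qed (simp_all add: smf_comp_functor[OF assms(2)] s.S.sm_functor_axioms s.T.sm_functor_axioms s.tc_nat')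
qed

lemma postcomp_simps [simp]:
  "FO (postcomp A B C F) \<in> extensional (Obj (ihom A B))" "FA (postcomp A B C F) \<in> extensional (Arr (ihom A B))"
  "restrict2 (F2 (postcomp A B C F)) (Obj (ihom A B)) = F2 (postcomp A B C F)"
  "sm_functor A B H \<Longrightarrow> FO (postcomp A B C F) H = smf_comp A C F H"
  "sm_transformation A B \<theta> \<Longrightarrow> FA (postcomp A B C F) \<theta> = whisker_fun A C F \<theta>"
  "TDom (F0 (postcomp A B C F)) = const_unit A C" "TCod (F0 (postcomp A B C F)) = smf_comp A C F (const_unit A B)"
  "TC (F0 (postcomp A B C F)) \<in> extensional (Obj A)" "a \<in> Obj A \<Longrightarrow> TC (F0 (postcomp A B C F)) a = F0 F"
  "\<lbrakk>sm_functor A B H; sm_functor A B K\<rbrakk> \<Longrightarrow> TDom (F2 (postcomp A B C F) H K) = fun_tens A C (smf_comp A C F H) (smf_comp A C F K)"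
  "\<lbrakk>sm_functor A B H; sm_functor A B K\<rbrakk> \<Longrightarrow> TCod (F2 (postcomp A B C F) H K) = smf_comp A C F (fun_tens A B H K)"
  "\<lbrakk>sm_functor A B H; sm_functor A B K\<rbrakk> \<Longrightarrow> TC (F2 (postcomp A B C F) H K) \<in> extensional (Obj A)"
  "\<lbrakk>sm_functor A B H; sm_functor A B K; a \<in> Obj A\<rbrakk> \<Longrightarrow> TC (F2 (postcomp A B C F) H K) a = F2 F (FO H a) (FO K a)"
  by (simp_all add: postcomp_def)

text \<open>This is what compatibility of the transformation \<open>F0 (postcomp A B C F)\<close>
  with tensor products amounts to at each pair of objects.\<close>

lemma (in sm_functor) f2_unit:
  "FA F (Ru A (Unit A)) \<cdot>\<^bsub>B\<^esub> (F2 F (Unit A) (Unit A) \<cdot>\<^bsub>B\<^esub> (F0 F \<star>\<^bsub>B\<^esub> F0 F)) = F0 F \<cdot>\<^bsub>B\<^esub> Ru B (Unit B)"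
proof -
  have "F0 F \<star>\<^bsub>B\<^esub> F0 F = (Ide B (FO F (Unit A)) \<star>\<^bsub>B\<^esub> F0 F) \<cdot>\<^bsub>B\<^esub> (F0 F \<star>\<^bsub>B\<^esub> Ide B (Unit B))"
    by (simp add: B.merge)
  then have "FA F (Ru A (Unit A)) \<cdot>\<^bsub>B\<^esub> (F2 F (Unit A) (Unit A) \<cdot>\<^bsub>B\<^esub> (F0 F \<star>\<^bsub>B\<^esub> F0 F))
    = (FA F (Ru A (Unit A)) \<cdot>\<^bsub>B\<^esub> (F2 F (Unit A) (Unit A) \<cdot>\<^bsub>B\<^esub> (Ide B (FO F (Unit A)) \<star>\<^bsub>B\<^esub> F0 F))) \<cdot>\<^bsub>B\<^esub> (F0 F \<star>\<^bsub>B\<^esub> Ide B (Unit B))"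
    by simp
  also have "\<dots> = F0 F \<cdot>\<^bsub>B\<^esub> Ru B (Unit B)" by (subst f_ru') (simp_all add: B.ru_nat')
  finally show ?thesis .
qed

lemma postcomp_f0_transformation:
  assumes "smc A" "sm_functor B C F"
  shows "sm_transformation A C (F0 (postcomp A B C F))"
proof -
  interpret A: smc A by fact
  interpret B: smc B by (rule sm_functor_smc[OF assms(2)])
  interpret C: smc C by (rule sm_functor_smc[OF assms(2)])
  interpret F: sm_functor B C F by fact
  show ?thesis
    by (rule sm_transformationI)
      (simp_all add: const_unit_functor smf_comp_functor[OF const_unit_functor assms(2)]
        A.smc_axioms B.smc_axioms C.smc_axioms F.f2_unit)
qed

lemma postcomp_f2_transformation:
  assumes "sm_functor A B H" "sm_functor A B K" "sm_functor B C F"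
  shows "sm_transformation A C (F2 (postcomp A B C F) H K)"
proof -
  interpret A: smc A by (rule sm_functor_smc[OF assms(1)])
  interpret B: smc B by (rule sm_functor_smc[OF assms(3)])
  interpret C: smc C by (rule sm_functor_smc[OF assms(3)])
  interpret H: sm_functor A B H by fact
  interpret K: sm_functor A B K by fact
  interpret F: sm_functor B C F by fact
  note [simp] = assms
  show ?thesis
  proof (rule sm_transformationI, goal_cases)
    case 8
    let ?r = "inv_arr C (Ru C (Unit C))"
    \<comment> \<open>The equation \<open>f2_unit\<close> with both unitors inverted, as the unit
      map of a tensor of functors contains an inverse unitor.\<close>
    have "inv_arr C (FA F (Ru B (Unit B))) \<cdot>\<^bsub>C\<^esub> F0 F = (F2 F (Unit B) (Unit B) \<cdot>\<^bsub>C\<^esub> (F0 F \<star>\<^bsub>C\<^esub> F0 F)) \<cdot>\<^bsub>C\<^esub> ?r"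
      by (rule C.inv_square) (simp_all add: F.f2_unit)
    moreover have "((FA F (F0 H) \<cdot>\<^bsub>C\<^esub> F0 F) \<star>\<^bsub>C\<^esub> (FA F (F0 K) \<cdot>\<^bsub>C\<^esub> F0 F)) \<cdot>\<^bsub>C\<^esub> ?r
      = (FA F (F0 H) \<star>\<^bsub>C\<^esub> FA F (F0 K)) \<cdot>\<^bsub>C\<^esub> ((F0 F \<star>\<^bsub>C\<^esub> F0 F) \<cdot>\<^bsub>C\<^esub> ?r)"
      by (simp add: C.merge_r)
    ultimately show ?case by (simp add: F.f2_nat_r)
  next
    case (9 x y)
    let ?m = "mid C (FO F (FO H x)) (FO F (FO K x)) (FO F (FO H y)) (FO F (FO K y))"
    let ?f = "F2 F (FO H x) (FO H y) \<star>\<^bsub>C\<^esub> F2 F (FO K x) (FO K y)"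
    have "((FA F (F2 H x y) \<cdot>\<^bsub>C\<^esub> F2 F (FO H x) (FO H y)) \<star>\<^bsub>C\<^esub> (FA F (F2 K x y) \<cdot>\<^bsub>C\<^esub> F2 F (FO K x) (FO K y))) \<cdot>\<^bsub>C\<^esub> ?m
      = (FA F (F2 H x y) \<star>\<^bsub>C\<^esub> FA F (F2 K x y)) \<cdot>\<^bsub>C\<^esub> (?f \<cdot>\<^bsub>C\<^esub> ?m)"
      using 9 by (simp add: C.merge_r)
    then show ?case using 9 by (simp add: F.f2_nat_r F.fa_mid)
  qed (simp_all add: fun_tens_functor smf_comp_functor[OF fun_tens_functor assms(3)] smf_comp_functor[OF _ assms(3)] F.f2_nat')
qed

lemma postcomp_functor:
  assumes "smc A" "sm_functor B C F"
  shows "sm_functor (ihom A B) (ihom A C) (postcomp A B C F)"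
proof -
  interpret A: smc A by fact
  interpret B: smc B by (rule sm_functor_smc[OF assms(2)])
  interpret C: smc C by (rule sm_functor_smc[OF assms(2)])
  interpret F: sm_functor B C F by fact
  interpret AB: smc "ihom A B" by (rule smc_ihom) unfold_locales
  interpret AC: smc "ihom A C" by (rule smc_ihom) unfold_locales
  note [simp] = ihom_rules[where A = A and B = B] const_unit_functor[OF A.smc_axioms B.smc_axioms]
    smf_comp_functor[OF _ assms(2)] whisker_fun_transformation[OF _ assms(2)]
    postcomp_f0_transformation[OF assms] postcomp_f2_transformation[OF _ _ assms(2)]
  show ?thesis
    by (rule sm_functorI, unfold ihom_simps)
      (auto intro!: smt_eqI[where S = "Obj A"] simp: AB.smc_axioms AC.smc_axioms F.f2_nat' F.f_ass' F.f_ru' F.f_lu' F.f_sym)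
qed

text \<open>Identity components force source and target to coincide: on objects by typing, on the
  rest by naturality and monoidality. Strictness of \<open>[A, F]\<close> rests on this, because its
  structure maps are known by their components.\<close>

lemma identity_transformation:
  assumes "sm_transformation A B \<sigma>" "\<And>x. x \<in> Obj A \<Longrightarrow> TC \<sigma> x = Ide B (FO (TDom \<sigma>) x)"
  shows "\<sigma> = Ide (ihom A B) (TDom \<sigma>)"
proof -
  interpret A: smc A by (rule sm_transformation_smc[OF assms(1)])
  interpret B: smc B by (rule sm_transformation_smc[OF assms(1)])
  interpret s: sm_transformation A B \<sigma> by fact
  note i [simp] = assms(2)
  have o: "FO (TDom \<sigma>) x = FO (TCod \<sigma>) x" if "x \<in> Obj A" for x
    using s.tc_arr(3)[OF that] that by simp
  have "TDom \<sigma> = TCod \<sigma>"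
  proof (rule smf_eqI[OF s.S.sm_functor_axioms s.T.sm_functor_axioms o])
    show "FA (TDom \<sigma>) f = FA (TCod \<sigma>) f" if "f \<in> Arr A" for f
      using s.tc_nat'[OF that HOL.refl] that by (simp add: o)
    show "F0 (TDom \<sigma>) = F0 (TCod \<sigma>)" using s.tc_unit by simp
    show "F2 (TDom \<sigma>) x y = F2 (TCod \<sigma>) x y" if "x \<in> Obj A" "y \<in> Obj A" for x y
      using s.tc_tens[OF that] that by (simp add: o)
  qed
  then show ?thesis by (intro smt_eqI[where S = "Obj A"]) (simp_all add: s.tc_ext)
qed

lemma strict_postcomp:
  assumes "smc A" "strict_functor B C F"
  shows "strict_functor (ihom A B) (ihom A C) (postcomp A B C F)"
proof -
  note s = strict_sm_functor[OF assms(2)] strict_functor_simps[OF assms(2)]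
  have "F0 (postcomp A B C F) = Ide (ihom A C) (const_unit A C)"
    using identity_transformation[OF postcomp_f0_transformation[OF assms(1) s(1)]]
    by (simp add: s)
  moreover have "F2 (postcomp A B C F) H K = Ide (ihom A C) (fun_tens A C (smf_comp A C F H) (smf_comp A C F K))"
    if H: "sm_functor A B H" and K: "sm_functor A B K" for H K
    using identity_transformation[OF postcomp_f2_transformation[OF H K s(1)]] H K
    by (simp add: s sm_functor.fo_obj[OF H] sm_functor.fo_obj[OF K])
  ultimately show ?thesis
    using postcomp_functor[OF assms(1) s(1)] by (simp add: strict_functor_def)
qed

lemma postcomp_comp:
  assumes "smc A" "sm_functor B C F" "sm_functor C D G"
  shows "postcomp A B D (smf_comp B D G F)
    = smf_comp (ihom A B) (ihom A D) (postcomp A C D G) (postcomp A B C F)" (is "?L = ?R")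
proof -
  interpret A: smc A by fact
  interpret B: smc B by (rule sm_functor_smc[OF assms(2)])
  interpret C: smc C by (rule sm_functor_smc[OF assms(2)])
  interpret D: smc D by (rule sm_functor_smc[OF assms(3)])
  interpret F: sm_functor B C F by fact
  interpret G: sm_functor C D G by fact
  note [simp] = smf_comp_assoc[OF _ assms(2,3)] smf_comp_functor[OF _ assms(2)] smf_comp_functor[OF _ assms(3)]
    smf_comp_functor[OF assms(2,3)] whisker_fun_transformation[OF _ assms(2)]
    whisker_fun_transformation[OF _ assms(3)] postcomp_f0_transformation[OF A.smc_axioms assms(2)]
    postcomp_f2_transformation[OF _ _ assms(2)] const_unit_functor[OF A.smc_axioms B.smc_axioms]
    const_unit_functor[OF A.smc_axioms C.smc_axioms]
    ihom_rules[where A = A and B = B]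
  show ?thesis
  proof (rule smf_eqI)
    show "sm_functor (ihom A B) (ihom A D) ?L" by (rule postcomp_functor) (use assms in simp_all)
    show "sm_functor (ihom A B) (ihom A D) ?R"
      by (rule smf_comp_functor) (rule postcomp_functor; use assms in simp)+
  qed (auto intro!: smt_eqI[where S = "Obj A"])
qed

lemma postcomp_trans_simps [simp]:
  "TDom (postcomp_trans A B C \<sigma>) = postcomp A B C (TDom \<sigma>)"
  "TCod (postcomp_trans A B C \<sigma>) = postcomp A B C (TCod \<sigma>)"
  "TC (postcomp_trans A B C \<sigma>) \<in> extensional (Obj (ihom A B))"
  "sm_functor A B H \<Longrightarrow> TC (postcomp_trans A B C \<sigma>) H = whisker_trans A C \<sigma> H"
  by (simp_all add: postcomp_trans_def)

lemma postcomp_trans_transformation: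
  assumes "smc A" "sm_transformation B C \<sigma>"
  shows "sm_transformation (ihom A B) (ihom A C) (postcomp_trans A B C \<sigma>)"
proof -
  interpret A: smc A by fact
  interpret B: smc B by (rule sm_transformation_smc[OF assms(2)])
  interpret C: smc C by (rule sm_transformation_smc[OF assms(2)])
  interpret s: sm_transformation B C \<sigma> by fact
  note [simp] = ihom_rules[where A = A and B = B]
    whisker_trans_transformation[OF assms(2)] const_unit_functor[OF A.smc_axioms B.smc_axioms]
  show ?thesis
    by (rule sm_transformationI)
      (auto intro!: smt_eqI[where S = "Obj A"] simp: postcomp_functor[OF assms(1)] s.S.sm_functor_axioms
        s.T.sm_functor_axioms s.tc_nat' s.tc_unit s.tc_tens)
qed

section \<open>Precomposition\<close>

lemma precomp_simps [simp]:
  "FO (precomp C A B F) \<in> extensional (Obj (ihom A B))" "FA (precomp C A B F) \<in> extensional (Arr (ihom A B))"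
  "sm_functor A B H \<Longrightarrow> FO (precomp C A B F) H = smf_comp C B H F"
  "sm_transformation A B \<theta> \<Longrightarrow> FA (precomp C A B F) \<theta> = whisker_trans C B \<theta> F"
  "F0 (precomp C A B F) = Ide (ihom C B) (const_unit C B)"
  by (simp_all add: precomp_def)

text \<open>Unit and tensor product of functors are pointwise, so precomposition preserves them as
  records.\<close>

lemma strict_precomp:
  assumes "sm_functor C A F" "smc B"
  shows "strict_functor (ihom A B) (ihom C B) (precomp C A B F)"
proof -
  interpret C: smc C by (rule sm_functor_smc[OF assms(1)])
  interpret A: smc A by (rule sm_functor_smc[OF assms(1)])
  interpret B: smc B by fact
  interpret F: sm_functor C A F by fact
  interpret AB: smc "ihom A B" by (rule smc_ihom) unfold_locales
  interpret CB: smc "ihom C B" by (rule smc_ihom) unfold_locales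
  have unit: "smf_comp C B (const_unit A B) F = const_unit C B"
    by (rule smf_eqI[where A = C and B = B])
      (simp_all add: smf_comp_functor[OF assms(1)] const_unit_functor A.smc_axioms B.smc_axioms C.smc_axioms)
  have tens: "smf_comp C B (fun_tens A B H K) F = fun_tens C B (smf_comp C B H F) (smf_comp C B K F)"
    if H: "sm_functor A B H" and K: "sm_functor A B K" for H K
  proof -
    interpret H: sm_functor A B H by fact
    interpret K: sm_functor A B K by fact
    show ?thesis
      by (rule smf_eqI[where A = C and B = B])
        (simp_all add: smf_comp_functor[OF assms(1)] fun_tens_functor H K B.merge B.merge_r)
  qed
  note [simp] = ihom_rules[where A = A and B = B] fun_tens_functor
    whisker_trans_transformation[OF _ assms(1)] const_unit_functor[OF A.smc_axioms B.smc_axioms]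
    smf_comp_functor[OF assms(1)]
  show ?thesis
  proof (rule strict_functorI, goal_cases)
    case 6
    show ?case by (auto simp: precomp_def intro!: restrict2_cong)
  qed (auto simp: unit tens AB.smc_axioms CB.smc_axioms intro!: smt_eqI[where S = "Obj C"])
qed

section \<open>The tensor product\<close>

locale smc_pair = A: smc A + B: smc B
  for A :: "('o, 'a) smcat" and B :: "('p, 'b) smcat"
begin

abbreviation "T \<equiv> A \<boxtimes> B"
abbreviation "cls \<equiv> ecls A B"
abbreviation "wfe \<equiv> wf_exp A B"
abbreviation "dm \<equiv> edom A B"
abbreviation "cd \<equiv> ecod A B"

lemma wf_dom_cod: "wfe p \<Longrightarrow> wf_word A B (dm p) \<and> wf_word A B (cd p)"
  by (induction p) auto

lemmas [simp] = wf_dom_cod[THEN conjunct1] wf_dom_cod[THEN conjunct2]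

lemma tens_eq_typing:
  "\<lbrakk>tens_eq A B p q; wfe p; wfe q\<rbrakk> \<Longrightarrow> dm p = dm q \<and> cd p = cd q"
  by (induction rule: tens_eq.induct) (auto simp: ETens_def EMid_def)

lemma tens_cong_typing:
  "tens_cong A B p q \<Longrightarrow> wfe p \<and> wfe q \<and> dm p = dm q \<and> cd p = cd q"
  by (induction rule: tens_cong.induct) (auto dest: tens_eq_typing)

lemma cls_eqI: "tens_cong A B p q \<Longrightarrow> cls p = cls q"
  unfolding ecls_def by (blast intro: tens_cong.trans tens_cong.sym)

lemma cls_base: "\<lbrakk>tens_eq A B p q; wfe p; wfe q\<rbrakk> \<Longrightarrow> cls p = cls q"
  by (intro cls_eqI tens_cong.base)

lemma cls_eqD: "\<lbrakk>cls p = cls q; wfe q\<rbrakk> \<Longrightarrow> tens_cong A B p q"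
  unfolding ecls_def using tens_cong.refl[of A B q] by blast

text \<open>Operations on classes are computed at \<open>erep\<close>; here it is tied to the
  expression that is actually given.\<close>

lemma rep: "wfe p \<Longrightarrow> tens_cong A B p (erep (cls p))"
  unfolding erep_def ecls_def by (metis (mono_tags) mem_Collect_eq someI tens_cong.refl)

lemma dm_rep: "wfe p \<Longrightarrow> dm (erep (cls p)) = dm p"
  and cd_rep: "wfe p \<Longrightarrow> cd (erep (cls p)) = cd p"
  using tens_cong_typing[OF rep[of p]] by auto

lemma tens_obj_iff [simp]: "X \<in> Obj T \<longleftrightarrow> wf_word A B X"
  by (simp add: tens_def)

lemma cls_arr [simp]: "wfe p \<Longrightarrow> cls p \<in> Arr T"
  by (simp add: tens_def)

lemma arrE:
  assumes "P \<in> Arr T" obtains p where "wfe p" "P = cls p"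
  using assms by (auto simp: tens_def)

lemma dom_cls [simp]: "wfe p \<Longrightarrow> Dom T (cls p) = dm p"
  and cod_cls [simp]: "wfe p \<Longrightarrow> Cod T (cls p) = cd p"
  by (simp_all add: tens_def dm_rep cd_rep)

lemma unit_tens [simp]: "Unit T = WUnit" and tensO_tens [simp]: "TensO T = (\<otimes>\<^sub>w)"
  and ide_cls: "Ide T X = cls (EIde X)" and ass_cls: "Ass T X Y Z = cls (EAss X Y Z)"
  and ru_cls: "Ru T X = cls (ERu X)" and lu_cls: "Lu T X = cls (ELu X)"
  and sym_cls: "Sym T X Y = cls (ESym X Y)"
  by (simp_all add: tens_def)

lemma comp_cls: "\<lbrakk>wfe p; wfe q; dm p = cd q\<rbrakk> \<Longrightarrow> cls p \<cdot>\<^bsub>T\<^esub> cls q = cls (p \<bullet> q)"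
  unfolding tens_def by (auto intro!: cls_eqI tens_cong.comp intro: tens_cong.sym rep simp: dm_rep cd_rep)

lemma wf_ETens [simp]: "wfe (ETens A B p q) \<longleftrightarrow> wfe p \<and> wfe q"
  by (auto simp: ETens_def)

lemma dm_ETens [simp]: "dm (ETens A B p q) = dm p \<otimes>\<^sub>w dm q"
  and cd_ETens [simp]: "cd (ETens A B p q) = cd p \<otimes>\<^sub>w cd q"
  by (simp_all add: ETens_def)

lemma ETens_cong:
  assumes "tens_cong A B p p'" "tens_cong A B q q'"
  shows "tens_cong A B (ETens A B p q) (ETens A B p' q')"
proof -
  have "wfe p" "wfe p'" "wfe q" "wfe q'" "dm p = dm p'" "cd q = cd q'"
    using assms[THEN tens_cong_typing] by auto
  then show ?thesis
    unfolding ETens_def using assms by (auto intro!: tens_cong.comp tens_cong.whl tens_cong.whr)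
qed

lemma tens_cls: "\<lbrakk>wfe p; wfe q\<rbrakk> \<Longrightarrow> cls p \<star>\<^bsub>T\<^esub> cls q = cls (ETens A B p q)"
  unfolding tens_def by (auto intro!: cls_eqI ETens_cong intro: tens_cong.sym rep)

lemma comp_cong:
  "\<lbrakk>cls p = cls p'; cls q = cls q'; wfe (p \<bullet> q); wfe (p' \<bullet> q')\<rbrakk> \<Longrightarrow> cls (p \<bullet> q) = cls (p' \<bullet> q')"
  by (auto intro!: cls_eqI tens_cong.comp dest: cls_eqD)

text \<open>Whiskering is primitive in the generating equations and the tensor of arrows is derived;
  this lemma and the next one convert between the two.\<close>

lemma ide_tens_cls: "\<lbrakk>wf_word A B X; wfe p\<rbrakk> \<Longrightarrow> cls (EIde X) \<star>\<^bsub>T\<^esub> cls p = cls (X \<rhd> p)"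
proof -
  assume *: "wf_word A B X" "wfe p"
  then have "cls ((EIde X \<lhd> cd p) \<bullet> (X \<rhd> p)) = cls (EIde (cd (X \<rhd> p)) \<bullet> (X \<rhd> p))"
    by (intro comp_cong) (auto del: equalityI intro!: cls_base tens_eq.whr_ide)
  also have "\<dots> = cls (X \<rhd> p)" using * by (intro cls_base tens_eq.ide_comp) auto
  finally show ?thesis using * by (simp add: tens_cls ETens_def)
qed

lemma tens_ide_cls: "\<lbrakk>wf_word A B X; wfe p\<rbrakk> \<Longrightarrow> cls p \<star>\<^bsub>T\<^esub> cls (EIde X) = cls (p \<lhd> X)"
proof -
  assume *: "wf_word A B X" "wfe p"
  then have "cls ((p \<lhd> X) \<bullet> (dm p \<rhd> EIde X)) = cls ((p \<lhd> X) \<bullet> EIde (dm (p \<lhd> X)))"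
    by (intro comp_cong) (auto del: equalityI intro!: cls_base tens_eq.whl_ide)
  also have "\<dots> = cls (p \<lhd> X)" using * by (intro cls_base tens_eq.comp_ide) auto
  finally show ?thesis using * by (simp add: tens_cls ETens_def)
qed

lemma cls_assoc:
  "\<lbrakk>wfe p; wfe q; wfe r; dm p = cd q; dm q = cd r\<rbrakk> \<Longrightarrow> cls (p \<bullet> (q \<bullet> r)) = cls ((p \<bullet> q) \<bullet> r)"
  by (intro cls_base tens_eq.comp_assoc) auto

lemma cls_tens_comp:
  assumes [simp]: "wfe f" "wfe g" "wfe f'" "wfe g'" "dm g = cd f" "dm g' = cd f'"
  shows "cls (ETens A B (g \<bullet> f) (g' \<bullet> f')) = cls (ETens A B g g' \<bullet> ETens A B f f')"
proof -
  let ?a = "dm f" and ?b = "cd f" and ?b' = "cd f'" and ?c' = "cd g'"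
  \<comment> \<open>The one use of interchange, on the two middle factors; everything else is
    regrouping.\<close>
  have i: "cls ((f \<lhd> ?c') \<bullet> (?a \<rhd> g')) = cls ((?b \<rhd> g') \<bullet> (f \<lhd> ?b'))"
    using tens_eq.interchange[of A B f g'] by (intro cls_base) auto
  have "cls (ETens A B (g \<bullet> f) (g' \<bullet> f'))
      = cls (((g \<lhd> ?c') \<bullet> (f \<lhd> ?c')) \<bullet> ((?a \<rhd> g') \<bullet> (?a \<rhd> f')))"
    unfolding ETens_def by (intro comp_cong) (auto del: equalityI intro!: cls_base tens_eq.whl_comp tens_eq.whr_comp)
  also have "\<dots> = cls ((g \<lhd> ?c') \<bullet> ((f \<lhd> ?c') \<bullet> ((?a \<rhd> g') \<bullet> (?a \<rhd> f'))))"
    by (rule cls_assoc[symmetric]) auto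
  also have "\<dots> = cls ((g \<lhd> ?c') \<bullet> (((f \<lhd> ?c') \<bullet> (?a \<rhd> g')) \<bullet> (?a \<rhd> f')))"
    by (intro comp_cong HOL.refl cls_assoc) auto
  also have "\<dots> = cls ((g \<lhd> ?c') \<bullet> (((?b \<rhd> g') \<bullet> (f \<lhd> ?b')) \<bullet> (?a \<rhd> f')))"
    by (rule comp_cong[OF HOL.refl comp_cong[OF i HOL.refl]]) auto
  also have "\<dots> = cls ((g \<lhd> ?c') \<bullet> ((?b \<rhd> g') \<bullet> ((f \<lhd> ?b') \<bullet> (?a \<rhd> f'))))"
    by (intro comp_cong HOL.refl cls_assoc[symmetric]) auto
  also have "\<dots> = cls (((g \<lhd> ?c') \<bullet> (?b \<rhd> g')) \<bullet> ((f \<lhd> ?b') \<bullet> (?a \<rhd> f')))"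
    by (rule cls_assoc) auto
  finally show ?thesis by (simp add: ETens_def)
qed

lemma inverse_cls:
  assumes "tens_eq A B (q \<bullet> p) (EIde (dm p))" "tens_eq A B (p \<bullet> q) (EIde (cd p))"
    "wfe p" "wfe q" "dm q = cd p" "cd q = dm p"
  shows "inverse_arrows T (cls p) (cls q)"
  using assms by (auto del: equalityI simp: inverse_arrows_def Hom_iff comp_cls ide_cls intro!: cls_base)

lemma inverse_ass: "\<lbrakk>wf_word A B X; wf_word A B Y; wf_word A B Z\<rbrakk> \<Longrightarrow> inverse_arrows T (Ass T X Y Z) (cls (EAssInv X Y Z))"
  and inverse_ru: "wf_word A B X \<Longrightarrow> inverse_arrows T (Ru T X) (cls (ERuInv X))"
  and inverse_lu: "wf_word A B X \<Longrightarrow> inverse_arrows T (Lu T X) (cls (ELuInv X))"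
  unfolding ass_cls ru_cls lu_cls
  by (rule inverse_cls; auto intro: tens_eq.intros)+

lemmas cls_simps = ide_cls ass_cls ru_cls lu_cls sym_cls comp_cls ide_tens_cls tens_ide_cls

lemma smc_tens: "smc T"
proof (unfold_locales, unfold Hom_iff, goal_cases)
  case 17 then show ?case using inverse_ass by (auto simp: iso_arr_def)
next
  case 18 then show ?case using inverse_ru by (auto simp: iso_arr_def)
next
  case 19 then show ?case using inverse_lu by (auto simp: iso_arr_def)
next
  \<comment> \<open>In this case and the five after it \<open>tens_cls\<close> is left out, because
    a tensor with an identity must turn into a whiskering in order to match its generating
    equation.\<close>
  case 11 then show ?case
    by (auto del: equalityI elim!: arrE simp: cls_simps intro!: cls_base tens_eq.intros(1-27))
next
  case 21 then show ?case
    by (auto del: equalityI elim!: arrE simp: cls_simps intro!: cls_base tens_eq.intros(1-27))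
next
  case 22 then show ?case
    by (auto del: equalityI elim!: arrE simp: cls_simps intro!: cls_base tens_eq.intros(1-27))
next
  case 24 then show ?case
    by (auto del: equalityI elim!: arrE simp: cls_simps intro!: cls_base tens_eq.intros(1-27))
next
  case 25 then show ?case
    by (auto del: equalityI elim!: arrE simp: cls_simps intro!: cls_base tens_eq.intros(1-27))
next
  case 29 then show ?case
    by (auto del: equalityI elim!: arrE simp: cls_simps intro!: cls_base tens_eq.intros(1-27))
qed (auto del: equalityI elim!: arrE simp: cls_simps tens_cls cls_assoc cls_tens_comp
    intro!: cls_base tens_eq.intros(1-27))

end

section \<open>The universal functor \<open>\<eta>\<close>\<close>

sublocale smc_pair \<subseteq> T: smc "A \<boxtimes> B" by (rule smc_tens)

context smc_pair
begin

lemma inv_ass_cls: "\<lbrakk>wf_word A B X; wf_word A B Y; wf_word A B Z\<rbrakk> \<Longrightarrow> inv_arr T (Ass T X Y Z) = cls (EAssInv X Y Z)"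
  by (rule T.inv_arr_eq) (rule inverse_ass)

text \<open>Reads a class of expressions as an arrow assembled with the operations of
  \<open>T\<close>, which turns each generating equation into an axiom for
  \<open>eta\<close>.\<close>

lemma expand:
  "\<lbrakk>wfe p; wfe q; dm p = cd q\<rbrakk> \<Longrightarrow> cls (p \<bullet> q) = cls p \<cdot>\<^bsub>T\<^esub> cls q"
  "\<lbrakk>wfe p; wfe q\<rbrakk> \<Longrightarrow> cls (ETens A B p q) = cls p \<star>\<^bsub>T\<^esub> cls q"
  "\<lbrakk>wf_word A B X; wfe p\<rbrakk> \<Longrightarrow> cls (X \<rhd> p) = Ide T X \<star>\<^bsub>T\<^esub> cls p"
  "\<lbrakk>wf_word A B X; wfe p\<rbrakk> \<Longrightarrow> cls (p \<lhd> X) = cls p \<star>\<^bsub>T\<^esub> Ide T X"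
  "cls (EIde X) = Ide T X" "cls (EAss X Y Z) = Ass T X Y Z"
  "\<lbrakk>wf_word A B X; wf_word A B Y; wf_word A B Z\<rbrakk> \<Longrightarrow> cls (EAssInv X Y Z) = inv_arr T (Ass T X Y Z)"
  "cls (ERu X) = Ru T X" "cls (ELu X) = Lu T X" "cls (ESym X Y) = Sym T X Y"
  "wf_word A B X \<Longrightarrow> cls (ERuInv X) = inv_arr T (Ru T X)"
  "wf_word A B X \<Longrightarrow> cls (ELuInv X) = inv_arr T (Lu T X)"
  by (simp_all only: inv_ass_cls T.inv_arr_eq[OF inverse_ru] T.inv_arr_eq[OF inverse_lu])
    (simp_all only: ide_cls ide_tens_cls tens_ide_cls ass_cls ru_cls lu_cls sym_cls comp_cls tens_cls)

lemma expand_mid: "\<lbrakk>wf_word A B X; wf_word A B Y; wf_word A B Z; wf_word A B W\<rbrakk>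
    \<Longrightarrow> cls (EMid X Y Z W) = mid T X Y Z W"
  by (simp add: mid_def EMid_def expand)

lemma EMid_typing [simp]: "wfe (EMid X Y Z W) \<longleftrightarrow> wf_word A B X \<and> wf_word A B Y \<and> wf_word A B Z \<and> wf_word A B W"
  "dm (EMid X Y Z W) = (X \<otimes>\<^sub>w Y) \<otimes>\<^sub>w (Z \<otimes>\<^sub>w W)" "cd (EMid X Y Z W) = (X \<otimes>\<^sub>w Z) \<otimes>\<^sub>w (Y \<otimes>\<^sub>w W)"
  by (auto simp: EMid_def)

lemma eta_obj_simps [simp]:
  "FO (eta_obj A B a) \<in> extensional (Obj B)" "FA (eta_obj A B a) \<in> extensional (Arr B)"
  "restrict2 (F2 (eta_obj A B a)) (Obj B) = F2 (eta_obj A B a)"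
  "b \<in> Obj B \<Longrightarrow> FO (eta_obj A B a) b = WGen a b"
  "g \<in> Arr B \<Longrightarrow> FA (eta_obj A B a) g = cls (EArrR a g)"
  "F0 (eta_obj A B a) = cls (EBeta a)"
  "\<lbrakk>b \<in> Obj B; b' \<in> Obj B\<rbrakk> \<Longrightarrow> F2 (eta_obj A B a) b b' = cls (EDelta a b b')"
  by (simp_all add: eta_obj_def)

lemma eta_simps [simp]:
  "FO (eta A B) \<in> extensional (Obj A)" "FA (eta A B) \<in> extensional (Arr A)"
  "restrict2 (F2 (eta A B)) (Obj A) = F2 (eta A B)"
  "a \<in> Obj A \<Longrightarrow> FO (eta A B) a = eta_obj A B a"
  "f \<in> Arr A \<Longrightarrow> TDom (FA (eta A B) f) = eta_obj A B (Dom A f)"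
  "f \<in> Arr A \<Longrightarrow> TCod (FA (eta A B) f) = eta_obj A B (Cod A f)"
  "f \<in> Arr A \<Longrightarrow> TC (FA (eta A B) f) \<in> extensional (Obj B)"
  "\<lbrakk>f \<in> Arr A; b \<in> Obj B\<rbrakk> \<Longrightarrow> TC (FA (eta A B) f) b = cls (EArrL f b)"
  "TDom (F0 (eta A B)) = const_unit B T" "TCod (F0 (eta A B)) = eta_obj A B (Unit A)"
  "TC (F0 (eta A B)) \<in> extensional (Obj B)" "b \<in> Obj B \<Longrightarrow> TC (F0 (eta A B)) b = cls (EAlpha b)"
  "\<lbrakk>a \<in> Obj A; a' \<in> Obj A\<rbrakk> \<Longrightarrow> TDom (F2 (eta A B) a a') = fun_tens B T (eta_obj A B a) (eta_obj A B a')"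
  "\<lbrakk>a \<in> Obj A; a' \<in> Obj A\<rbrakk> \<Longrightarrow> TCod (F2 (eta A B) a a') = eta_obj A B (a \<otimes>\<^bsub>A\<^esub> a')"
  "\<lbrakk>a \<in> Obj A; a' \<in> Obj A\<rbrakk> \<Longrightarrow> TC (F2 (eta A B) a a') \<in> extensional (Obj B)"
  "\<lbrakk>a \<in> Obj A; a' \<in> Obj A; b \<in> Obj B\<rbrakk> \<Longrightarrow> TC (F2 (eta A B) a a') b = cls (EGamma a a' b)"
  by (simp_all add: eta_def)

text \<open>Each axiom is the generating equation of the same shape for \<beta> and
  \<delta>.\<close>

lemma eta_obj_functor: "a \<in> Obj A \<Longrightarrow> sm_functor B T (eta_obj A B a)"
proof (rule sm_functorI, goal_cases)
  case (10 x)
  then show ?case using cls_base[OF tens_eq.arrR_ide] by (simp add: expand)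
next
  case (11 f g)
  then show ?case using cls_base[OF tens_eq.arrR_comp[of B f g A a]] by (simp add: expand)
next
  case (18 f g)
  then show ?case using cls_base[OF tens_eq.delta_nat[of A B a f g]] by (simp add: expand)
next
  case (19 x y z)
  then show ?case using cls_base[OF tens_eq.delta_ass[of A B a x y z]] by (simp add: expand)
next
  case (20 x)
  then show ?case using cls_base[OF tens_eq.delta_ru[of A B a x]] by (simp add: expand)
next
  case (21 x)
  then show ?case using cls_base[OF tens_eq.delta_lu[of A B a x]] by (simp add: expand)
next
  case (22 x y)
  then show ?case using cls_base[OF tens_eq.delta_sym[of A B a x y]] by (simp add: expand)
qed (simp_all add: B.smc_axioms smc_tens)

lemma eta_arr_transformation: "f \<in> Arr A \<Longrightarrow> sm_transformation B T (FA (eta A B) f)"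
proof (rule sm_transformationI, goal_cases)
  case (7 g)
  then show ?case using cls_base[OF tens_eq.arr_nat[of A B f g]] by (simp add: expand)
next
  case 8
  then show ?case using cls_base[OF tens_eq.arrL_unit[of A B f]] by (simp add: expand)
next
  case (9 x y)
  then show ?case using cls_base[OF tens_eq.arrL_tens[of A B f x y]] by (simp add: expand)
qed (simp_all add: eta_obj_functor)

lemma eta_f0_transformation: "sm_transformation B T (F0 (eta A B))"
proof (rule sm_transformationI, goal_cases)
  case (7 g)
  then show ?case using cls_base[OF tens_eq.arrR_unit[of A B g]] by (simp add: expand)
next
  case 8
  then show ?case using cls_base[OF tens_eq.beta_alpha[of A B]] by (simp add: expand)
next
  case (9 x y)
  then show ?case using cls_base[OF tens_eq.alpha_tens[of A B x y]] by (simp add: expand)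
qed (simp_all add: eta_obj_functor const_unit_functor B.smc_axioms smc_tens)

lemma eta_f2_transformation:
  "\<lbrakk>a \<in> Obj A; a' \<in> Obj A\<rbrakk> \<Longrightarrow> sm_transformation B T (F2 (eta A B) a a')"
proof (rule sm_transformationI, goal_cases)
  case (7 g)
  then show ?case using cls_base[OF tens_eq.arrR_tens[of A B a a' g]] by (simp add: expand)
next
  \<comment> \<open>\<open>beta_tens\<close> has the unitor on the other side; composing with its
    inverse gives the form in which it occurs in \<open>F0\<close> of a tensor of functors.\<close>
  case 8
  have "cls (EBeta (a \<otimes>\<^bsub>A\<^esub> a')) \<cdot>\<^bsub>T\<^esub> Ru T WUnit = cls (EGamma a a' (Unit B)) \<cdot>\<^bsub>T\<^esub> (cls (EBeta a) \<star>\<^bsub>T\<^esub> cls (EBeta a'))"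
    using 8 cls_base[OF tens_eq.beta_tens[of A B a a']] by (simp add: expand)
  then have "(cls (EGamma a a' (Unit B)) \<cdot>\<^bsub>T\<^esub> (cls (EBeta a) \<star>\<^bsub>T\<^esub> cls (EBeta a'))) \<cdot>\<^bsub>T\<^esub> inv_arr T (Ru T WUnit)
      = (cls (EBeta (a \<otimes>\<^bsub>A\<^esub> a')) \<cdot>\<^bsub>T\<^esub> Ru T WUnit) \<cdot>\<^bsub>T\<^esub> inv_arr T (Ru T WUnit)"
    by simp
  then show ?case using 8 T.ru_iso[of WUnit] by simp
next
  \<comment> \<open>\<open>gamma_delta\<close> has the interchange on the other side; as
    \<open>mid\<close> is an involution it can be brought over.\<close>
  case (9 x y)
  let ?d = "cls (EDelta a x y) \<star>\<^bsub>T\<^esub> cls (EDelta a' x y)"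
    and ?m = "mid T (WGen a x) (WGen a' x) (WGen a y) (WGen a' y)"
    and ?n = "mid T (WGen a x) (WGen a y) (WGen a' x) (WGen a' y)"
  have "cls (EGamma a a' (x \<otimes>\<^bsub>B\<^esub> y)) \<cdot>\<^bsub>T\<^esub> ?d
      = cls (EDelta (a \<otimes>\<^bsub>A\<^esub> a') x y) \<cdot>\<^bsub>T\<^esub> ((cls (EGamma a a' x) \<star>\<^bsub>T\<^esub> cls (EGamma a a' y)) \<cdot>\<^bsub>T\<^esub> ?n)"
    using 9 cls_base[OF tens_eq.gamma_delta[of A B a a' x y]] by (simp add: expand expand_mid)
  then have "(cls (EGamma a a' (x \<otimes>\<^bsub>B\<^esub> y)) \<cdot>\<^bsub>T\<^esub> ?d) \<cdot>\<^bsub>T\<^esub> ?m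
      = (cls (EDelta (a \<otimes>\<^bsub>A\<^esub> a') x y) \<cdot>\<^bsub>T\<^esub> ((cls (EGamma a a' x) \<star>\<^bsub>T\<^esub> cls (EGamma a a' y)) \<cdot>\<^bsub>T\<^esub> ?n)) \<cdot>\<^bsub>T\<^esub> ?m"
    by (rule arg_cong)
  then show ?case using 9 T.mid_mid[of "WGen a x" "WGen a y" "WGen a' x" "WGen a' y"] T.mid_typing[of "WGen a x" "WGen a' x" "WGen a y" "WGen a' y"]
    T.mid_typing[of "WGen a x" "WGen a y" "WGen a' x" "WGen a' y"] by simp
qed (simp_all add: eta_obj_functor fun_tens_functor)

lemma eta_functor: "sm_functor A (ihom B T) (eta A B)"
proof (rule sm_functorI, goal_cases)
  case (10 x)
  then show ?case using cls_base[OF tens_eq.arrL_ide[of A B x]]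
    by (auto intro!: smt_eqI[where S = "Obj B"] simp: expand)
next
  case (11 f g)
  then show ?case using cls_base[OF tens_eq.arrL_comp[of A f g B]]
    by (auto intro!: smt_eqI[where S = "Obj B"] simp: expand)
next
  case (18 f g)
  then show ?case using cls_base[OF tens_eq.gamma_nat[of A B f g]]
    by (auto intro!: smt_eqI[where S = "Obj B"] simp: expand)
next
  case (19 x y z)
  then show ?case using cls_base[OF tens_eq.gamma_ass[of A B x y z]]
    by (auto intro!: smt_eqI[where S = "Obj B"] simp: expand)
next
  case (20 x)
  then show ?case using cls_base[OF tens_eq.gamma_ru[of A B x]]
    by (auto intro!: smt_eqI[where S = "Obj B"] simp: expand)
next
  case (21 x)
  then show ?case using cls_base[OF tens_eq.gamma_lu[of A B x]]
    by (auto intro!: smt_eqI[where S = "Obj B"] simp: expand)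
next
  case (22 x y)
  then show ?case using cls_base[OF tens_eq.gamma_sym[of A B x y]]
    by (auto intro!: smt_eqI[where S = "Obj B"] simp: expand)
qed (simp_all add: A.smc_axioms smc_ihom B.smc_axioms smc_tens eta_obj_functor eta_arr_transformation
    eta_f0_transformation eta_f2_transformation)

end

section \<open>The functor \<open>En\<close>\<close>

locale bifunctor = smc_pair A B + C: smc C + F: sm_functor A "ihom B C" F
  for A :: "('o, 'a) smcat" and B :: "('p, 'b) smcat" and C :: "('q, 'c) smcat" and F
begin

lemma fo_functor: "a \<in> Obj A \<Longrightarrow> sm_functor B C (FO F a)"
  using F.fo_obj[of a] by simp

lemma fa_transformation [simp]:
  assumes "f \<in> Arr A"
  shows "sm_transformation B C (FA F f)" "TDom (FA F f) = FO F (Dom A f)" "TCod (FA F f) = FO F (Cod A f)"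
  using F.fa_arr[OF assms] F.dom_fa[OF assms] F.cod_fa[OF assms] by simp_all

lemma f0_transformation [simp]:
  "sm_transformation B C (F0 F)" "TDom (F0 F) = const_unit B C" "TCod (F0 F) = FO F (Unit A)"
  using F.f0_arr by simp_all

lemma f2_transformation [simp]:
  assumes "a \<in> Obj A" "a' \<in> Obj A"
  shows "sm_transformation B C (F2 F a a')" "TDom (F2 F a a') = fun_tens B C (FO F a) (FO F a')"
    "TCod (F2 F a a') = FO F (a \<otimes>\<^bsub>A\<^esub> a')"
  using F.f2_arr[OF assms] by simp_all

lemmas [simp] = sm_functor.fo_obj[where A = B and B = C, OF fo_functor]
  sm_functor.fa_arr[where A = B and B = C, OF fo_functor]
  sm_functor.dom_fa[where A = B and B = C, OF fo_functor]
  sm_functor.cod_fa[where A = B and B = C, OF fo_functor]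
  sm_functor.fa_ide[where A = B and B = C, OF fo_functor]
  sm_functor.fa_comp'[where A = B and B = C, OF fo_functor]
  sm_functor.f0_arr[where A = B and B = C, OF fo_functor]
  sm_functor.f2_arr[where A = B and B = C, OF fo_functor]
  sm_transformation.tc_arr[where A = B and B = C]

abbreviation "ew \<equiv> en_word C F"
abbreviation "ex \<equiv> en_exp C F"

lemma ew_obj [simp]: "wf_word A B X \<Longrightarrow> ew X \<in> Obj C"
  by (induction X) auto

lemma ex_typing:
  "wfe p \<Longrightarrow> ex p \<in> Arr C \<and> Dom C (ex p) = ew (dm p) \<and> Cod C (ex p) = ew (cd p)"
  by (induction p) auto

lemmas [simp] = ex_typing[THEN conjunct1] ex_typing[THEN conjunct2, THEN conjunct1]
  ex_typing[THEN conjunct2, THEN conjunct2]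

lemma ex_ETens: "\<lbrakk>wfe p; wfe q\<rbrakk> \<Longrightarrow> ex (ETens A B p q) = ex p \<star>\<^bsub>C\<^esub> ex q"
  by (simp add: ETens_def C.merge)

lemma ex_EMid: "\<lbrakk>wf_word A B X; wf_word A B Y; wf_word A B Z; wf_word A B W\<rbrakk>
    \<Longrightarrow> ex (EMid X Y Z W) = mid C (ew X) (ew Y) (ew Z) (ew W)"
  by (simp add: mid_def EMid_def)

text \<open>The axioms of \<open>F\<close> are equations between transformations, whereas a
  generating equation concerns a single component.\<close>

lemma component: "\<sigma> = \<tau> \<Longrightarrow> TC \<sigma> b = TC \<tau> b" by simp

text \<open>Monoidality of \<open>F2 F a a'\<close>, with the interchange moved to the side on which
  \<open>gamma_delta\<close> has it.\<close>

lemma ex_gamma_delta: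
  assumes [simp]: "a \<in> Obj A" "a' \<in> Obj A" "b \<in> Obj B" "b' \<in> Obj B"
  shows "TC (F2 F a a') (b \<otimes>\<^bsub>B\<^esub> b') \<cdot>\<^bsub>C\<^esub> (F2 (FO F a) b b' \<star>\<^bsub>C\<^esub> F2 (FO F a') b b')
    = F2 (FO F (a \<otimes>\<^bsub>A\<^esub> a')) b b' \<cdot>\<^bsub>C\<^esub> ((TC (F2 F a a') b \<star>\<^bsub>C\<^esub> TC (F2 F a a') b')
      \<cdot>\<^bsub>C\<^esub> mid C (FO (FO F a) b) (FO (FO F a) b') (FO (FO F a') b) (FO (FO F a') b'))"
proof -
  interpret s: sm_transformation B C "F2 F a a'" by simp
  let ?m = "mid C (FO (FO F a) b) (FO (FO F a) b') (FO (FO F a') b) (FO (FO F a') b')"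
  have "(TC (F2 F a a') (b \<otimes>\<^bsub>B\<^esub> b') \<cdot>\<^bsub>C\<^esub> F2 (TDom (F2 F a a')) b b') \<cdot>\<^bsub>C\<^esub> ?m
      = (F2 (TCod (F2 F a a')) b b' \<cdot>\<^bsub>C\<^esub> (TC (F2 F a a') b \<star>\<^bsub>C\<^esub> TC (F2 F a a') b')) \<cdot>\<^bsub>C\<^esub> ?m"
    by (simp only: s.tc_tens assms)
  then show ?thesis by simp
qed

text \<open>The equations for \<beta> and \<delta> are axioms of the functors \<open>FO F a\<close>,
  those for \<alpha> and \<gamma> are axioms of \<open>F\<close> at a component, and the mixed ones
  say that \<open>FA F f\<close>, \<open>F0 F\<close> and \<open>F2 F a a'\<close> are natural and
  monoidal.\<close>

lemma ex_sound: "\<lbrakk>tens_eq A B p q; wfe p; wfe q\<rbrakk> \<Longrightarrow> ex p = ex q"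
proof (induction rule: tens_eq.induct)
  case (delta_nat a g g')
  then show ?case by (simp add: ex_ETens sm_functor.f2_nat'[OF fo_functor])
next
  case (delta_ass a b b' b'')
  then show ?case by (simp add: sm_functor.f_ass'[OF fo_functor])
next
  case (delta_ru a b)
  then show ?case by (simp add: sm_functor.f_ru'[OF fo_functor])
next
  case (delta_lu a b)
  then show ?case by (simp add: sm_functor.f_lu'[OF fo_functor])
next
  case (delta_sym a b b')
  then show ?case by (simp add: sm_functor.f_sym[OF fo_functor])
next
  case (gamma_nat f f' b)
  then show ?case
    using component[OF F.f2_nat'[of f f' "Cod A f" "Cod A f'"], of b] by (simp add: ex_ETens)
next
  case (gamma_ass a a' a'' b)
  then show ?case using component[OF F.f_ass'[of a a' a''], of b] by simp
next
  case (gamma_ru a b)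
  then show ?case using component[OF F.f_ru'[of a], of b] by simp
next
  case (gamma_lu a b)
  then show ?case using component[OF F.f_lu'[of a], of b] by simp
next
  case (gamma_sym a a' b)
  then show ?case using component[OF F.f_sym[of a a'], of b] by simp
next
  case (arr_nat f g)
  then show ?case using sm_transformation.tc_nat'[of B C "FA F f" g "Cod B g"] by simp
next
  case (arrL_unit f)
  then show ?case using sm_transformation.tc_unit[of B C "FA F f"] by simp
next
  case (arrL_tens f b b')
  then show ?case using sm_transformation.tc_tens[of B C "FA F f" b b'] by (simp add: ex_ETens)
next
  case (arrR_unit g)
  then show ?case using sm_transformation.tc_nat'[of B C "F0 F" g "Cod B g"] by simp
next
  case (arrR_tens a a' g)
  then show ?case using sm_transformation.tc_nat'[of B C "F2 F a a'" g "Cod B g"] by (simp add: ex_ETens)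
next
  case (alpha_tens b b')
  then show ?case using sm_transformation.tc_tens[of B C "F0 F" b b'] by (simp add: ex_ETens)
next
  case (beta_tens a a')
  then have "(TC (F2 F a a') (Unit B) \<cdot>\<^bsub>C\<^esub> F0 (TDom (F2 F a a'))) \<cdot>\<^bsub>C\<^esub> Ru C (Unit C)
      = F0 (TCod (F2 F a a')) \<cdot>\<^bsub>C\<^esub> Ru C (Unit C)"
    using sm_transformation.tc_unit[of B C "F2 F a a'"] by simp
  then show ?case using beta_tens by (simp add: ex_ETens)
next
  case beta_alpha
  then show ?case using sm_transformation.tc_unit[of B C "F0 F"] by simp
next
  case (gamma_delta a a' b b')
  then show ?case by (simp add: ex_ETens ex_EMid ex_gamma_delta)
qed (auto simp: ex_ETens C.merge C.ass_nat' C.ru_nat' C.lu_nat' C.sym_nat' C.pentagon' C.triangle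
    C.ru_lu_unit C.sym_unit C.hexagon')

lemma ex_cong: "tens_cong A B p q \<Longrightarrow> ex p = ex q"
proof (induction rule: tens_cong.induct)
  case (base p q)
  then show ?case by (rule ex_sound)
qed auto

lemma ex_rep: "wfe p \<Longrightarrow> ex (erep (cls p)) = ex p"
  using ex_cong[OF rep] by simp

lemma En_simps [simp]:
  "FO (En A B C F) \<in> extensional (Obj T)" "FA (En A B C F) \<in> extensional (Arr T)"
  "wf_word A B X \<Longrightarrow> FO (En A B C F) X = ew X"
  "wfe p \<Longrightarrow> FA (En A B C F) (cls p) = ex p"
  "F0 (En A B C F) = Ide C (Unit C)"
  by (simp_all add: En_def ex_rep)

lemma En_strict: "strict_functor T C (En A B C F)"
proof (rule strict_functorI, goal_cases)
  case 6
  show ?case by (auto simp: En_def intro!: restrict2_cong)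
next
  case (15 f g)
  then show ?case by (auto elim!: arrE simp: tens_cls ex_ETens)
next
  case (14 f g)
  then show ?case by (auto elim!: arrE simp: comp_cls)
qed (auto elim!: arrE simp: smc_tens C.smc_axioms cls_simps)

end

lemma bifunctorI:
  assumes "smc A" "smc B" "smc C" "sm_functor A (ihom B C) F"
  shows "bifunctor A B C F"
  using assms by (simp add: bifunctor_def smc_pair_def)

text \<open>A strict functor commutes with whiskering and with all canonical arrows, so induction on
  expressions leaves only the generators to be compared.\<close>

lemma (in smc_pair) strict_ext:
  assumes H: "strict_functor T C H" and K: "strict_functor T C K"
    and gen: "\<And>a b. \<lbrakk>a \<in> Obj A; b \<in> Obj B\<rbrakk> \<Longrightarrow> FO H (WGen a b) = FO K (WGen a b)"
    and alpha: "\<And>b. b \<in> Obj B \<Longrightarrow> FA H (cls (EAlpha b)) = FA K (cls (EAlpha b))"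
    and beta: "\<And>a. a \<in> Obj A \<Longrightarrow> FA H (cls (EBeta a)) = FA K (cls (EBeta a))"
    and gamma: "\<And>a a' b. \<lbrakk>a \<in> Obj A; a' \<in> Obj A; b \<in> Obj B\<rbrakk> \<Longrightarrow> FA H (cls (EGamma a a' b)) = FA K (cls (EGamma a a' b))"
    and delta: "\<And>a b b'. \<lbrakk>a \<in> Obj A; b \<in> Obj B; b' \<in> Obj B\<rbrakk> \<Longrightarrow> FA H (cls (EDelta a b b')) = FA K (cls (EDelta a b b'))"
    and arrL: "\<And>f b. \<lbrakk>f \<in> Arr A; b \<in> Obj B\<rbrakk> \<Longrightarrow> FA H (cls (EArrL f b)) = FA K (cls (EArrL f b))"
    and arrR: "\<And>a g. \<lbrakk>a \<in> Obj A; g \<in> Arr B\<rbrakk> \<Longrightarrow> FA H (cls (EArrR a g)) = FA K (cls (EArrR a g))"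
  shows "H = K"
proof (rule strict_eqI[OF H K])
  interpret H: sm_functor T C H using H by (rule strict_sm_functor)
  interpret K: sm_functor T C K using K by (rule strict_sm_functor)
  note sH = strict_functor_simps[OF H] and sK = strict_functor_simps[OF K]
  have w: "FO H X = FO K X" if "wf_word A B X" for X
    using that sH(3) sK(3) sH(4) sK(4) by (induction X) (auto simp: gen)
  then show "FO H X = FO K X" if "X \<in> Obj T" for X using that by simp
  have "FA H (cls p) = FA K (cls p)" if "wfe p" for p
    using that
    by (induction p) (auto simp: expand sH(5-) sK(5-) w alpha beta gamma delta arrL arrR)
  then show "FA H P = FA K P" if "P \<in> Arr T" for P
    using that by (auto elim!: arrE)
qed

section \<open>The functor \<open>Rn\<close>\<close>

lemma smt_eqI_ihom:
  assumes "sm_transformation A (ihom B C) \<sigma>" "sm_transformation A (ihom B C) \<tau>"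
    "TDom \<sigma> = TDom \<tau>" "TCod \<sigma> = TCod \<tau>"
    "\<And>a b. \<lbrakk>a \<in> Obj A; b \<in> Obj B\<rbrakk> \<Longrightarrow> TC (TC \<sigma> a) b = TC (TC \<tau> a) b"
  shows "\<sigma> = \<tau>"
proof -
  interpret s: sm_transformation A "ihom B C" \<sigma> by fact
  interpret t: sm_transformation A "ihom B C" \<tau> by fact
  show ?thesis
  proof (rule smt_eqI[OF assms(3,4) s.tc_ext t.tc_ext])
    fix a assume a: "a \<in> Obj A"
    show "TC \<sigma> a = TC \<tau> a"
      using s.tc_arr[OF a] t.tc_arr[OF a] assms a
      by (intro smt_eqI[where S = "Obj B"]) (auto intro: sm_transformation.tc_ext)
  qed
qed

lemma smf_eqI_ihom:
  assumes "bifunctor A B C F" "bifunctor A B C G"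
    and "\<And>a b. \<lbrakk>a \<in> Obj A; b \<in> Obj B\<rbrakk> \<Longrightarrow> FO (FO F a) b = FO (FO G a) b"
    and "\<And>a g. \<lbrakk>a \<in> Obj A; g \<in> Arr B\<rbrakk> \<Longrightarrow> FA (FO F a) g = FA (FO G a) g"
    and "\<And>a. a \<in> Obj A \<Longrightarrow> F0 (FO F a) = F0 (FO G a)"
    and "\<And>a b b'. \<lbrakk>a \<in> Obj A; b \<in> Obj B; b' \<in> Obj B\<rbrakk> \<Longrightarrow> F2 (FO F a) b b' = F2 (FO G a) b b'"
    and "\<And>f b. \<lbrakk>f \<in> Arr A; b \<in> Obj B\<rbrakk> \<Longrightarrow> TC (FA F f) b = TC (FA G f) b"
    and "\<And>b. b \<in> Obj B \<Longrightarrow> TC (F0 F) b = TC (F0 G) b"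
    and "\<And>a a' b. \<lbrakk>a \<in> Obj A; a' \<in> Obj A; b \<in> Obj B\<rbrakk> \<Longrightarrow> TC (F2 F a a') b = TC (F2 G a a') b"
  shows "F = G"
proof -
  interpret F: bifunctor A B C F by fact
  interpret G: bifunctor A B C G by fact
  have o: "FO F a = FO G a" if "a \<in> Obj A" for a
    using that assms by (intro smf_eqI[OF F.fo_functor G.fo_functor]) auto
  note [simp] = sm_transformation.tc_ext[where A = B and B = C]
  show ?thesis
    by (rule smf_eqI[OF F.F.sm_functor_axioms G.F.sm_functor_axioms])
      (auto intro!: smt_eqI[where S = "Obj B"] simp: o assms)
qed

text \<open>The object part of \<open>Rn\<close> without its restriction to \<open>Obj\<close>,
  named separately because most of the argument concerns single functors.\<close>

definition rn :: "('o, 'a) smcat \<Rightarrow> ('p, 'b) smcat \<Rightarrow> ('q, 'c) smcat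
    \<Rightarrow> (('o, 'p) tword, ('o, 'a, 'p, 'b) texp set, 'q, 'c) smfun
    \<Rightarrow> ('o, 'a, ('p, 'b, 'q, 'c) smfun, ('p, 'b, 'q, 'c) smtrans) smfun" where
  "rn A B C F = smf_comp A (ihom B C) (postcomp B (A \<boxtimes> B) C F) (eta A B)"

context smc_pair
begin

lemma rn_functor: "sm_functor T C H \<Longrightarrow> sm_functor A (ihom B C) (rn A B C H)"
  unfolding rn_def by (rule smf_comp_functor[OF eta_functor postcomp_functor[OF B.smc_axioms]])

lemma rn_bifunctor:
  assumes "sm_functor T C H" shows "bifunctor A B C (rn A B C H)"
  by (rule bifunctorI[OF A.smc_axioms B.smc_axioms sm_functor_smc(2)[OF assms] rn_functor[OF assms]])

lemma rn_simps:
  assumes "sm_functor T C H"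
  shows "a \<in> Obj A \<Longrightarrow> FO (rn A B C H) a = smf_comp B C H (eta_obj A B a)"
    "\<lbrakk>f \<in> Arr A; b \<in> Obj B\<rbrakk> \<Longrightarrow> TC (FA (rn A B C H) f) b = FA H (cls (EArrL f b))"
    "b \<in> Obj B \<Longrightarrow> TC (F0 (rn A B C H)) b = FA H (cls (EAlpha b)) \<cdot>\<^bsub>C\<^esub> F0 H"
    "\<lbrakk>a \<in> Obj A; a' \<in> Obj A; b \<in> Obj B\<rbrakk>
      \<Longrightarrow> TC (F2 (rn A B C H) a a') b = FA H (cls (EGamma a a' b)) \<cdot>\<^bsub>C\<^esub> F2 H (WGen a b) (WGen a' b)"
  by (simp_all add: rn_def eta_obj_functor eta_arr_transformation eta_f0_transformation eta_f2_transformation)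

text \<open>\<open>En F\<close> sends each generator to the datum of \<open>F\<close> that it stands
  for, and currying composes this only with structure maps of \<open>En F\<close>, which are
  identities.\<close>

lemma rn_En:
  assumes "bifunctor A B C F" shows "rn A B C (En A B C F) = F"
proof -
  interpret bifunctor A B C F by fact
  note s = strict_sm_functor[OF En_strict] and z = strict_functor_simps(2)[OF En_strict]
  show ?thesis
    by (rule smf_eqI_ihom[OF rn_bifunctor[OF s] assms]) (simp_all add: rn_simps[OF s] z)
qed

lemma rn_inject:
  assumes "strict_functor T C H" "strict_functor T C K" "rn A B C H = rn A B C K"
  shows "H = K"
proof -
  note sH = strict_sm_functor[OF assms(1)] and sK = strict_sm_functor[OF assms(2)]
  interpret H: sm_functor T C H by (rule sH)
  interpret K: sm_functor T C K by (rule sK)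
  have o: "smf_comp B C H (eta_obj A B a) = smf_comp B C K (eta_obj A B a)" if "a \<in> Obj A" for a
    using arg_cong[OF assms(3), of "\<lambda>F. FO F a"] that by (simp add: rn_simps sH sK)
  \<comment> \<open>Currying shows \<open>FA H (cls p)\<close> only in composition with
    \<open>F0 H\<close>. By strictness \<open>F0 H\<close> is the identity of the unit, which is the
    domain of \<open>FA H (cls p)\<close>, and so it drops out.\<close>
  have c: "FA H (cls p) = FA K (cls p)" if "FA H (cls p) \<cdot>\<^bsub>C\<^esub> F0 H = FA K (cls p) \<cdot>\<^bsub>C\<^esub> F0 K" "wfe p" "dm p = WUnit" for p
    using that H.dom_fa[of "cls p"] K.dom_fa[of "cls p"] strict_functor_simps(3)[OF assms(1)]
      strict_functor_simps(3)[OF assms(2)]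
    by (simp add: strict_functor_simps(1)[OF assms(1)] strict_functor_simps(1)[OF assms(2)])
  show ?thesis
  proof (rule strict_ext[OF assms(1,2)])
    show gen: "FO H (WGen a b) = FO K (WGen a b)" if "a \<in> Obj A" "b \<in> Obj B" for a b
      using arg_cong[OF o[OF that(1)], of "\<lambda>F. FO F b"] that by simp
    show "FA H (cls (EAlpha b)) = FA K (cls (EAlpha b))" if "b \<in> Obj B" for b
      using arg_cong[OF assms(3), of "\<lambda>F. TC (F0 F) b"] that
      by (intro c) (simp_all add: rn_simps sH sK)
    show "FA H (cls (EBeta a)) = FA K (cls (EBeta a))" if "a \<in> Obj A" for a
      using arg_cong[OF o[OF that(1)], of F0] that by (intro c) simp_all
    show "FA H (cls (EGamma a a' b)) = FA K (cls (EGamma a a' b))" if "a \<in> Obj A" "a' \<in> Obj A" "b \<in> Obj B" for a a' b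
      using arg_cong[OF assms(3), of "\<lambda>F. TC (F2 F a a') b"] that H.dom_fa[of "cls (EGamma a a' b)"] K.dom_fa[of "cls (EGamma a a' b)"]
        strict_functor_simps(4)[OF assms(1), of "WGen a b" "WGen a' b"] strict_functor_simps(4)[OF assms(2), of "WGen a b" "WGen a' b"]
      by (simp add: rn_simps sH sK strict_functor_simps[OF assms(1)] strict_functor_simps[OF assms(2)])
    show "FA H (cls (EDelta a b b')) = FA K (cls (EDelta a b b'))" if "a \<in> Obj A" "b \<in> Obj B" "b' \<in> Obj B" for a b b'
      using arg_cong[OF o[OF that(1)], of "\<lambda>F. F2 F b b'"] that H.dom_fa[of "cls (EDelta a b b')"] K.dom_fa[of "cls (EDelta a b b')"]
        strict_functor_simps(4)[OF assms(1), of "WGen a b" "WGen a b'"] strict_functor_simps(4)[OF assms(2), of "WGen a b" "WGen a b'"]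
      by (simp add: strict_functor_simps[OF assms(1)] strict_functor_simps[OF assms(2)])
    show "FA H (cls (EArrL f b)) = FA K (cls (EArrL f b))" if "f \<in> Arr A" "b \<in> Obj B" for f b
      using arg_cong[OF assms(3), of "\<lambda>F. TC (FA F f) b"] that by (simp add: rn_simps sH sK)
    show "FA H (cls (EArrR a g)) = FA K (cls (EArrR a g))" if "a \<in> Obj A" "g \<in> Arr B" for a g
      using arg_cong[OF o[OF that(1)], of "\<lambda>F. FA F g"] that by simp
  qed
qed

text \<open>Comes from functoriality of \<open>postcomp B\<close> and associativity of
  composition.\<close>

lemma rn_comp:
  assumes "sm_functor T C H" "sm_functor C D G"
  shows "rn A B D (smf_comp T D G H) = smf_comp A (ihom B D) (postcomp B C D G) (rn A B C H)"
  unfolding rn_def postcomp_comp[OF B.smc_axioms assms]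
  by (rule smf_comp_assoc[OF eta_functor postcomp_functor[OF B.smc_axioms assms(1)]
    postcomp_functor[OF B.smc_axioms assms(2)], symmetric])

end

section \<open>Strictness and naturality of currying\<close>

lemma inv_ru_ihom:
  assumes "sm_functor A B F"
  shows "inv_arr (ihom A B) (Ru (ihom A B) F)
    = \<lparr> TDom = F, TCod = fun_tens A B F (const_unit A B), TC = (\<lambda>x \<in> Obj A. inv_arr B (Ru B (FO F x))) \<rparr>"
proof -
  interpret F: sm_functor A B F by fact
  show ?thesis
    by (subst inv_arr_ihom[OF ru_transformation[OF assms]]) (simp_all cong: restrict_cong)
qed

lemma inv_ass_ihom:
  assumes "sm_functor A B F" "sm_functor A B G" "sm_functor A B H"
  shows "inv_arr (ihom A B) (Ass (ihom A B) F G H)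
    = \<lparr> TDom = fun_tens A B (fun_tens A B F G) H, TCod = fun_tens A B F (fun_tens A B G H),
        TC = (\<lambda>x \<in> Obj A. inv_arr B (Ass B (FO F x) (FO G x) (FO H x))) \<rparr>"
proof -
  interpret F: sm_functor A B F by fact
  interpret G: sm_functor A B G by fact
  interpret H: sm_functor A B H by fact
  show ?thesis
    by (subst inv_arr_ihom[OF ass_transformation[OF assms]]) (simp_all cong: restrict_cong)
qed

text \<open>Needed for tensors of functors with values in \<open>ihom B C\<close>, whose
  \<open>F2\<close> contains the interchange of that internal hom.\<close>

lemma mid_ihom:
  assumes "sm_functor A B F" "sm_functor A B G" "sm_functor A B H" "sm_functor A B K" "x \<in> Obj A"
  shows "TC (mid (ihom A B) F G H K) x = mid B (FO F x) (FO G x) (FO H x) (FO K x)"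
  using assms by (simp add: mid_def inv_ass_ihom fun_tens_functor)

context smc_pair
begin

lemma rn_const_unit:
  assumes "smc C" shows "rn A B C (const_unit T C) = const_unit A (ihom B C)"
proof -
  interpret C: smc C by fact
  note c = const_unit_functor[OF smc_tens C.smc_axioms]
  have "bifunctor A B C (const_unit A (ihom B C))"
    by (intro bifunctorI const_unit_functor smc_ihom) unfold_locales
  then show ?thesis
    by (intro smf_eqI_ihom[OF rn_bifunctor[OF c]]) (simp_all add: rn_simps[OF c])
qed

text \<open>The tensor of functors is pointwise, whether evaluated at the word
  \<open>WGen a b\<close> or at \<open>a\<close> and then at \<open>b\<close>. Strictness of
  \<open>Rn\<close> requires this as an equality of records.\<close>

lemma rn_fun_tens:
  assumes "sm_functor T C F" "sm_functor T C G"
  shows "rn A B C (fun_tens T C F G) = fun_tens A (ihom B C) (rn A B C F) (rn A B C G)"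
proof -
  interpret C: smc C by (rule sm_functor_smc[OF assms(1)])
  interpret F: sm_functor T C F by fact
  interpret G: sm_functor T C G by fact
  note c = fun_tens_functor[OF assms]
  interpret rF: bifunctor A B C "rn A B C F" by (rule rn_bifunctor) fact
  interpret rG: bifunctor A B C "rn A B C G" by (rule rn_bifunctor) fact
  have "bifunctor A B C (fun_tens A (ihom B C) (rn A B C F) (rn A B C G))"
    using rn_functor[OF assms(1)] rn_functor[OF assms(2)]
    by (intro bifunctorI fun_tens_functor) unfold_locales
  then show ?thesis
    by (intro smf_eqI_ihom[OF rn_bifunctor[OF c]])
      (simp_all add: rn_simps assms c smf_comp_functor[OF eta_obj_functor] C.merge C.merge_r inv_ru_ihom
        const_unit_functor B.smc_axioms C.smc_axioms mid_ihom rF.fo_functor rG.fo_functor)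
qed

end

context smc_pair
begin

lemma Rn_simps:
  "FO (Rn A B C) \<in> extensional (Obj (ihom T C))" "FA (Rn A B C) \<in> extensional (Arr (ihom T C))"
  "sm_functor T C H \<Longrightarrow> FO (Rn A B C) H = rn A B C H"
  "sm_transformation T C \<sigma> \<Longrightarrow> FA (Rn A B C) \<sigma> = whisker_trans A (ihom B C) (postcomp_trans B T C \<sigma>) (eta A B)"
  "F0 (Rn A B C) = Ide (ihom A (ihom B C)) (const_unit A (ihom B C))"
  by (simp_all add: Rn_def rn_def Let_def)

lemma FA_Rn_transformation:
  "sm_transformation T C \<sigma> \<Longrightarrow> sm_transformation A (ihom B C) (FA (Rn A B C) \<sigma>)"
  by (simp add: Rn_simps whisker_trans_transformation[OF postcomp_trans_transformation[OF B.smc_axioms] eta_functor])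

lemma FA_Rn_simps:
  assumes "sm_transformation T C \<sigma>"
  shows "TDom (FA (Rn A B C) \<sigma>) = rn A B C (TDom \<sigma>)" "TCod (FA (Rn A B C) \<sigma>) = rn A B C (TCod \<sigma>)"
    "a \<in> Obj A \<Longrightarrow> TC (FA (Rn A B C) \<sigma>) a = whisker_trans B C \<sigma> (eta_obj A B a)"
  using assms by (simp_all add: Rn_simps rn_def eta_obj_functor)

lemma Rn_strict:
  assumes "smc C" shows "strict_functor (ihom T C) (ihom A (ihom B C)) (Rn A B C)"
proof -
  interpret C: smc C by fact
  interpret BC: smc "ihom B C" by (rule smc_ihom) unfold_locales
  interpret TC: smc "ihom T C" by (rule smc_ihom) unfold_locales
  interpret ABC: smc "ihom A (ihom B C)" by (rule smc_ihom) unfold_locales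
  note [simp] = rn_const_unit[OF assms] rn_fun_tens rn_functor FA_Rn_transformation FA_Rn_simps Rn_simps(1-3,5)
    ihom_rules[where A = T and B = C] fun_tens_functor
    const_unit_functor[OF smc_tens C.smc_axioms] const_unit_functor[OF A.smc_axioms BC.smc_axioms]
    eta_obj_functor rn_simps(1) smf_comp_functor[OF eta_obj_functor]
    ihom_rules[where A = A and B = "ihom B C"]
  show ?thesis
  proof (rule strict_functorI, goal_cases)
    case 6
    show ?case by (auto simp: Rn_def rn_def Let_def intro!: restrict2_cong)
  qed (auto simp: TC.smc_axioms ABC.smc_axioms intro!: smt_eqI_ihom[where A = A and B = B and C = C])
qed

end

text \<open>Objects are compared as whole functors, since this also makes the sources and targets of
  the 2-cells agree; the 2-cells themselves are then compared at double components.\<close>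

lemma smf_eqI_ihom2:
  assumes F: "sm_functor X (ihom A (ihom B C)) F" and G: "sm_functor X (ihom A (ihom B C)) G"
    and o: "\<And>x. x \<in> Obj X \<Longrightarrow> FO F x = FO G x"
    and "\<And>f a b. \<lbrakk>f \<in> Arr X; a \<in> Obj A; b \<in> Obj B\<rbrakk> \<Longrightarrow> TC (TC (FA F f) a) b = TC (TC (FA G f) a) b"
    and "\<And>a b. \<lbrakk>a \<in> Obj A; b \<in> Obj B\<rbrakk> \<Longrightarrow> TC (TC (F0 F) a) b = TC (TC (F0 G) a) b"
    and "\<And>x y a b. \<lbrakk>x \<in> Obj X; y \<in> Obj X; a \<in> Obj A; b \<in> Obj B\<rbrakk>
      \<Longrightarrow> TC (TC (F2 F x y) a) b = TC (TC (F2 G x y) a) b"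
  shows "F = G"
proof -
  interpret X: smc X by (rule sm_functor_smc[OF F])
  interpret F: sm_functor X "ihom A (ihom B C)" F by fact
  interpret G: sm_functor X "ihom A (ihom B C)" G by fact
  show ?thesis
  proof (rule smf_eqI[OF F G o])
    show "FA F f = FA G f" if "f \<in> Arr X" for f
      using F.fa_arr[OF that] F.dom_fa[OF that] F.cod_fa[OF that]
        G.fa_arr[OF that] G.dom_fa[OF that] G.cod_fa[OF that] that
      by (intro smt_eqI_ihom[of A B C]) (simp_all add: o assms)
    show "F0 F = F0 G"
      using F.f0_arr G.f0_arr by (intro smt_eqI_ihom[of A B C]) (simp_all add: o assms)
    show "F2 F x y = F2 G x y" if "x \<in> Obj X" "y \<in> Obj X" for x y
      using F.f2_arr[OF that] G.f2_arr[OF that] that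
      by (intro smt_eqI_ihom[of A B C]) (simp_all add: o assms)
  qed
qed

lemma smt_eqI_ihom2:
  assumes "sm_transformation A (ihom B (ihom C D)) \<sigma>" "sm_transformation A (ihom B (ihom C D)) \<tau>"
    "TDom \<sigma> = TDom \<tau>" "TCod \<sigma> = TCod \<tau>"
    "\<And>a b c. \<lbrakk>a \<in> Obj A; b \<in> Obj B; c \<in> Obj C\<rbrakk> \<Longrightarrow> TC (TC (TC \<sigma> a) b) c = TC (TC (TC \<tau> a) b) c"
  shows "\<sigma> = \<tau>"
proof -
  interpret s: sm_transformation A "ihom B (ihom C D)" \<sigma> by fact
  interpret t: sm_transformation A "ihom B (ihom C D)" \<tau> by fact
  show ?thesis
  proof (rule smt_eqI[OF assms(3,4) s.tc_ext t.tc_ext])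
    fix a assume a: "a \<in> Obj A"
    show "TC \<sigma> a = TC \<tau> a"
      using s.tc_arr[OF a] t.tc_arr[OF a] assms a
      by (intro smt_eqI_ihom[of B C D]) auto
  qed
qed

context smc_pair
begin

lemma Rn_functor: "smc C \<Longrightarrow> sm_functor (ihom T C) (ihom A (ihom B C)) (Rn A B C)"
  by (rule strict_sm_functor[OF Rn_strict])

text \<open>On objects this is \<open>rn_comp\<close>. On 2-cells and structure maps both sides have
  the same double components, because the structure maps of \<open>Rn\<close> are
  identities.\<close>

lemma Rn_natural:
  assumes "sm_functor C D H"
  shows "smf_comp (ihom T C) (ihom A (ihom B D)) (postcomp A (ihom B C) (ihom B D) (postcomp B C D H)) (Rn A B C)
    = smf_comp (ihom T C) (ihom A (ihom B D)) (Rn A B D) (postcomp T C D H)" (is "?L = ?R")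
proof -
  interpret C: smc C by (rule sm_functor_smc[OF assms])
  interpret D: smc D by (rule sm_functor_smc[OF assms])
  interpret BC: smc "ihom B C" by (rule smc_ihom) unfold_locales
  interpret H: sm_functor C D H by fact
  note BH = postcomp_functor[OF B.smc_axioms assms]
  note [simp] = rn_functor Rn_simps(3,5) FA_Rn_transformation FA_Rn_simps rn_simps(1)
    smf_comp_functor[OF eta_obj_functor] eta_obj_functor postcomp_trans_transformation[OF B.smc_axioms]
    whisker_fun_transformation[OF _ assms] whisker_fun_transformation[OF _ BH]
    whisker_trans_transformation[OF _ eta_obj_functor] eta_functor
    smf_comp_functor[OF _ assms] fun_tens_functor postcomp_f0_transformation[OF smc_tens assms]
    postcomp_f2_transformation[OF _ _ assms] const_unit_functor[OF A.smc_axioms BC.smc_axioms]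
    const_unit_functor[OF B.smc_axioms C.smc_axioms] sm_functor.fo_obj[where A = T and B = C]
    sm_functor.ide_transformation[where A = A and B = "ihom B C"]
    sm_functor.ide_transformation[where A = B and B = C]
  have z: "F2 (Rn A B C) F G = Ide (ihom A (ihom B C)) (fun_tens A (ihom B C) (rn A B C F) (rn A B C G))"
    if "sm_functor T C F" "sm_functor T C G" for F G
    using that strict_functor_simps(2)[OF Rn_strict[OF C.smc_axioms], of F G] by simp
  have z': "F2 (Rn A B D) F G = Ide (ihom A (ihom B D)) (fun_tens A (ihom B D) (rn A B D F) (rn A B D G))"
    if "sm_functor T D F" "sm_functor T D G" for F G
    using that strict_functor_simps(2)[OF Rn_strict[OF D.smc_axioms], of F G] by simp
  show ?thesis
  proof (rule smf_eqI_ihom2)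
    show "sm_functor (ihom T C) (ihom A (ihom B D)) ?L"
      by (rule smf_comp_functor[OF Rn_functor postcomp_functor[OF A.smc_axioms BH]]) unfold_locales
    show "sm_functor (ihom T C) (ihom A (ihom B D)) ?R"
      by (rule smf_comp_functor[OF postcomp_functor[OF smc_tens assms] Rn_functor]) unfold_locales
    show "FO ?L F = FO ?R F" if "F \<in> Obj (ihom T C)" for F
      using that by (simp add: rn_comp[OF _ assms])
  qed (simp_all add: z z')
qed

end

section \<open>The associativity arrow\<close>

lemmas smc_tensor [simp] = smc_pair.smc_tens[OF smc_pair.intro]
lemmas eta_sm_functor [simp] = smc_pair.eta_functor[OF smc_pair.intro]
lemmas rn_sm_functor [simp] = smc_pair.rn_functor[OF smc_pair.intro]
lemmas rn_compose = smc_pair.rn_comp[OF smc_pair.intro]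
lemmas rn_of_En = smc_pair.rn_En[OF smc_pair.intro bifunctorI]
lemmas rn_injective = smc_pair.rn_inject[OF smc_pair.intro]
lemmas Rn_sm_functor [simp] = smc_pair.Rn_functor[OF smc_pair.intro]
lemmas Rn_strict_functor = smc_pair.Rn_strict[OF smc_pair.intro]
lemmas Rn_naturality = smc_pair.Rn_natural[OF smc_pair.intro]
lemmas En_strict_functor = bifunctor.En_strict[OF bifunctorI]

declare smc_ihom [simp] postcomp_functor [simp] smf_comp_functor [simp]

text \<open>The functor \<open>K\<close> in the definition of the associativity arrow.\<close>

definition
  "curried_assoc A B C =
    smf_comp A (ihom B (ihom C (A \<boxtimes> (B \<boxtimes> C)))) (Rn B C (A \<boxtimes> (B \<boxtimes> C))) (eta A (B \<boxtimes> C))"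

lemma curried_assoc_functor [simp]:
  assumes [simp]: "smc A" "smc B" "smc C"
  shows "sm_functor A (ihom B (ihom C (A \<boxtimes> (B \<boxtimes> C)))) (curried_assoc A B C)"
  unfolding curried_assoc_def by (rule smf_comp_functor[OF eta_sm_functor Rn_sm_functor]) simp_all

text \<open>By naturality of \<open>Rn\<close>. The left-hand side is what two curryings make of
  \<open>f\<close> after an associativity arrow; on the right that arrow is gone, and only
  \<open>Rn\<close> and the curried \<open>f\<close> remain.\<close>

lemma curried_assoc_natural:
  assumes [simp]: "smc A" "smc B" "smc C" and f: "sm_functor (A \<boxtimes> (B \<boxtimes> C)) Z f"
  shows "smf_comp A (ihom B (ihom C Z))
      (postcomp B (ihom C (A \<boxtimes> (B \<boxtimes> C))) (ihom C Z) (postcomp C (A \<boxtimes> (B \<boxtimes> C)) Z f)) (curried_assoc A B C)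
    = smf_comp A (ihom B (ihom C Z)) (Rn B C Z) (rn A (B \<boxtimes> C) Z f)"
proof -
  let ?Y = "A \<boxtimes> (B \<boxtimes> C)"
  have [simp]: "smc Z" using sm_functor_smc[OF f] by simp
  note e = eta_sm_functor[of A "B \<boxtimes> C"]
  note p = postcomp_functor[OF \<open>smc C\<close> f]
  show ?thesis
    unfolding curried_assoc_def rn_def
    by (simp add: smf_comp_assoc[OF e Rn_sm_functor postcomp_functor[OF _ p]]
        smf_comp_assoc[OF e postcomp_functor[OF _ f] Rn_sm_functor] Rn_naturality[OF _ _ f])
qed

lemma assoc_fun_eq: "assoc_fun A B C = En (A \<boxtimes> B) C (A \<boxtimes> (B \<boxtimes> C))
    (En A B (ihom C (A \<boxtimes> (B \<boxtimes> C))) (curried_assoc A B C))"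
  by (simp add: assoc_fun_def curried_assoc_def Let_def)

context
  fixes A :: "('o, 'a) smcat" and B :: "('p, 'b) smcat" and C :: "('q, 'c) smcat"
  assumes smc [simp]: "smc A" "smc B" "smc C"
begin

lemma En_curried_assoc_functor: "sm_functor (A \<boxtimes> B) (ihom C (A \<boxtimes> (B \<boxtimes> C)))
    (En A B (ihom C (A \<boxtimes> (B \<boxtimes> C))) (curried_assoc A B C))"
  by (rule strict_sm_functor[OF En_strict_functor]) simp_all

lemma strict_assoc: "strict_functor ((A \<boxtimes> B) \<boxtimes> C) (A \<boxtimes> (B \<boxtimes> C)) (assoc_fun A B C)"
  unfolding assoc_fun_eq by (rule En_strict_functor) (simp_all add: En_curried_assoc_functor)

lemma assoc_functor [simp]: "sm_functor ((A \<boxtimes> B) \<boxtimes> C) (A \<boxtimes> (B \<boxtimes> C)) (assoc_fun A B C)"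
  by (rule strict_sm_functor[OF strict_assoc])

lemma rn_assoc: "rn (A \<boxtimes> B) C (A \<boxtimes> (B \<boxtimes> C)) (assoc_fun A B C)
    = En A B (ihom C (A \<boxtimes> (B \<boxtimes> C))) (curried_assoc A B C)"
  unfolding assoc_fun_eq by (rule rn_of_En) (simp_all add: En_curried_assoc_functor)

text \<open>Each currying undoes one of the two \<open>En\<close> in the associativity
  arrow.\<close>

lemma rn_rn_assoc:
  "rn A B (ihom C (A \<boxtimes> (B \<boxtimes> C))) (rn (A \<boxtimes> B) C (A \<boxtimes> (B \<boxtimes> C)) (assoc_fun A B C)) = curried_assoc A B C"
  unfolding rn_assoc by (rule rn_of_En) simp_all

text \<open>Locates the components of a 2-cell whiskered with the associativity arrow, as needed on
  the arrows in \<open>curry_assoc\<close>.\<close>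

lemma assoc_gen:
  assumes "a \<in> Obj A" "b \<in> Obj B" "c \<in> Obj C"
  shows "FO (assoc_fun A B C) (WGen (WGen a b) c) = WGen a (WGen b c)"
proof -
  let ?X = "A \<boxtimes> (B \<boxtimes> C)"
  interpret AB: smc_pair A B by (intro smc_pair.intro smc)
  interpret BC: smc_pair B C by (intro smc_pair.intro smc)
  interpret ABC: smc_pair A "B \<boxtimes> C" by (intro smc_pair.intro smc smc_tensor)
  interpret X: bifunctor A B "ihom C ?X" "curried_assoc A B C" by (rule bifunctorI) simp_all
  interpret Y: bifunctor "A \<boxtimes> B" C ?X "En A B (ihom C ?X) (curried_assoc A B C)"
    by (rule bifunctorI) (simp_all add: En_curried_assoc_functor)
  show ?thesis
    using assms unfolding assoc_fun_eq
    by simp (simp add: curried_assoc_def BC.Rn_simps BC.rn_simps ABC.eta_obj_functor)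
qed

text \<open>An equality of functors in a variable functor \<open>H\<close> out of
  \<open>A \<boxtimes> (B \<boxtimes> C)\<close>, and not only of their values at one
  \<open>H\<close>: in the theorem they are composed with \<open>eta\<close>, whose values on arrows
  and whose structure maps are 2-cells.\<close>

lemma curry_assoc:
  assumes [simp]: "smc Z"
  defines "P \<equiv> ihom (A \<boxtimes> (B \<boxtimes> C)) Z" and "Q \<equiv> ihom A (ihom B (ihom C Z))"
  shows "smf_comp P Q (Rn A B (ihom C Z)) (smf_comp P (ihom (A \<boxtimes> B) (ihom C Z)) (Rn (A \<boxtimes> B) C Z)
      (precomp ((A \<boxtimes> B) \<boxtimes> C) (A \<boxtimes> (B \<boxtimes> C)) Z (assoc_fun A B C)))
    = smf_comp P Q (postcomp A (ihom (B \<boxtimes> C) Z) (ihom B (ihom C Z)) (Rn B C Z)) (Rn A (B \<boxtimes> C) Z)"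
    (is "?L = ?R")
proof -
  let ?X = "A \<boxtimes> (B \<boxtimes> C)"
  interpret AB: smc_pair A B by (intro smc_pair.intro smc)
  interpret BC: smc_pair B C by (intro smc_pair.intro smc)
  interpret ABC: smc_pair A "B \<boxtimes> C" by (intro smc_pair.intro smc smc_tensor)
  interpret AB_C: smc_pair "A \<boxtimes> B" C by (intro smc_pair.intro smc smc_tensor)
  have L: "strict_functor P Q ?L"
    unfolding P_def Q_def
    by (rule strict_comp[OF strict_comp[OF strict_precomp Rn_strict_functor] Rn_strict_functor]) simp_all
  have R: "strict_functor P Q ?R"
    unfolding P_def Q_def
    by (rule strict_comp[OF Rn_strict_functor strict_postcomp[OF _ Rn_strict_functor]]) simp_all
  have o: "FO ?L H = FO ?R H" if "H \<in> Obj P" for H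
  proof -
    have H [simp]: "sm_functor ?X Z H" using that by (simp add: P_def)
    have "FO ?L H = rn A B (ihom C Z) (rn (A \<boxtimes> B) C Z (smf_comp ((A \<boxtimes> B) \<boxtimes> C) Z H (assoc_fun A B C)))"
      by (simp add: P_def AB.Rn_simps AB_C.Rn_simps smf_comp_functor[OF assoc_functor H])
    also have "\<dots> = smf_comp A (ihom B (ihom C Z)) (postcomp B (ihom C ?X) (ihom C Z) (postcomp C ?X Z H)) (curried_assoc A B C)"
      by (subst rn_compose[OF _ _ assoc_functor H], simp, simp)
        (subst rn_compose[OF _ _ rn_sm_functor postcomp_functor[OF _ H]], simp_all add: rn_rn_assoc)
    also have "\<dots> = FO ?R H"
      using curried_assoc_natural[OF smc H]
      by (simp add: P_def ABC.Rn_simps)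
    finally show ?thesis .
  qed
  show ?thesis
  proof (rule strict_eqI[OF L R o])
    interpret L: sm_functor P Q ?L by (rule strict_sm_functor[OF L])
    interpret R: sm_functor P Q ?R by (rule strict_sm_functor[OF R])
    fix \<sigma> assume s: "\<sigma> \<in> Arr P"
    then have [simp]: "sm_transformation ?X Z \<sigma>" by (simp add: P_def)
    show "FA ?L \<sigma> = FA ?R \<sigma>"
    proof (rule smt_eqI_ihom2)
      show "sm_transformation A (ihom B (ihom C Z)) (FA ?L \<sigma>)" "sm_transformation A (ihom B (ihom C Z)) (FA ?R \<sigma>)"
        using L.fa_arr[OF s] R.fa_arr[OF s] by (simp_all add: Q_def)
      show "TDom (FA ?L \<sigma>) = TDom (FA ?R \<sigma>)" "TCod (FA ?L \<sigma>) = TCod (FA ?R \<sigma>)"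
        using L.dom_fa[OF s] R.dom_fa[OF s] o[OF L.A.dom_obj[OF s]]
          L.cod_fa[OF s] R.cod_fa[OF s] o[OF L.A.cod_obj[OF s]] by (simp_all add: Q_def)
      \<comment> \<open>Both sides are the component of \<sigma> at the word
        \<open>WGen a (WGen b c)\<close>.\<close>
      show "TC (TC (TC (FA ?L \<sigma>) a) b) c = TC (TC (TC (FA ?R \<sigma>) a) b) c"
        if "a \<in> Obj A" "b \<in> Obj B" "c \<in> Obj C" for a b c
        using that
        by (simp add: P_def AB.FA_Rn_simps AB_C.FA_Rn_simps BC.FA_Rn_simps ABC.FA_Rn_simps AB_C.FA_Rn_transformation
            ABC.FA_Rn_transformation whisker_trans_transformation[OF _ assoc_functor]
            whisker_trans_transformation[OF _ ABC.eta_obj_functor] assoc_gen)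
    qed
  qed
qed

end

section \<open>Currying the tensor of 1-cells\<close>

lemma strict_tens_fun_id:
  assumes "smc A" "smc B" "smc C" "sm_functor A C F"
  shows "strict_functor (A \<boxtimes> B) (C \<boxtimes> B) (tens_fun_id A B C F)"
    and "rn A B (C \<boxtimes> B) (tens_fun_id A B C F) = smf_comp A (ihom B (C \<boxtimes> B)) (eta C B) F"
proof -
  note e = smf_comp_functor[OF assms(4) eta_sm_functor[OF assms(3,2)]]
  show "strict_functor (A \<boxtimes> B) (C \<boxtimes> B) (tens_fun_id A B C F)"
    unfolding tens_fun_id_def using assms e by (intro En_strict_functor) simp_all
  show "rn A B (C \<boxtimes> B) (tens_fun_id A B C F) = smf_comp A (ihom B (C \<boxtimes> B)) (eta C B) F"
    unfolding tens_fun_id_def using assms e by (intro rn_of_En) simp_all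
qed

lemma strict_tens_id_fun:
  assumes "smc A" "smc B" "smc D" "sm_functor B D G"
  shows "strict_functor (A \<boxtimes> B) (A \<boxtimes> D) (tens_id_fun A B D G)"
    and "rn A B (A \<boxtimes> D) (tens_id_fun A B D G)
      = smf_comp A (ihom B (A \<boxtimes> D)) (precomp B D (A \<boxtimes> D) G) (eta A D)"
proof -
  note e = smf_comp_functor[OF eta_sm_functor[OF assms(1,3)] strict_sm_functor[OF strict_precomp[OF assms(4)]]]
  show "strict_functor (A \<boxtimes> B) (A \<boxtimes> D) (tens_id_fun A B D G)"
    unfolding tens_id_fun_def using assms e by (intro En_strict_functor) simp_all
  show "rn A B (A \<boxtimes> D) (tens_id_fun A B D G)
      = smf_comp A (ihom B (A \<boxtimes> D)) (precomp B D (A \<boxtimes> D) G) (eta A D)"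
    unfolding tens_id_fun_def using assms e by (intro rn_of_En) simp_all
qed

theorem lemma19p9:
  fixes A :: "('o1, 'a1) smcat" and B :: "('o2, 'a2) smcat"
    and C :: "('o3, 'a3) smcat" and D :: "('o4, 'a4) smcat"
  assumes "smc A" and "smc B" and "smc C" and "smc D"
  defines "S \<equiv> ((A \<boxtimes> B) \<boxtimes> C) \<boxtimes> D"
    and "T \<equiv> A \<boxtimes> (B \<boxtimes> (C \<boxtimes> D))"
  defines "lhs \<equiv> smf_comp S T (assoc_fun A B (C \<boxtimes> D)) (assoc_fun (A \<boxtimes> B) C D)"
    and "rhs \<equiv> smf_comp S T (tens_id_fun A ((B \<boxtimes> C) \<boxtimes> D) (B \<boxtimes> (C \<boxtimes> D)) (assoc_fun B C D))
                 (smf_comp S (A \<boxtimes> ((B \<boxtimes> C) \<boxtimes> D)) (assoc_fun A (B \<boxtimes> C) D)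
                   (tens_fun_id ((A \<boxtimes> B) \<boxtimes> C) D (A \<boxtimes> (B \<boxtimes> C)) (assoc_fun A B C)))"
  shows "sm_functor S T lhs \<and> sm_functor S T rhs \<and> lhs = rhs"
proof -
  note [simp] = assms(1-4)
  let ?AB = "A \<boxtimes> B" and ?BC = "B \<boxtimes> C" and ?CD = "C \<boxtimes> D"
  let ?ABC = "?AB \<boxtimes> C" and ?U = "?AB \<boxtimes> ?CD" and ?V = "A \<boxtimes> (?BC \<boxtimes> D)" and ?W = "(A \<boxtimes> ?BC) \<boxtimes> D"
  let ?DT = "ihom D T" and ?CDT = "ihom C (ihom D T)"
  define f1 where "f1 = assoc_fun ?AB C D"
  define f2 where "f2 = assoc_fun A B ?CD"
  define a where "a = assoc_fun A B C"
  define g1 where "g1 = tens_fun_id ?ABC D (A \<boxtimes> ?BC) a"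
  define g2 where "g2 = assoc_fun A ?BC D"
  define g3 where "g3 = tens_id_fun A (?BC \<boxtimes> D) (B \<boxtimes> ?CD) (assoc_fun B C D)"
  have T [simp]: "smc T" by (simp add: T_def)
  have sf1: "strict_functor S ?U f1" unfolding f1_def S_def by (rule strict_assoc) simp_all
  have sf2: "strict_functor ?U T f2" unfolding f2_def T_def by (rule strict_assoc) simp_all
  have sa: "sm_functor ?ABC (A \<boxtimes> ?BC) a" unfolding a_def by simp
  have sg1: "strict_functor S ?W g1" unfolding g1_def S_def by (rule strict_tens_fun_id) (simp_all add: sa)
  have sg2: "strict_functor ?W ?V g2" unfolding g2_def by (rule strict_assoc) simp_all
  have sg3: "strict_functor ?V T g3" unfolding g3_def T_def by (rule strict_tens_id_fun) simp_all
  note f1 = strict_sm_functor[OF sf1] and f2 = strict_sm_functor[OF sf2] and g1 = strict_sm_functor[OF sg1]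
    and g2 = strict_sm_functor[OF sg2] and g3 = strict_sm_functor[OF sg3]
  have lhs: "lhs = smf_comp S T f2 f1" by (simp add: lhs_def f1_def f2_def)
  have rhs: "rhs = smf_comp S T g3 (smf_comp S ?V g2 g1)" by (simp add: rhs_def g1_def g2_def g3_def a_def)
  have sl: "strict_functor S T lhs" unfolding lhs by (rule strict_comp[OF sf1 sf2])
  have sr: "strict_functor S T rhs" unfolding rhs by (rule strict_comp[OF strict_comp[OF sg1 sg2] sg3])

  \<comment> \<open>Left-hand side: currying moves \<open>f2\<close> outside as
    \<open>[D, f2]\<close>, so that it is \<open>f1\<close> alone whose curried form has to be
    found.\<close>
  define pf2 where "pf2 = postcomp D ?U T f2"
  have pf2: "strict_functor (ihom D ?U) ?DT pf2" unfolding pf2_def by (rule strict_postcomp[OF _ sf2]) simp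
  define e1 where "e1 = rn ?ABC D ?U f1"
  have l1: "rn ?ABC D T lhs = smf_comp ?ABC ?DT pf2 e1"
    unfolding lhs S_def pf2_def e1_def by (rule rn_compose) (use f1 f2 in \<open>simp_all add: S_def\<close>)
  have se1: "strict_functor ?ABC (ihom D ?U) e1"
    unfolding e1_def f1_def rn_assoc[OF smc_tensor[OF assms(1,2)] assms(3,4)] by (rule En_strict_functor) simp_all
  \<comment> \<open>Strictness here and in \<open>sl2\<close> is what permits undoing the curryings
    at the end.\<close>
  have sl1: "strict_functor ?ABC ?DT (rn ?ABC D T lhs)"
    unfolding l1 by (rule strict_comp[OF se1 pf2])
  have "rn ?AB C ?DT (rn ?ABC D T lhs) = smf_comp ?AB ?CDT (postcomp C (ihom D ?U) ?DT pf2) (rn ?AB C (ihom D ?U) e1)"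
    unfolding l1 by (rule rn_compose) (simp_all add: strict_sm_functor[OF se1] strict_sm_functor[OF pf2])
  also have "rn ?AB C (ihom D ?U) e1 = curried_assoc ?AB C D"
    unfolding e1_def f1_def by (rule rn_rn_assoc) simp_all
  \<comment> \<open>With \<open>f1\<close> fully curried, \<open>[C, [D, f2]]\<close> after it
    becomes \<open>Rn\<close> after the curried \<open>f2\<close>; the only associativity arrow left
    is \<open>f2\<close>.\<close>
  also have "smf_comp ?AB ?CDT (postcomp C (ihom D ?U) ?DT pf2) (curried_assoc ?AB C D)
      = smf_comp ?AB ?CDT (Rn C D T) (rn ?AB ?CD T f2)"
    unfolding pf2_def by (rule curried_assoc_natural) (simp_all add: f2)
  finally have l2: "rn ?AB C ?DT (rn ?ABC D T lhs) = smf_comp ?AB ?CDT (Rn C D T) (rn ?AB ?CD T f2)" .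
  have sf2': "strict_functor ?AB (ihom ?CD T) (rn ?AB ?CD T f2)"
    unfolding f2_def T_def rn_assoc[OF assms(1,2) smc_tensor[OF assms(3,4)]] by (rule En_strict_functor) simp_all
  have sl2: "strict_functor ?AB ?CDT (rn ?AB C ?DT (rn ?ABC D T lhs))"
    unfolding l2 by (rule strict_comp[OF sf2' Rn_strict_functor]) simp_all
  have "rn A B ?CDT (rn ?AB C ?DT (rn ?ABC D T lhs))
      = smf_comp A (ihom B ?CDT) (postcomp B (ihom ?CD T) ?CDT (Rn C D T)) (rn A B (ihom ?CD T) (rn ?AB ?CD T f2))"
    unfolding l2 by (rule rn_compose[OF _ _ strict_sm_functor[OF sf2']]) simp_all
  also have "rn A B (ihom ?CD T) (rn ?AB ?CD T f2) = curried_assoc A B ?CD"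
    unfolding f2_def T_def by (rule rn_rn_assoc) simp_all
  finally have l3: "rn A B ?CDT (rn ?AB C ?DT (rn ?ABC D T lhs))
      = smf_comp A (ihom B ?CDT) (postcomp B (ihom ?CD T) ?CDT (Rn C D T)) (curried_assoc A B ?CD)" .

  define pg3 where "pg3 = postcomp D ?V T g3"
  have spg3: "strict_functor (ihom D ?V) ?DT pg3" unfolding pg3_def by (rule strict_postcomp[OF _ sg3]) simp
  define e2 where "e2 = rn (A \<boxtimes> ?BC) D ?V g2"
  have se2: "strict_functor (A \<boxtimes> ?BC) (ihom D ?V) e2"
    unfolding e2_def g2_def rn_assoc[OF assms(1) smc_tensor[OF assms(2,3)] assms(4)]
    by (rule En_strict_functor) simp_all
  \<comment> \<open>The curried composite of \<open>g2\<close> and \<open>g3\<close>. With it the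
    curried right-hand side becomes \<open>k\<close> after \<open>a\<close>, again a functor
    following an associativity arrow.\<close>
  define k where "k = smf_comp (A \<boxtimes> ?BC) ?DT pg3 e2"
  have sk: "strict_functor (A \<boxtimes> ?BC) ?DT k" unfolding k_def by (rule strict_comp[OF se2 spg3])
  have "rn ?ABC D T rhs = smf_comp ?ABC ?DT pg3 (rn ?ABC D ?V (smf_comp S ?V g2 g1))"
    unfolding rhs S_def pg3_def
    by (rule rn_compose[OF _ _ smf_comp_functor[OF g1[unfolded S_def] g2] g3]) simp_all
  also have "rn ?ABC D ?V (smf_comp S ?V g2 g1) = smf_comp ?ABC (ihom D ?V) (postcomp D ?W ?V g2) (rn ?ABC D ?W g1)"
    unfolding S_def by (rule rn_compose[OF _ _ g1[unfolded S_def] g2]) simp_all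
  also have "rn ?ABC D ?W g1 = smf_comp ?ABC (ihom D ?W) (eta (A \<boxtimes> ?BC) D) a"
    unfolding g1_def by (rule strict_tens_fun_id) (simp_all add: sa)
  \<comment> \<open>Currying the tensor of \<open>a\<close> with the identity gives
    \<open>eta\<close> after \<open>a\<close>; this \<open>eta\<close> followed by
    \<open>[D, g2]\<close> is the curried \<open>g2\<close>.\<close>
  also have "smf_comp ?ABC (ihom D ?V) (postcomp D ?W ?V g2) (smf_comp ?ABC (ihom D ?W) (eta (A \<boxtimes> ?BC) D) a)
      = smf_comp ?ABC (ihom D ?V) e2 a"
    unfolding e2_def rn_def by (rule smf_comp_assoc[OF sa eta_sm_functor postcomp_functor[OF _ g2]]) simp_all
  also have "smf_comp ?ABC ?DT pg3 (smf_comp ?ABC (ihom D ?V) e2 a) = smf_comp ?ABC ?DT k a"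
    unfolding k_def by (rule smf_comp_assoc[OF sa strict_sm_functor[OF se2] strict_sm_functor[OF spg3]])
  finally have r1: "rn ?ABC D T rhs = smf_comp ?ABC ?DT k a" .
  have sr1: "strict_functor ?ABC ?DT (rn ?ABC D T rhs)"
    unfolding r1 a_def by (rule strict_comp[OF strict_assoc sk]) simp_all
  have r2: "rn ?AB C ?DT (rn ?ABC D T rhs) = smf_comp ?AB ?CDT (postcomp C (A \<boxtimes> ?BC) ?DT k) (rn ?AB C (A \<boxtimes> ?BC) a)"
    unfolding r1 by (rule rn_compose[OF _ _ sa strict_sm_functor[OF sk]]) simp_all
  have sa': "strict_functor ?AB (ihom C (A \<boxtimes> ?BC)) (rn ?AB C (A \<boxtimes> ?BC) a)"
    unfolding a_def rn_assoc[OF assms(1-3)] by (rule En_strict_functor) simp_all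
  have sr2: "strict_functor ?AB ?CDT (rn ?AB C ?DT (rn ?ABC D T rhs))"
    unfolding r2 by (rule strict_comp[OF sa' strict_postcomp[OF _ sk]]) simp_all
  have "rn A B ?CDT (rn ?AB C ?DT (rn ?ABC D T rhs))
      = smf_comp A (ihom B ?CDT) (postcomp B (ihom C (A \<boxtimes> ?BC)) ?CDT (postcomp C (A \<boxtimes> ?BC) ?DT k))
          (rn A B (ihom C (A \<boxtimes> ?BC)) (rn ?AB C (A \<boxtimes> ?BC) a))"
    unfolding r2
    by (rule rn_compose[OF _ _ strict_sm_functor[OF sa'] postcomp_functor[OF _ strict_sm_functor[OF sk]]]) simp_all
  also have "rn A B (ihom C (A \<boxtimes> ?BC)) (rn ?AB C (A \<boxtimes> ?BC) a) = curried_assoc A B C"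
    unfolding a_def by (rule rn_rn_assoc) simp_all
  \<comment> \<open>Absorbs \<open>a\<close>, as \<open>f1\<close> was absorbed on the left-hand
    side.\<close>
  also have "smf_comp A (ihom B ?CDT) (postcomp B (ihom C (A \<boxtimes> ?BC)) ?CDT (postcomp C (A \<boxtimes> ?BC) ?DT k)) (curried_assoc A B C)
      = smf_comp A (ihom B ?CDT) (Rn B C ?DT) (rn A ?BC ?DT k)"
    by (rule curried_assoc_natural) (simp_all add: strict_sm_functor[OF sk])
  also have "rn A ?BC ?DT k = smf_comp A (ihom ?BC ?DT) (postcomp ?BC (ihom D ?V) ?DT pg3) (rn A ?BC (ihom D ?V) e2)"
    unfolding k_def by (rule rn_compose) (simp_all add: strict_sm_functor[OF se2] strict_sm_functor[OF spg3])
  also have "rn A ?BC (ihom D ?V) e2 = curried_assoc A ?BC D"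
    unfolding e2_def g2_def by (rule rn_rn_assoc) simp_all
  \<comment> \<open>Absorbs \<open>g2\<close>, leaving the curried form of
    \<open>g3\<close>.\<close>
  also have "smf_comp A (ihom ?BC ?DT) (postcomp ?BC (ihom D ?V) ?DT pg3) (curried_assoc A ?BC D)
      = smf_comp A (ihom ?BC ?DT) (Rn ?BC D T) (rn A (?BC \<boxtimes> D) T g3)"
    unfolding pg3_def by (rule curried_assoc_natural) (simp_all add: g3)
  \<comment> \<open>The associativity arrow of \<open>B\<close>, \<open>C\<close>, \<open>D\<close>
    survives only through precomposition, behind \<open>eta\<close>.\<close>
  also have "rn A (?BC \<boxtimes> D) T g3 = smf_comp A (ihom (?BC \<boxtimes> D) T)
      (precomp (?BC \<boxtimes> D) (B \<boxtimes> ?CD) T (assoc_fun B C D)) (eta A (B \<boxtimes> ?CD))"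
    unfolding g3_def T_def by (rule strict_tens_id_fun) simp_all
  finally have r3: "rn A B ?CDT (rn ?AB C ?DT (rn ?ABC D T rhs))
    = smf_comp A (ihom B ?CDT) (Rn B C ?DT) (smf_comp A (ihom ?BC ?DT) (Rn ?BC D T)
        (smf_comp A (ihom (?BC \<boxtimes> D) T) (precomp (?BC \<boxtimes> D) (B \<boxtimes> ?CD) T (assoc_fun B C D)) (eta A (B \<boxtimes> ?CD))))" .

  let ?P = "ihom (B \<boxtimes> ?CD) T" and ?Q = "ihom B ?CDT"
  have eta: "sm_functor A ?P (eta A (B \<boxtimes> ?CD))" unfolding T_def by simp
  have pre: "sm_functor ?P (ihom (?BC \<boxtimes> D) T) (precomp (?BC \<boxtimes> D) (B \<boxtimes> ?CD) T (assoc_fun B C D))"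
    by (rule strict_sm_functor[OF strict_precomp]) simp_all
  have Rn1: "sm_functor (ihom (?BC \<boxtimes> D) T) (ihom ?BC ?DT) (Rn ?BC D T)"
    and Rn2: "sm_functor (ihom ?BC ?DT) ?Q (Rn B C ?DT)"
    and Rn3: "sm_functor ?P (ihom B (ihom ?CD T)) (Rn B ?CD T)"
    and Rn4: "sm_functor (ihom B (ihom ?CD T)) ?Q (postcomp B (ihom ?CD T) ?CDT (Rn C D T))"
    by simp_all
  \<comment> \<open>Reassociated so that \<open>eta\<close> acts first, the rest of the right-hand
    side is the left-hand side of \<open>curry_assoc\<close> for \<open>B\<close>, \<open>C\<close>,
    \<open>D\<close> and target \<open>T\<close>; its other side is \<open>[B, Rn]\<close> after
    \<open>Rn\<close>, as in \<open>l3\<close>.\<close>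
  have "rn A B ?CDT (rn ?AB C ?DT (rn ?ABC D T lhs)) = rn A B ?CDT (rn ?AB C ?DT (rn ?ABC D T rhs))"
    unfolding l3 r3 smf_comp_assoc[OF eta pre Rn1] smf_comp_assoc[OF eta smf_comp_functor[OF pre Rn1] Rn2]
      curry_assoc[OF assms(2-4) T]
    using smf_comp_assoc[OF eta Rn3 Rn4] by (simp add: curried_assoc_def T_def)
  \<comment> \<open>The curryings are undone in reverse order, each time between functors already
    known to be strict.\<close>
  then have "rn ?AB C ?DT (rn ?ABC D T lhs) = rn ?AB C ?DT (rn ?ABC D T rhs)"
    by (rule rn_injective[OF _ _ sl2 sr2, rotated 2]) simp_all
  then have "rn ?ABC D T lhs = rn ?ABC D T rhs"
    by (rule rn_injective[OF _ _ sl1 sr1, rotated 2]) simp_all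
  then have "lhs = rhs"
    by (rule rn_injective[OF _ _ sl[unfolded S_def] sr[unfolded S_def], rotated 2]) simp_all
  then show ?thesis using strict_sm_functor[OF sl] strict_sm_functor[OF sr] by blast
qed

end
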